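(* Let $(K,v)$ be a valued field. Every increasing family of valuations in $\mathcal{T}_{\rm sme}$ admits a supremum; that is, for every totally ordered subset $\mathfrak{v}=\{\nu_i\}_{i\in I}$ of $\mathcal{T}_{\rm sme}$ without maximum there exists $\mu\in\mathcal{T}_{\rm sme}$ such that $\nu_i\leq\mu$ for every $i\in I$, and such that whenever $\mu'\in\mathcal{T}_{\rm sme}$ satisfies $\nu_i\leq\mu'$ for every $i\in I$ and $\mu'\leq\mu$, then $\mu'=\mu$.
   Context: Valuations: a valuation on $K[x]$ with values in a totally ordered abelian group $\Lambda$ is a map $\nu:K[x]\to\Lambda_\infty=\Lambda\cup\{\infty\}$ with $\nu(fg)=\nu(f)+\nu(g)$, $\nu(f+g)\geq\min\{\nu(f),\nu(g)\}$, $\nu(1)=0$, $\nu(0)=\infty$; nonzero polynomials may have value $\infty$. $\Gamma_\nu$ denotes the subgroup generated by the finite values. $\Gamma=\Gamma_v$ is the value group of $v$ and $\Gamma_{\mathbb{Q}}=\Gamma\otimes_{\mathbb{Z}}\mathbb{Q}$. The group $\mathbb{R}^{\mathbb{I}}_{\rm lex}$: let $\mathcal{I}$ be the set of non-zero principal convex subgroups of $\Gamma$ (the principal convex subgroup generated by $\gamma$ is the intersection of all convex subgroups containing $\gamma$), totally ordered by decreasing inclusion. For a totally ordered set $J$, the Hahn product $\mathbb{R}^J_{\rm lex}$ is the group of all $y=(y_j)_{j\in J}\in\mathbb{R}^J$ whose support $\{j\mid y_j\neq 0\}$ is well-ordered, with the lexicographic order. ${\rm Init}(\mathcal{I})$ is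 the set of initial segments of $\mathcal{I}$. For $S\in{\rm Init}(\mathcal{I})$ take a formal symbol $i_S$ and let $\mathcal{I}_S=\mathcal{I}\sqcup\{i_S\}$ with $i<i_S$ for $i\in S$ and $i_S<j$ for $j\in\mathcal{I}\setminus S$. Let $\mathbb{I}=\mathcal{I}\sqcup\{i_S\mid S\in{\rm Init}(\mathcal{I})\}$, with the total order extending the order of each $\mathcal{I}_S$ and such that $i_S<i_T$ iff $S\subsetneq T$. Extending by zero, $\mathbb{R}^{\mathcal{I}}_{\rm lex}\subset\mathbb{R}^{\mathcal{I}_S}_{\rm lex}\subset\mathbb{R}^{\mathbb{I}}_{\rm lex}$. Fix a Hahn embedding of ordered groups $\Gamma\hookrightarrow\Gamma_{\mathbb{Q}}\hookrightarrow\mathbb{R}^{\mathcal{I}}_{\rm lex}$ (for $0\neq\gamma\in\Gamma$ the least index in the support of its image is the principal convex subgroup generated by $\gamma$), and regard it as an inclusion, so $v$ takes values in $\mathbb{R}^{\mathcal I}_{\rm lex}\cup\{\infty\}$. Let $\mathbb{R}_{\rm sme}=\bigcup_{S\in{\rm Init}(\mathcal{I})}\mathbb{R}^{\mathcal{I}_S}_{\rm lex}\subset\mathbb{R}^{\mathbb{I}}_{\rm lex}$. For $\alpha,\beta\in\mathbb{R}_{\rm sme}$ write $\alpha\sim_{\rm sme}\beta$ if there is an isomorphism of ordered groups $\langle\Gamma,\alpha\rangle\to\langle\Gamma,\beta\rangle$ sending $\alpha$ to $\beta$ and being the identity on $\Gamma$. Equivalently (known), $\{\gamma\in\Gamma_{\mathbb{Q}}\mid\gamma\leq\alpha\}=\{\gamma\in\Gamma_{\mathbb{Q}}\mid\gamma\leq\beta\}$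 and $\{\gamma\in\Gamma_{\mathbb{Q}}\mid\gamma\geq\alpha\}=\{\gamma\in\Gamma_{\mathbb{Q}}\mid\gamma\geq\beta\}$. Fix $\Gamma_{\rm sme}\subset\mathbb{R}_{\rm sme}$, any set of representatives (exactly one from each class) of $\mathbb{R}_{\rm sme}/\!\sim_{\rm sme}$; one has $\Gamma_{\mathbb{Q}}\subset\Gamma_{\rm sme}$. $\mathcal{T}_{\mathbb{R}_{\rm sme}}$ is the set of valuations $\nu:K[x]\to(\mathbb{R}^{\mathbb{I}}_{\rm lex})_\infty$ with $\nu|_K=v$ and $\Gamma_\nu\subset\mathbb{R}^{\mathcal{I}_S}_{\rm lex}$ for some $S\in{\rm Init}(\mathcal{I})$, partially ordered by $\mu\leq\nu$ iff $\mu(f)\leq\nu(f)$ for all $f\in K[x]$. Key polynomials: the graded algebra of $\nu$ is $\mathcal{G}_\nu=\bigoplus_{\alpha\in\Gamma_\nu}\mathcal{P}_\alpha/\mathcal{P}_\alpha^+$ with $\mathcal{P}_\alpha=\{f\mid\nu(f)\geq\alpha\}$, $\mathcal{P}^+_\alpha=\{f\mid\nu(f)>\alpha\}$; the initial term is ${\rm in}_\nu f=f+\mathcal{P}^+_{\nu(f)}$ if $\nu(f)\neq\infty$ and $0$ otherwise. A monic $\phi\in K[x]$ is a (Mac Lane–Vaquié) key polynomial for $\nu$ if $({\rm in}_\nu\phi)\mathcal{G}_\nu$ is a homogeneous prime ideal containing no initial term ${\rm in}_\nu f$ with $\deg f<\deg\phi$. ${\rm KP}(\nu)$ is the set of key polynomials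 for $\nu$; it is empty exactly when $\nu$ has non-trivial support ($\nu^{-1}(\infty)\neq 0$) or $\nu$ is valuation-algebraic (trivial support, $\Gamma_\nu/\Gamma$ torsion, residue field extension algebraic). If ${\rm KP}(\nu)\neq\emptyset$, put ${\rm sv}(\nu)=\nu(\phi)$ for $\phi\in{\rm KP}(\nu)$ of minimal degree (well defined). $\mathcal{T}_{\rm sme}$ is the set of $\nu\in\mathcal{T}_{\mathbb{R}_{\rm sme}}$ such that either ${\rm KP}(\nu)=\emptyset$, or ${\rm KP}(\nu)\neq\emptyset$ and ${\rm sv}(\nu)\in\Gamma_{\rm sme}$, with the induced order. *)

theory Defs
  imports
    "HOL-Computational_Algebra.Polynomial"
    "HOL-Computational_Algebra.Group_Closure"
    "HOL-Library.Fun_Lexorder"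
    "HOL-Library.Poly_Mapping"
    "HOL-Algebra.QuotRing"
begin

section \<open>Adjoining infinity to an ordered group\<close>

datatype 'l with_inf = Fin 'l | Infty

instantiation with_inf :: (comm_monoid_add) comm_monoid_add
begin

definition zero_with_inf :: "'a with_inf" where
  "0 = Fin 0"

fun plus_with_inf :: "'a with_inf \<Rightarrow> 'a with_inf \<Rightarrow> 'a with_inf" where
  "Fin a + Fin b = Fin (a + b)"
| "Infty + y = Infty"
| "x + Infty = Infty"

instance
proof
  fix a b c :: "'a with_inf"
  show "a + b + c = a + (b + c)" by (cases a; cases b; cases c) (simp_all add: add.assoc)
  show "a + b = b + a" by (cases a; cases b) (simp_all add: add.commute)
  show "0 + a = a" by (cases a) (simp_all add: zero_with_inf_def)
qed

end

instantiation with_inf :: (linorder) linorder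
begin

fun less_eq_with_inf :: "'a with_inf \<Rightarrow> 'a with_inf \<Rightarrow> bool" where
  "Fin a \<le> Fin b \<longleftrightarrow> a \<le> b"
| "x \<le> Infty \<longleftrightarrow> True"
| "Infty \<le> Fin b \<longleftrightarrow> False"

definition less_with_inf :: "'a with_inf \<Rightarrow> 'a with_inf \<Rightarrow> bool" where
  "x < y \<longleftrightarrow> x \<le> y \<and> \<not> y \<le> x" for x y :: "'a with_inf"

instance
proof
  fix x y z :: "'a with_inf"
  show "x < y \<longleftrightarrow> x \<le> y \<and> \<not> y \<le> x" by (rule less_with_inf_def)
  show "x \<le> x" by (cases x) simp_all
  show "x \<le> y \<Longrightarrow> y \<le> z \<Longrightarrow> x \<le> z" by (cases x; cases y; cases z) simp_all
  show "x \<le> y \<Longrightarrow> y \<le> x \<Longrightarrow> x = y" by (cases x; cases y) simp_all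
  show "x \<le> y \<or> y \<le> x" by (cases x; cases y) auto
qed

end

lemma less_with_inf_simps [simp]:
  "Fin a < Fin b \<longleftrightarrow> a < b" "Fin a < Infty" "\<not> Infty < x"
  by (cases x; auto simp: less_with_inf_def)+


section \<open>Valuations\<close>

text \<open>The support \<open>\<nu> -` {Infty}\<close> is allowed to be non-trivial; on a field it is \<open>{0}\<close>
  automatically.\<close>

definition valuation :: "('r::comm_ring_1 \<Rightarrow> 'l::linordered_ab_group_add with_inf) \<Rightarrow> bool" where
  "valuation \<nu> \<longleftrightarrow>
     (\<forall>f g. \<nu> (f * g) = \<nu> f + \<nu> g) \<and>
     (\<forall>f g. min (\<nu> f) (\<nu> g) \<le> \<nu> (f + g)) \<and>
     \<nu> 1 = 0 \<and> \<nu> 0 = Infty"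

definition value_group :: "('r \<Rightarrow> 'l::linordered_ab_group_add with_inf) \<Rightarrow> 'l set" where
  "value_group \<nu> = group_closure {\<alpha>. \<exists>f. \<nu> f = Fin \<alpha>}"


section \<open>The graded algebra\<close>

definition val_ge :: "('r \<Rightarrow> 'l::linordered_ab_group_add with_inf) \<Rightarrow> 'l \<Rightarrow> 'r set" where
  "val_ge \<nu> \<alpha> = {f. Fin \<alpha> \<le> \<nu> f}"

definition val_gt :: "('r \<Rightarrow> 'l::linordered_ab_group_add with_inf) \<Rightarrow> 'l \<Rightarrow> 'r set" where
  "val_gt \<nu> \<alpha> = {f. Fin \<alpha> < \<nu> f}"

text \<open>The direct sum of the quotients \<open>val_ge \<nu> \<alpha> / val_gt \<nu> \<alpha>\<close> over \<open>\<alpha> \<in> value_group \<nu>\<close>, with the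
  multiplication induced by that of the ring, is realised as the quotient of the direct sum of the
  \<open>val_ge \<nu> \<alpha>\<close> by the direct sum of the \<open>val_gt \<nu> \<alpha>\<close>. The former is a subring of the group algebra of
  the value group (finitely supported functions with convolution product), the latter an ideal
  of it.\<close>

definition graded_sum_ge ::
    "('r::comm_ring_1 \<Rightarrow> 'l::linordered_ab_group_add with_inf) \<Rightarrow> ('l \<Rightarrow>\<^sub>0 'r) ring" where
  "graded_sum_ge \<nu> =
     \<lparr> carrier = {p. Poly_Mapping.keys p \<subseteq> value_group \<nu> \<and>
                     (\<forall>\<alpha>. Poly_Mapping.lookup p \<alpha> \<in> val_ge \<nu> \<alpha>)},
       monoid.mult = (*), one = 1, ring.zero = 0, add = (+) \<rparr>"

definition graded_sum_gt ::
    "('r::comm_ring_1 \<Rightarrow> 'l::linordered_ab_group_add with_inf) \<Rightarrow> ('l \<Rightarrow>\<^sub>0 'r) set" where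
  "graded_sum_gt \<nu> =
     {p. Poly_Mapping.keys p \<subseteq> value_group \<nu> \<and> (\<forall>\<alpha>. Poly_Mapping.lookup p \<alpha> \<in> val_gt \<nu> \<alpha>)}"

definition graded_algebra ::
    "('r::comm_ring_1 \<Rightarrow> 'l::linordered_ab_group_add with_inf) \<Rightarrow> ('l \<Rightarrow>\<^sub>0 'r) set ring" where
  "graded_algebra \<nu> = graded_sum_ge \<nu> Quot graded_sum_gt \<nu>"

definition graded_class ::
    "('r::comm_ring_1 \<Rightarrow> 'l::linordered_ab_group_add with_inf) \<Rightarrow> ('l \<Rightarrow>\<^sub>0 'r) \<Rightarrow> ('l \<Rightarrow>\<^sub>0 'r) set" where
  "graded_class \<nu> p = graded_sum_gt \<nu> +>\<^bsub>graded_sum_ge \<nu>\<^esub> p"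

definition initial_term ::
    "('r::comm_ring_1 \<Rightarrow> 'l::linordered_ab_group_add with_inf) \<Rightarrow> 'r \<Rightarrow> ('l \<Rightarrow>\<^sub>0 'r) set" where
  "initial_term \<nu> f =
     (case \<nu> f of Fin \<alpha> \<Rightarrow> graded_class \<nu> (Poly_Mapping.single \<alpha> f)
      | Infty \<Rightarrow> \<zero>\<^bsub>graded_algebra \<nu>\<^esub>)"

text \<open>A subset is homogeneous if it contains the homogeneous components of its elements.\<close>

definition homogeneous ::
    "('r::comm_ring_1 \<Rightarrow> 'l::linordered_ab_group_add with_inf) \<Rightarrow> ('l \<Rightarrow>\<^sub>0 'r) set set \<Rightarrow> bool" where
  "homogeneous \<nu> J \<longleftrightarrow>
     (\<forall>p \<in> carrier (graded_sum_ge \<nu>). graded_class \<nu> p \<in> J \<longrightarrow>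
        (\<forall>\<alpha>. graded_class \<nu> (Poly_Mapping.single \<alpha> (Poly_Mapping.lookup p \<alpha>)) \<in> J))"

text \<open>The remaining facts of this section confirm that the algebraic structures above are what
  their names say.\<close>

lemma valuation_uminus:
  assumes "valuation \<nu>"
  shows "\<nu> (- f) = \<nu> f"
proof -
  have "\<nu> (- 1) + \<nu> (- 1) = \<nu> ((- 1) * (- 1))"
    using assms unfolding valuation_def by metis
  also have "\<dots> = 0"
    using assms by (simp add: valuation_def)
  finally have sq: "\<nu> (- 1) + \<nu> (- 1) = 0" .
  have "\<nu> (- 1) = 0"
  proof (cases "\<nu> (- 1)")
    case (Fin a)
    with sq show ?thesis by (simp add: zero_with_inf_def)
  next
    case Infty
    with sq show ?thesis by (simp add: zero_with_inf_def)
  qed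
  moreover have "\<nu> (- f) = \<nu> (- 1) + \<nu> f"
    using assms unfolding valuation_def by (metis mult_minus1)
  ultimately show ?thesis by simp
qed

lemma val_ge_closed:
  assumes "valuation \<nu>"
  shows "0 \<in> val_ge \<nu> \<alpha>" "1 \<in> val_ge \<nu> 0"
    and "f \<in> val_ge \<nu> \<alpha> \<Longrightarrow> - f \<in> val_ge \<nu> \<alpha>"
    and "f \<in> val_ge \<nu> \<alpha> \<Longrightarrow> g \<in> val_ge \<nu> \<alpha> \<Longrightarrow> f + g \<in> val_ge \<nu> \<alpha>"
    and "f \<in> val_ge \<nu> \<alpha> \<Longrightarrow> g \<in> val_ge \<nu> \<beta> \<Longrightarrow> f * g \<in> val_ge \<nu> (\<alpha> + \<beta>)"
proof -
  note v = assms[unfolded valuation_def]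
  show "0 \<in> val_ge \<nu> \<alpha>" "1 \<in> val_ge \<nu> 0"
    using v by (simp_all add: val_ge_def zero_with_inf_def)
  show "f \<in> val_ge \<nu> \<alpha> \<Longrightarrow> - f \<in> val_ge \<nu> \<alpha>"
    by (simp add: val_ge_def valuation_uminus[OF assms])
  show "f + g \<in> val_ge \<nu> \<alpha>" if "f \<in> val_ge \<nu> \<alpha>" "g \<in> val_ge \<nu> \<alpha>"
  proof -
    have "Fin \<alpha> \<le> min (\<nu> f) (\<nu> g)" using that by (simp add: val_ge_def)
    then show ?thesis using v order_trans unfolding val_ge_def by blast
  qed
  show "f * g \<in> val_ge \<nu> (\<alpha> + \<beta>)" if "f \<in> val_ge \<nu> \<alpha>" "g \<in> val_ge \<nu> \<beta>"
    using that v
    by (cases "\<nu> f"; cases "\<nu> g") (auto simp: val_ge_def add_mono)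
qed

lemma val_gt_closed:
  assumes "valuation \<nu>"
  shows "0 \<in> val_gt \<nu> \<alpha>"
    and "f \<in> val_gt \<nu> \<alpha> \<Longrightarrow> - f \<in> val_gt \<nu> \<alpha>"
    and "f \<in> val_gt \<nu> \<alpha> \<Longrightarrow> g \<in> val_gt \<nu> \<alpha> \<Longrightarrow> f + g \<in> val_gt \<nu> \<alpha>"
    and "f \<in> val_ge \<nu> \<alpha> \<Longrightarrow> g \<in> val_gt \<nu> \<beta> \<Longrightarrow> f * g \<in> val_gt \<nu> (\<alpha> + \<beta>)"
proof -
  note v = assms[unfolded valuation_def]
  show "0 \<in> val_gt \<nu> \<alpha>"
    using v by (simp add: val_gt_def)
  show "f \<in> val_gt \<nu> \<alpha> \<Longrightarrow> - f \<in> val_gt \<nu> \<alpha>"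
    by (simp add: val_gt_def valuation_uminus[OF assms])
  show "f + g \<in> val_gt \<nu> \<alpha>" if "f \<in> val_gt \<nu> \<alpha>" "g \<in> val_gt \<nu> \<alpha>"
  proof -
    have "Fin \<alpha> < min (\<nu> f) (\<nu> g)" using that by (simp add: val_gt_def)
    then show ?thesis using v less_le_trans unfolding val_gt_def by blast
  qed
  show "f * g \<in> val_gt \<nu> (\<alpha> + \<beta>)" if "f \<in> val_ge \<nu> \<alpha>" "g \<in> val_gt \<nu> \<beta>"
    using that v
    by (cases "\<nu> f"; cases "\<nu> g") (auto simp: val_ge_def val_gt_def add_le_less_mono)
qed

lemma val_gt_le_val_ge: "val_gt \<nu> \<alpha> \<subseteq> val_ge \<nu> \<alpha>"
  by (auto simp: val_gt_def val_ge_def)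

lemma lookup_times_closed:
  fixes p q :: "'l::comm_monoid_add \<Rightarrow>\<^sub>0 'r::comm_ring_1"
  assumes zero: "\<And>\<alpha>. 0 \<in> C \<alpha>"
    and add: "\<And>\<alpha> f g. f \<in> C \<alpha> \<Longrightarrow> g \<in> C \<alpha> \<Longrightarrow> f + g \<in> C \<alpha>"
    and mult: "\<And>\<alpha> \<beta>. Poly_Mapping.lookup p \<alpha> * Poly_Mapping.lookup q \<beta> \<in> C (\<alpha> + \<beta>)"
  shows "Poly_Mapping.lookup (p * q) \<alpha> \<in> C \<alpha>"
proof -
  have sum: "sum F A \<in> C \<alpha>" if "finite A" "\<And>x. x \<in> A \<Longrightarrow> F x \<in> C \<alpha>" for F :: "'l \<Rightarrow> 'r" and A
    using that by (induction A rule: finite_induct) (auto intro: zero add)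
  have inner: "Sum_any (\<lambda>m. Poly_Mapping.lookup q m when \<alpha> = l + m)
      = (\<Sum>m \<in> Poly_Mapping.keys q. Poly_Mapping.lookup q m when \<alpha> = l + m)" for l
    by (rule Sum_any.expand_superset) (auto simp: in_keys_iff)
  have "Poly_Mapping.lookup (p * q) \<alpha> =
     Sum_any (\<lambda>l. Poly_Mapping.lookup p l * Sum_any (\<lambda>m. Poly_Mapping.lookup q m when \<alpha> = l + m))"
    by (simp add: lookup_mult)
  also have "\<dots> = (\<Sum>l \<in> Poly_Mapping.keys p.
      Poly_Mapping.lookup p l * Sum_any (\<lambda>m. Poly_Mapping.lookup q m when \<alpha> = l + m))"
    by (rule Sum_any.expand_superset) (auto simp: in_keys_iff)
  also have "\<dots> = (\<Sum>l \<in> Poly_Mapping.keys p. \<Sum>m \<in> Poly_Mapping.keys q.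
      Poly_Mapping.lookup p l * (Poly_Mapping.lookup q m when \<alpha> = l + m))"
    by (simp add: inner sum_distrib_left)
  finally have eq: "Poly_Mapping.lookup (p * q) \<alpha> = (\<Sum>l \<in> Poly_Mapping.keys p.
      \<Sum>m \<in> Poly_Mapping.keys q.
        Poly_Mapping.lookup p l * (Poly_Mapping.lookup q m when \<alpha> = l + m))" .
  show ?thesis
    unfolding eq by (intro sum finite_keys) (auto simp: when_def zero mult)
qed

lemma keys_times_closed:
  fixes p q :: "'l::linordered_ab_group_add \<Rightarrow>\<^sub>0 'r::comm_ring_1"
  assumes "Poly_Mapping.keys p \<subseteq> group_closure S" "Poly_Mapping.keys q \<subseteq> group_closure S"
  shows "Poly_Mapping.keys (p * q) \<subseteq> group_closure S"
  using assms keys_mult[of p q] by (auto intro!: group_closure_add)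

lemma cring_graded_sum_ge:
  assumes "valuation \<nu>"
  shows "cring (graded_sum_ge \<nu>)"
proof -
  let ?R = "graded_sum_ge \<nu>"
  note c = val_ge_closed[OF assms]
  have ops: "x \<oplus>\<^bsub>?R\<^esub> y = x + y" "x \<otimes>\<^bsub>?R\<^esub> y = x * y" "\<zero>\<^bsub>?R\<^esub> = 0" "\<one>\<^bsub>?R\<^esub> = 1" for x y
    by (simp_all add: graded_sum_ge_def)
  have add: "p + q \<in> carrier ?R" if "p \<in> carrier ?R" "q \<in> carrier ?R" for p q
    using that Poly_Mapping.keys_add[of p q] by (auto simp: graded_sum_ge_def lookup_add c)
  have mult: "p * q \<in> carrier ?R" if "p \<in> carrier ?R" "q \<in> carrier ?R" for p q
  proof -
    have "Poly_Mapping.keys (p * q) \<subseteq> value_group \<nu>"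
      using that unfolding value_group_def
      by (intro keys_times_closed) (simp_all add: graded_sum_ge_def value_group_def)
    moreover have "Poly_Mapping.lookup (p * q) \<alpha> \<in> val_ge \<nu> \<alpha>" for \<alpha>
      using that by (intro lookup_times_closed c) (simp_all add: graded_sum_ge_def)
    ultimately show ?thesis by (simp add: graded_sum_ge_def)
  qed
  have um: "- p \<in> carrier ?R" if "p \<in> carrier ?R" for p
    using that by (auto simp: graded_sum_ge_def c)
  have z: "0 \<in> carrier ?R"
    by (simp add: graded_sum_ge_def c)
  have o: "1 \<in> carrier ?R"
    by (auto simp: graded_sum_ge_def c lookup_one when_def value_group_def)
  show ?thesis
  proof (rule cringI)
    show "abelian_group ?R"
    proof (rule abelian_groupI)
      show "\<exists>y \<in> carrier ?R. y \<oplus>\<^bsub>?R\<^esub> x = \<zero>\<^bsub>?R\<^esub>" if "x \<in> carrier ?R" for x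
        using um[OF that] by (intro bexI[of _ "- x"]) (simp_all add: ops)
    qed (simp_all add: ops add z add.assoc add.commute)
    show "Group.comm_monoid ?R"
      by (rule comm_monoidI) (simp_all add: ops mult o algebra_simps)
  qed (simp_all add: ops algebra_simps)
qed

lemma ideal_graded_sum_gt:
  assumes "valuation \<nu>"
  shows "ideal (graded_sum_gt \<nu>) (graded_sum_ge \<nu>)"
proof -
  let ?R = "graded_sum_ge \<nu>" and ?I = "graded_sum_gt \<nu>"
  interpret cring ?R by (rule cring_graded_sum_ge[OF assms])
  note c = val_gt_closed[OF assms]
  have sub: "?I \<subseteq> carrier ?R"
    using val_gt_le_val_ge by (fastforce simp: graded_sum_ge_def graded_sum_gt_def)
  have um: "- p \<in> ?I" if "p \<in> ?I" for p
    using that by (auto simp: graded_sum_gt_def c)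
  have add: "p + q \<in> ?I" if "p \<in> ?I" "q \<in> ?I" for p q
    using that Poly_Mapping.keys_add[of p q] by (auto simp: graded_sum_gt_def lookup_add c)
  have z: "0 \<in> ?I"
    by (simp add: graded_sum_gt_def c)
  have mult: "p * q \<in> ?I" if "p \<in> carrier ?R" "q \<in> ?I" for p q
  proof -
    have "Poly_Mapping.keys (p * q) \<subseteq> value_group \<nu>"
      using that unfolding value_group_def
      by (intro keys_times_closed) (simp_all add: graded_sum_ge_def graded_sum_gt_def value_group_def)
    moreover have "Poly_Mapping.lookup (p * q) \<alpha> \<in> val_gt \<nu> \<alpha>" for \<alpha>
      using that by (intro lookup_times_closed c) (simp_all add: graded_sum_ge_def graded_sum_gt_def)
    ultimately show ?thesis by (simp add: graded_sum_gt_def)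
  qed
  have inv: "inv\<^bsub>add_monoid ?R\<^esub> p = - p" if "p \<in> ?I" for p
  proof -
    have "\<ominus>\<^bsub>?R\<^esub> p = - p"
      using sub um[OF that] that by (intro minus_equality) (auto simp: graded_sum_ge_def)
    then show ?thesis by (simp add: a_inv_def)
  qed
  have "subgroup ?I (add_monoid ?R)"
  proof (rule group.subgroupI[OF a_group])
    show "?I \<noteq> {}" using z by blast
    show "?I \<subseteq> carrier (add_monoid ?R)" using sub by simp
    show "inv\<^bsub>add_monoid ?R\<^esub> a \<in> ?I" if "a \<in> ?I" for a using um[OF that] inv[OF that] by simp
    show "a \<otimes>\<^bsub>add_monoid ?R\<^esub> b \<in> ?I" if "a \<in> ?I" "b \<in> ?I" for a b
      using add[OF that] by (simp add: graded_sum_ge_def)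
  qed
  then show ?thesis
  proof (intro idealI ring_axioms)
    fix p q assume *: "p \<in> ?I" "q \<in> carrier ?R"
    have "q * p \<in> ?I" by (rule mult[OF *(2,1)])
    then show "q \<otimes>\<^bsub>?R\<^esub> p \<in> ?I" "p \<otimes>\<^bsub>?R\<^esub> q \<in> ?I"
      by (simp_all add: graded_sum_ge_def mult.commute)
  qed
qed

lemma cring_graded_algebra: "valuation \<nu> \<Longrightarrow> cring (graded_algebra \<nu>)"
  unfolding graded_algebra_def
  by (intro ideal.quotient_is_cring ideal_graded_sum_gt cring_graded_sum_ge)


section \<open>Key polynomials\<close>

text \<open>The ideal generated by the initial term is required to be non-zero: this is what makes
  the set of key polynomials empty if \<open>\<nu>\<close> has non-trivial support. It only excludes polynomials of
  value \<open>Infty\<close>. In the minimality condition \<open>f = 0\<close> has to be excluded, its degree being \<open>0\<close> here.\<close>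

definition KP :: "('k::field poly \<Rightarrow> 'l::linordered_ab_group_add with_inf) \<Rightarrow> 'k poly set" where
  "KP \<nu> = {\<phi>. lead_coeff \<phi> = 1 \<and>
     (let J = PIdl\<^bsub>graded_algebra \<nu>\<^esub> (initial_term \<nu> \<phi>) in
        J \<noteq> {\<zero>\<^bsub>graded_algebra \<nu>\<^esub>} \<and>
        primeideal J (graded_algebra \<nu>) \<and> homogeneous \<nu> J \<and>
        (\<forall>f. f \<noteq> 0 \<longrightarrow> degree f < degree \<phi> \<longrightarrow> initial_term \<nu> f \<notin> J))}"

definition sv :: "('k::field poly \<Rightarrow> 'l::linordered_ab_group_add with_inf) \<Rightarrow> 'l with_inf" where
  "sv \<nu> = \<nu> (ARG_MIN degree \<phi>. \<phi> \<in> KP \<nu>)"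


section \<open>Hahn products\<close>

typedef (overloaded) 'i hahn = "{y :: 'i::linorder \<Rightarrow> real. wfp_on {i. y i \<noteq> 0} (<)}"
  morphisms coord Abs_hahn
  by (rule exI[of _ "\<lambda>_. 0"]) (simp add: wfp_on_iff_ex_minimal)

setup_lifting type_definition_hahn

definition supp :: "'i::linorder hahn \<Rightarrow> 'i set" where
  "supp y = {i. coord y i \<noteq> 0}"

lemma wfp_on_less_union:
  fixes A B :: "'i::linorder set"
  assumes "wfp_on A (<)" "wfp_on B (<)" "C \<subseteq> A \<union> B"
  shows "wfp_on C (<)"
  unfolding wfp_on_iff_ex_minimal
proof (intro allI impI)
  fix D assume D: "D \<subseteq> C" "D \<noteq> {}"
  show "\<exists>z\<in>D. \<forall>y. y < z \<longrightarrow> y \<notin> D"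
  proof (cases "D \<inter> A = {}")
    case True
    with D assms(3) have "D \<subseteq> B" by blast
    then show ?thesis using assms(2) D by (simp add: wfp_on_iff_ex_minimal)
  next
    case False
    then obtain a where a: "a \<in> D \<inter> A" "\<And>y. y < a \<Longrightarrow> y \<notin> D \<inter> A"
      using assms(1) unfolding wfp_on_iff_ex_minimal by (metis inf_le2)
    show ?thesis
    proof (cases "D \<inter> B = {}")
      case True
      with D a assms(3) show ?thesis by blast
    next
      case False
      then obtain b where b: "b \<in> D \<inter> B" "\<And>y. y < b \<Longrightarrow> y \<notin> D \<inter> B"
        using assms(2) unfolding wfp_on_iff_ex_minimal by (metis inf_le2)
      have "min a b \<in> D" using a b by (simp add: min_def)
      moreover have "y \<notin> D" if "y < min a b" for y
        using that a b D assms(3) by auto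
      ultimately show ?thesis by blast
    qed
  qed
qed

instantiation hahn :: (linorder) linordered_ab_group_add
begin

lift_definition zero_hahn :: "'a hahn" is "\<lambda>_. 0"
  by (simp add: wfp_on_iff_ex_minimal)

lift_definition plus_hahn :: "'a hahn \<Rightarrow> 'a hahn \<Rightarrow> 'a hahn" is "\<lambda>x y i. x i + y i"
  by (erule (1) wfp_on_less_union) auto

lift_definition uminus_hahn :: "'a hahn \<Rightarrow> 'a hahn" is "\<lambda>x i. - x i"
  by simp

lift_definition minus_hahn :: "'a hahn \<Rightarrow> 'a hahn \<Rightarrow> 'a hahn" is "\<lambda>x y i. x i - y i"
  by (erule (1) wfp_on_less_union) auto

lift_definition less_hahn :: "'a hahn \<Rightarrow> 'a hahn \<Rightarrow> bool" is less_fun .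

definition less_eq_hahn :: "'a hahn \<Rightarrow> 'a hahn \<Rightarrow> bool" where
  "x \<le> y \<longleftrightarrow> x < y \<or> x = y" for x y :: "'a hahn"

instance
proof
  fix a b c :: "'a hahn"
  show "a + b + c = a + (b + c)" by transfer (simp add: add.assoc)
  show "a + b = b + a" by transfer (simp add: add.commute)
  show "0 + a = a" by transfer simp
  show "- a + a = 0" by transfer simp
  show "a - b = a + - b" by transfer simp
  have irrefl: "\<not> a < a" for a :: "'a hahn" by transfer (rule less_fun_irrefl)
  have asym: "a < b \<Longrightarrow> \<not> b < a" for a b :: "'a hahn" by transfer (rule less_fun_asym)
  have trans: "a < b \<Longrightarrow> b < c \<Longrightarrow> a < c" for a b c :: "'a hahn" by transfer (rule less_fun_trans)
  show "a < b \<longleftrightarrow> a \<le> b \<and> \<not> b \<le> a" using asym irrefl by (auto simp: less_eq_hahn_def)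
  show "a \<le> a" by (simp add: less_eq_hahn_def)
  show "a \<le> b \<Longrightarrow> b \<le> c \<Longrightarrow> a \<le> c" using trans by (auto simp: less_eq_hahn_def)
  show "a \<le> b \<Longrightarrow> b \<le> a \<Longrightarrow> a = b" using asym by (auto simp: less_eq_hahn_def)
  have "a < b \<Longrightarrow> c + a < c + b" by transfer (simp add: less_fun_def)
  then show "a \<le> b \<Longrightarrow> c + a \<le> c + b" by (auto simp: less_eq_hahn_def)
  have "a < b \<or> a = b \<or> b < a"
  proof transfer
    fix a b :: "'a \<Rightarrow> real"
    assume a: "wfp_on {i. a i \<noteq> 0} (<)" and b: "wfp_on {i. b i \<noteq> 0} (<)"
    have wf: "wfp_on {i. a i \<noteq> b i} (<)" by (rule wfp_on_less_union[OF a b]) auto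
    show "less_fun a b \<or> a = b \<or> less_fun b a"
    proof (cases "a = b")
      case False
      then have "{i. a i \<noteq> b i} \<noteq> {}" by auto
      with wf[unfolded wfp_on_iff_ex_minimal, rule_format, OF order_refl]
      obtain m where m: "a m \<noteq> b m" "\<And>y. y < m \<Longrightarrow> a y = b y"
        by auto
      show ?thesis
      proof (cases "a m < b m")
        case True
        with m(2) have "less_fun a b" by (auto simp: less_fun_def)
        then show ?thesis by simp
      next
        case False
        with m have "b m < a m" "\<And>y. y < m \<Longrightarrow> b y = a y" by auto
        then have "less_fun b a" by (auto simp: less_fun_def)
        then show ?thesis by simp
      qed
    qed simp
  qed
  then show "a \<le> b \<or> b \<le> a" by (auto simp: less_eq_hahn_def)
qed

end


section \<open>The index set of small extensions\<close>

definition convex_subgroup :: "'g::linordered_ab_group_add set \<Rightarrow> bool" where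
  "convex_subgroup H \<longleftrightarrow>
     0 \<in> H \<and> (\<forall>a\<in>H. \<forall>b\<in>H. a - b \<in> H) \<and> (\<forall>a\<in>H. \<forall>b\<in>H. \<forall>x. a \<le> x \<and> x \<le> b \<longrightarrow> x \<in> H)"

definition principal_convex :: "'g::linordered_ab_group_add \<Rightarrow> 'g set" where
  "principal_convex \<gamma> = \<Inter> {H. convex_subgroup H \<and> \<gamma> \<in> H}"

definition levels :: "'g::linordered_ab_group_add set set" where
  "levels = {H. (\<exists>\<gamma>. H = principal_convex \<gamma>) \<and> H \<noteq> {0}}"

text \<open>Levels are ordered by decreasing inclusion: \<open>H\<close> precedes \<open>H'\<close> iff \<open>H' \<subseteq> H\<close>.\<close>

definition initial_segments :: "'g::linordered_ab_group_add set set set" where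
  "initial_segments = {S. S \<subseteq> levels \<and> (\<forall>H\<in>S. \<forall>H'\<in>levels. H \<subseteq> H' \<longrightarrow> H' \<in> S)}"

lemma convex_subgroup_total:
  assumes "convex_subgroup G" "convex_subgroup H"
  shows "G \<subseteq> H \<or> H \<subseteq> G"
proof (rule ccontr)
  assume "\<not> ?thesis"
  then obtain a b where ab: "a \<in> G" "a \<notin> H" "b \<in> H" "b \<notin> G" by blast
  have neg: "- x \<in> L" if "convex_subgroup L" "x \<in> L" for x :: 'a and L
    using that unfolding convex_subgroup_def by (metis diff_0)
  define m :: "'a \<Rightarrow> 'a" where "m x = max x (- x)" for x
  have m: "x \<in> L" if L: "convex_subgroup L" and y: "y \<in> L" and le: "m x \<le> m y" for x y L
  proof -
    have my: "m y \<in> L" using neg[OF L y] y by (auto simp: m_def max_def)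
    then have "- m y \<in> L" using neg[OF L] by blast
    moreover have "- m y \<le> x" "x \<le> m y" using le by (auto simp: m_def minus_le_iff)
    ultimately show ?thesis using L my unfolding convex_subgroup_def by blast
  qed
  from m[OF assms(1) \<open>a \<in> G\<close>, of b] m[OF assms(2) \<open>b \<in> H\<close>, of a] ab show False
    by (meson linear)
qed

lemma levels_total:
  assumes "G \<in> levels" "H \<in> levels"
  shows "G \<subseteq> H \<or> H \<subseteq> G"
proof -
  have "convex_subgroup (principal_convex \<gamma>)" for \<gamma> :: 'a
  proof -
    have "convex_subgroup (\<Inter> \<H>)" if "\<forall>H\<in>\<H>. convex_subgroup H" for \<H> :: "'a set set"
      unfolding convex_subgroup_def
    proof (intro conjI ballI allI impI)
      show "0 \<in> \<Inter> \<H>" using that by (simp add: convex_subgroup_def)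
    next
      fix a b assume "a \<in> \<Inter> \<H>" "b \<in> \<Inter> \<H>"
      then show "a - b \<in> \<Inter> \<H>" using that by (simp add: convex_subgroup_def)
    next
      fix a b x assume ab: "a \<in> \<Inter> \<H>" "b \<in> \<Inter> \<H>" "a \<le> x \<and> x \<le> b"
      show "x \<in> \<Inter> \<H>"
      proof
        fix H assume "H \<in> \<H>"
        then have "convex_subgroup H" "a \<in> H" "b \<in> H" using that ab by simp_all
        with ab(3) show "x \<in> H" unfolding convex_subgroup_def by metis
      qed
    qed
    then show ?thesis by (simp add: principal_convex_def)
  qed
  then show ?thesis
    using assms convex_subgroup_total unfolding levels_def by auto
qed

text \<open>\<open>Inl H\<close> stands for the level \<open>H\<close>, and \<open>Inr S\<close> for the symbol attached to the initial segment \<open>S\<close>.\<close>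

typedef (overloaded) 'g sme_index =
  "Inl ` levels \<union> Inr ` initial_segments :: ('g::linordered_ab_group_add set + 'g set set) set"
  by (rule exI[of _ "Inr {}"]) (simp add: initial_segments_def)

definition lvl_index :: "'g::linordered_ab_group_add set \<Rightarrow> 'g sme_index" where
  "lvl_index H = Abs_sme_index (Inl H)"

definition cut_index :: "'g::linordered_ab_group_add set set \<Rightarrow> 'g sme_index" where
  "cut_index S = Abs_sme_index (Inr S)"

fun raw_index_le :: "'g set + 'g set set \<Rightarrow> 'g set + 'g set set \<Rightarrow> bool" where
  "raw_index_le (Inl H) (Inl H') \<longleftrightarrow> H' \<subseteq> H"
| "raw_index_le (Inl H) (Inr S) \<longleftrightarrow> H \<in> S"
| "raw_index_le (Inr S) (Inl H) \<longleftrightarrow> H \<notin> S"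
| "raw_index_le (Inr S) (Inr T) \<longleftrightarrow> S \<subseteq> T"

instantiation sme_index :: (linordered_ab_group_add) linorder
begin

definition less_eq_sme_index :: "'a sme_index \<Rightarrow> 'a sme_index \<Rightarrow> bool" where
  "i \<le> j \<longleftrightarrow> raw_index_le (Rep_sme_index i) (Rep_sme_index j)"

definition less_sme_index :: "'a sme_index \<Rightarrow> 'a sme_index \<Rightarrow> bool" where
  "i < j \<longleftrightarrow> i \<le> j \<and> \<not> j \<le> i" for i j :: "'a sme_index"

instance
proof
  fix i j k :: "'a sme_index"
  have cs: "(\<exists>H \<in> levels. Rep_sme_index i = Inl H) \<or> (\<exists>S \<in> initial_segments. Rep_sme_index i = Inr S)"
    for i :: "'a sme_index"
    using Rep_sme_index[of i] by auto
  show "i < j \<longleftrightarrow> i \<le> j \<and> \<not> j \<le> i" by (rule less_sme_index_def)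
  show "i \<le> i" by (cases "Rep_sme_index i") (simp_all add: less_eq_sme_index_def)
  have init: "H' \<in> S" if "S \<in> initial_segments" "H \<in> S" "H' \<in> levels" "H \<subseteq> H'"
    for H H' :: "'a set" and S
    using that unfolding initial_segments_def by blast
  have segm: "H \<in> levels" if "S \<in> initial_segments" "H \<in> S" for H :: "'a set" and S
    using that unfolding initial_segments_def by blast
  have mid: "H' \<subseteq> H" if "S \<in> initial_segments" "H \<in> levels" "H' \<in> levels" "H \<in> S" "H' \<notin> S"
    for H H' :: "'a set" and S
    using that init levels_total by metis
  have seg_total: "S \<subseteq> T \<or> T \<subseteq> S" if "S \<in> initial_segments" "T \<in> initial_segments"
    for S T :: "'a set set"
    using that init segm levels_total by (metis subsetI)
  show "i \<le> k" if "i \<le> j" "j \<le> k"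
    using cs[of i] cs[of j] cs[of k] that unfolding less_eq_sme_index_def
    by (elim disjE bexE; simp) (metis subset_trans init mid seg_total subsetD)+
  show "i = j" if "i \<le> j" "j \<le> i"
  proof -
    have "Rep_sme_index i = Rep_sme_index j"
      using cs[of i] cs[of j] that unfolding less_eq_sme_index_def by auto
    then show ?thesis by (simp add: Rep_sme_index_inject)
  qed
  show "i \<le> j \<or> j \<le> i"
    using cs[of i] cs[of j] unfolding less_eq_sme_index_def
    by (elim disjE bexE) (simp_all add: levels_total seg_total)
qed

end


section \<open>Small extensions of the value group\<close>

text \<open>In this section the type \<open>'g\<close> plays the role of the value group of the base field. All Hahn
  products are taken inside \<open>'g sme_index hahn\<close>, with extension by zero being inclusion.\<close>

definition R_lvl :: "'g::linordered_ab_group_add sme_index hahn set" where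
  "R_lvl = {y. supp y \<subseteq> lvl_index ` levels}"

definition R_cut :: "'g::linordered_ab_group_add set set \<Rightarrow> 'g sme_index hahn set" where
  "R_cut S = {y. supp y \<subseteq> insert (cut_index S) (lvl_index ` levels)}"

definition R_sme :: "'g::linordered_ab_group_add sme_index hahn set" where
  "R_sme = (\<Union>S \<in> initial_segments. R_cut S)"

text \<open>An embedding of the divisible hull of \<open>'g\<close> into the torsion-free divisible group \<open>R_lvl\<close> is the
  same as an embedding of \<open>'g\<close>.\<close>

definition hahn_embedding :: "('g::linordered_ab_group_add \<Rightarrow> 'g sme_index hahn) \<Rightarrow> bool" where
  "hahn_embedding \<iota> \<longleftrightarrow>
     (\<forall>a b. \<iota> (a + b) = \<iota> a + \<iota> b) \<and> strict_mono \<iota> \<and> range \<iota> \<subseteq> R_lvl \<and>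
     (\<forall>\<gamma>. \<gamma> \<noteq> 0 \<longrightarrow> lvl_index (principal_convex \<gamma>) \<in> supp (\<iota> \<gamma>) \<and>
                    (\<forall>i \<in> supp (\<iota> \<gamma>). lvl_index (principal_convex \<gamma>) \<le> i))"

definition sme_equiv ::
    "('g::linordered_ab_group_add \<Rightarrow> 'g sme_index hahn) \<Rightarrow>
     'g sme_index hahn \<Rightarrow> 'g sme_index hahn \<Rightarrow> bool" where
  "sme_equiv \<iota> \<alpha> \<beta> \<longleftrightarrow>
     (\<exists>\<phi>. bij_betw \<phi> (group_closure (insert \<alpha> (range \<iota>))) (group_closure (insert \<beta> (range \<iota>))) \<and>
          (\<forall>x \<in> group_closure (insert \<alpha> (range \<iota>)). \<forall>y \<in> group_closure (insert \<alpha> (range \<iota>)).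
             \<phi> (x + y) = \<phi> x + \<phi> y) \<and>
          strict_mono_on (group_closure (insert \<alpha> (range \<iota>))) \<phi> \<and>
          \<phi> \<alpha> = \<beta> \<and> (\<forall>\<gamma>. \<phi> (\<iota> \<gamma>) = \<iota> \<gamma>))"

definition sme_representatives ::
    "('g::linordered_ab_group_add \<Rightarrow> 'g sme_index hahn) \<Rightarrow> 'g sme_index hahn set \<Rightarrow> bool" where
  "sme_representatives \<iota> \<Gamma>sme \<longleftrightarrow>
     \<Gamma>sme \<subseteq> R_sme \<and> (\<forall>\<alpha> \<in> R_sme. \<exists>!\<beta>. \<beta> \<in> \<Gamma>sme \<and> sme_equiv \<iota> \<alpha> \<beta>)"


section \<open>The trees of valuations\<close>

text \<open>The orders on both sets are the pointwise order of functions.\<close>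

definition T_Rsme ::
    "('k::field \<Rightarrow> 'g::linordered_ab_group_add with_inf) \<Rightarrow> ('g \<Rightarrow> 'g sme_index hahn) \<Rightarrow>
     ('k poly \<Rightarrow> 'g sme_index hahn with_inf) set" where
  "T_Rsme v \<iota> = {\<nu>. valuation \<nu> \<and> (\<forall>a. \<nu> [:a:] = map_with_inf \<iota> (v a)) \<and>
     (\<exists>S \<in> initial_segments. value_group \<nu> \<subseteq> R_cut S)}"

definition T_sme ::
    "('k::field \<Rightarrow> 'g::linordered_ab_group_add with_inf) \<Rightarrow> ('g \<Rightarrow> 'g sme_index hahn) \<Rightarrow>
     'g sme_index hahn set \<Rightarrow> ('k poly \<Rightarrow> 'g sme_index hahn with_inf) set" where
  "T_sme v \<iota> \<Gamma>sme = {\<nu> \<in> T_Rsme v \<iota>. KP \<nu> = {} \<or> sv \<nu> \<in> Fin ` \<Gamma>sme}"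

end

(*
An increasing family either stabilises on every polynomial, and then its pointwise limit is the
supremum, or there is a monic polynomial phi of least degree d on which the values keep growing.
Limit values on polynomials of degree < d are torsion over the value group: if nu < nu' agree
on f, then nu(f) is computed on f mod chi for some chi, and the powers of f mod chi lie in a
finite-dimensional K-vector space. Expansions in powers of phi then give a valuation as
soon as phi receives a value gamma above all nu(phi).

For gamma one takes the representative of the smallest class of R_sme above all nu(phi). It exists
because every cut of the divisible hull Q is filled in R_sme, and it dominates all nu(phi) because
elements of Q are cofinal among them: otherwise two different nu(phi), nu'(phi) would be singular
values of nu, nu' (hence representatives) defining the same cut. As gamma is not torsion, values of
the terms of a phi-expansion are pairwise distinct, so phi is a key polynomial of minimal degree and
gamma is the singular value. The empty family is covered by phi = x and gamma below Q.
*)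

theory Submission
  imports Defs
begin

section \<open>Hahn products as ordered real vector spaces\<close>

text \<open>Only a minimal upper bound is asked for, and minimality is decided by singular values. A
  competitor \<mu>' below \<mu> is squeezed to the limit values in degrees below d, so it can differ
  from \<mu> only through \<gamma>' = \<mu>' \<phi>. No element of Q separates \<gamma>' from
  \<gamma>; so \<gamma>' is not torsion either and is the singular value of \<mu>'. Membership in
  \<open>T_sme\<close> makes it a representative, and a cut has only one. One conflict drives most
  contradictions: by Euclidean division a product q * \<chi> is a difference of terms whose values
  no longer change, although its value has to grow with that of \<chi>. It yields torsion of common
  values, multiplicativity of the limit on remainders, and the bound of the family by the new
  valuation. \<open>sv\<close> evaluates an arbitrarily chosen key polynomial of least degree, so
  all of these must be shown to have the same value. Hahn products are made real vector spaces so
  that Q can be formed inside them, division by integers being scalar multiplication.\<close>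

instantiation hahn :: (linorder) ordered_real_vector
begin

lift_definition scaleR_hahn :: "real \<Rightarrow> 'a hahn \<Rightarrow> 'a hahn" is "\<lambda>c x i. c * x i"
proof -
  fix c :: real and x :: "'a \<Rightarrow> real"
  assume x: "wfp_on {i. x i \<noteq> 0} (<)"
  show "wfp_on {i. c * x i \<noteq> 0} (<)" by (rule wfp_on_less_union[OF x x]) auto
qed

instance
proof
  fix a b :: real and x y :: "'a hahn"
  show "a *\<^sub>R (x + y) = a *\<^sub>R x + a *\<^sub>R y" by transfer (simp add: algebra_simps)
  show "(a + b) *\<^sub>R x = a *\<^sub>R x + b *\<^sub>R x" by transfer (simp add: algebra_simps)
  show "a *\<^sub>R b *\<^sub>R x = (a * b) *\<^sub>R x" by transfer (simp add: algebra_simps)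
  show "1 *\<^sub>R x = x" by transfer simp
  have "x < y \<Longrightarrow> 0 < a \<Longrightarrow> a *\<^sub>R x < a *\<^sub>R y" by transfer (auto simp: less_fun_def)
  moreover have zero: "0 *\<^sub>R x = 0" "c *\<^sub>R 0 = (0 :: 'a hahn)" for c and x :: "'a hahn"
    by (transfer, simp)+
  ultimately show "x \<le> y \<Longrightarrow> 0 \<le> a \<Longrightarrow> a *\<^sub>R x \<le> a *\<^sub>R y"
    by (cases "a = 0") (auto simp: less_eq_hahn_def)
  have "0 < x \<Longrightarrow> a < b \<Longrightarrow> a *\<^sub>R x < b *\<^sub>R x"
    by transfer (force simp: less_fun_def)
  then show "a \<le> b \<Longrightarrow> 0 \<le> x \<Longrightarrow> a *\<^sub>R x \<le> b *\<^sub>R x"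
    by (cases "a = b") (auto simp: less_eq_hahn_def zero)
qed

end

lemma coord_simps [simp]:
  "coord 0 i = 0" "coord (x + y) i = coord x i + coord y i"
  "coord (x - y) i = coord x i - coord y i" "coord (- x) i = - coord x i"
  "coord (c *\<^sub>R x) i = c * coord x i"
  by (simp_all add: zero_hahn.rep_eq plus_hahn.rep_eq minus_hahn.rep_eq uminus_hahn.rep_eq
      scaleR_hahn.rep_eq)

lemma hahn_less_iff:
  "x < y \<longleftrightarrow> (\<exists>k. coord x k < coord y k \<and> (\<forall>j<k. coord x j = coord y j))"
  by transfer (simp add: less_fun_def)

lift_definition hahn_single :: "'i::linorder \<Rightarrow> real \<Rightarrow> 'i hahn" is "\<lambda>k r i. if i = k then r else 0"
proof -
  fix k :: 'i and r :: real
  have "wfp_on {k} (<)" by (auto simp: wfp_on_iff_ex_minimal)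
  then show "wfp_on {i. (if i = k then r else 0) \<noteq> 0} (<)"
    by (rule wfp_on_less_union[of _ "{k}"]) (auto simp: \<open>wfp_on {k} (<)\<close>)
qed

lemma coord_hahn_single [simp]: "coord (hahn_single k r) i = (if i = k then r else 0)"
  by transfer simp


section \<open>Filling cuts\<close>

lemma lvl_index_le_iff [simp]:
  assumes "H \<in> levels" "H' \<in> levels"
  shows "lvl_index H \<le> lvl_index H' \<longleftrightarrow> H' \<subseteq> H"
  using assms by (simp add: less_eq_sme_index_def lvl_index_def Abs_sme_index_inverse)

lemma lvl_less_cut_iff:
  assumes "H \<in> levels" "S \<in> initial_segments"
  shows "lvl_index H < cut_index S \<longleftrightarrow> H \<in> S"
  using assms by (simp add: less_sme_index_def less_eq_sme_index_def lvl_index_def cut_index_def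
      Abs_sme_index_inverse)

lemma lvl_ne_cut:
  assumes "H \<in> levels" "S \<in> initial_segments"
  shows "lvl_index H \<noteq> cut_index S"
  using assms by (simp add: lvl_index_def cut_index_def Abs_sme_index_inject)

text \<open>The new symbols sit exactly in the gaps between levels: the initial segment of levels
  indexed by D has its symbol above all of D and below every other level.\<close>

lemma down_closed_cut_index:
  assumes "D \<subseteq> lvl_index ` levels" "\<And>i j. i \<in> D \<Longrightarrow> j \<in> lvl_index ` levels \<Longrightarrow> j \<le> i \<Longrightarrow> j \<in> D"
  obtains S where "S \<in> initial_segments"
    "\<And>i. i \<in> lvl_index ` levels \<Longrightarrow> i < cut_index S \<longleftrightarrow> i \<in> D"
    "\<And>i. i \<in> lvl_index ` levels \<Longrightarrow> i \<noteq> cut_index S"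
proof
  define S where "S = {H \<in> levels. lvl_index H \<in> D}"
  show S: "S \<in> initial_segments"
    using assms unfolding initial_segments_def S_def by auto
  show "i < cut_index S \<longleftrightarrow> i \<in> D" if "i \<in> lvl_index ` levels" for i
    using that lvl_less_cut_iff[OF _ S] by (auto simp: S_def)
  show "i \<noteq> cut_index S" if "i \<in> lvl_index ` levels" for i
    using that lvl_ne_cut[OF _ S] by auto
qed

text \<open>The filling element follows the common coordinates of ever closer pairs \<open>a < b\<close>; where
  this stops, either the new index or a real supremum at the next level separates the rest.\<close>

proposition R_sme_fills_cuts:
  fixes A B :: "'g::linordered_ab_group_add sme_index hahn set"
  assumes A: "A \<subseteq> R_lvl" and B: "B \<subseteq> R_lvl" and AB: "\<And>a b. a \<in> A \<Longrightarrow> b \<in> B \<Longrightarrow> a < b"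
  obtains \<beta> where "\<beta> \<in> R_sme" "\<And>a. a \<in> A \<Longrightarrow> a < \<beta>" "\<And>b. b \<in> B \<Longrightarrow> \<beta> < b"
proof -
  note result = that

  \<comment> \<open>The common coordinates of A and B\<close>
  define Lv where "Lv = (lvl_index ` levels :: 'g sme_index set)"
  have nonlvl: "coord a k = 0" if "a \<in> A \<union> B" "k \<notin> Lv" for a k
    using that A B by (auto simp: R_lvl_def supp_def Lv_def)
  \<comment> \<open>Levels up to which some a in A and some b in B still coincide; there the
    coordinates of any element between A and B are forced.\<close>
  define D where "D = {i \<in> Lv. \<exists>a\<in>A. \<exists>b\<in>B. \<forall>k\<le>i. coord a k = coord b k}"
  have Ddown: "j \<in> D" if "i \<in> D" "j \<in> Lv" "j \<le> i" for i j
    using that by (auto simp: D_def) (meson order_trans)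
  obtain S where S: "S \<in> initial_segments" and
    Sless: "\<And>i. i \<in> Lv \<Longrightarrow> i < cut_index S \<longleftrightarrow> i \<in> D" and
    Sne: "\<And>i. i \<in> Lv \<Longrightarrow> i \<noteq> cut_index S"
  proof (rule down_closed_cut_index[of D])
    show "D \<subseteq> lvl_index ` levels" by (auto simp: D_def Lv_def)
    show "j \<in> D" if "i \<in> D" "j \<in> lvl_index ` levels" "j \<le> i" for i j
      using Ddown that by (simp add: Lv_def)
  qed (simp add: Lv_def)
  let ?c = "cut_index S"
  define wit where "wit i a \<longleftrightarrow> a \<in> A \<and> (\<exists>b\<in>B. \<forall>k\<le>i. coord a k = coord b k)" for i a
  have wit_ex: "\<exists>a. wit i a" if "i \<in> D" for i using that by (auto simp: D_def wit_def)
  \<comment> \<open>If witnesses a < a' first differed at m \<le> k, the partner b of a would agree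
    with a up to m, so b < a', contradicting A < B.\<close>
  have wit_uniq: "coord a k = coord a' k" if "wit i a" "wit i' a'" "k \<le> i" "k \<le> i'" for a a' i i' k
  proof -
    have *: "coord a k = coord a' k" if w: "wit i a" "wit i' a'" "k \<le> i" "k \<le> i'" and le: "a \<le> a'"
      for a a' i i'
    proof (rule ccontr)
      assume ne: "coord a k \<noteq> coord a' k"
      then have "a < a'" using le by (auto simp: order_le_less)
      then obtain m where m: "coord a m < coord a' m" "\<forall>j<m. coord a j = coord a' j"
        by (auto simp: hahn_less_iff)
      then have "m \<le> k" using ne by (meson leI)
      obtain b where b: "b \<in> B" "\<forall>k\<le>i. coord a k = coord b k" using w by (auto simp: wit_def)
      have "coord b m < coord a' m" "\<forall>j<m. coord b j = coord a' j"
        using b(2) m \<open>m \<le> k\<close> w(3) by (metis order_trans, metis order_trans less_imp_le)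
      then have "b < a'" by (auto simp: hahn_less_iff)
      moreover have "a' < b" using AB b w by (auto simp: wit_def)
      ultimately show False by simp
    qed
    show ?thesis using *[OF that] *[OF that(2,1,4,3)] by (metis linear)
  qed
  define y where "y = Abs_hahn (\<lambda>k. if k \<in> D then coord (SOME a. wit k a) k else 0)"
  have wf_coord: "wfp_on {i. coord a i \<noteq> 0} (<)" for a :: "'g sme_index hahn"
    using coord[of a] by simp
  have raw: "(if k \<in> D then coord (SOME a. wit k a) k else 0) = coord a k"
    if "wit i a" "i \<in> D" "k \<le> i" for i a k
  proof (cases "k \<in> Lv")
    case True
    then have "k \<in> D" using Ddown that by blast
    then show ?thesis using wit_uniq[OF someI_ex[OF wit_ex[OF \<open>k \<in> D\<close>]] that(1)] that by simp
  next
    case False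
    then show ?thesis using nonlvl[of a k] that by (auto simp: wit_def D_def)
  qed
  have coord_y: "coord y k = (if k \<in> D then coord (SOME a. wit k a) k else 0)" for k
  proof -
    \<comment> \<open>Up to any point i of E the glued function equals one single witness, whose
      support is well-ordered and supplies the least element.\<close>
    have "wfp_on {k. (if k \<in> D then coord (SOME a. wit k a) k else 0) \<noteq> 0} (<)" (is "wfp_on ?Y _")
      unfolding wfp_on_iff_ex_minimal
    proof (intro allI impI)
      fix E assume E: "E \<subseteq> ?Y" "E \<noteq> {}"
      then obtain i where i: "i \<in> E" by auto
      have "i \<in> D" using i E by (auto split: if_splits)
      obtain a where a: "wit i a" using wit_ex[OF \<open>i \<in> D\<close>] by auto
      have "E \<inter> {..i} \<subseteq> {k. coord a k \<noteq> 0}" "E \<inter> {..i} \<noteq> {}"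
        using E i raw[OF a \<open>i \<in> D\<close>] by auto
      then obtain z where z: "z \<in> E \<inter> {..i}" "\<And>y. y < z \<Longrightarrow> y \<notin> E \<inter> {..i}"
        using wf_coord[of a] unfolding wfp_on_iff_ex_minimal by meson
      have "y \<notin> E" if "y < z" for y using z(1) z(2)[OF that] that by auto
      then show "\<exists>z\<in>E. \<forall>y<z. y \<notin> E" using z(1) by blast
    qed
    then show ?thesis unfolding y_def by (subst Abs_hahn_inverse) auto
  qed
  have y_wit: "coord y k = coord a k" if "wit i a" "i \<in> D" "k \<le> i" for i a k
    using raw[OF that] coord_y by simp
  have y_off: "coord y k = 0" if "k \<notin> D" for k using that coord_y by simp

  \<comment> \<open>Elements that leave the common coordinates, and the one-sided case\<close>
  define agr where "agr a \<longleftrightarrow> (\<forall>k<?c. coord a k = coord y k)" for a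
  have first_diff: "\<exists>i\<in>D. coord a i \<noteq> coord y i" if "a \<in> A \<union> B" "\<not> agr a" for a
  proof -
    obtain i where i: "i < ?c" "coord a i \<noteq> coord y i" using \<open>\<not> agr a\<close> by (auto simp: agr_def)
    have "i \<in> Lv"
    proof (rule ccontr)
      assume "i \<notin> Lv"
      then show False using i(2) nonlvl[OF that(1), of i] y_off[of i] by (simp add: D_def)
    qed
    then show ?thesis using i Sless by auto
  qed
  \<comment> \<open>a leaves y at some i in D, while some b in B agrees with y up to i. As a < b,
    their first difference lies at or before i, where every continuation \<beta> of y looks like
    b.\<close>
  have belowA: "a < \<beta>" if ab: "a \<in> A" "\<not> agr a" and \<beta>: "\<And>k. k < ?c \<Longrightarrow> coord \<beta> k = coord y k" for a \<beta>
  proof -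
    obtain i where i: "i \<in> D" "coord a i \<noteq> coord y i" using first_diff ab by blast
    obtain a0 where a0: "wit i a0" using wit_ex[OF i(1)] by auto
    then obtain b where b: "b \<in> B" "\<forall>k\<le>i. coord a0 k = coord b k" by (auto simp: wit_def)
    have yb: "coord y k = coord b k" if "k \<le> i" for k using y_wit[OF a0 i(1) that] b(2) that by simp
    have "i < ?c" using i Sless by (auto simp: D_def)
    obtain k where k: "coord a k < coord b k" "\<forall>j<k. coord a j = coord b j"
      using AB[OF ab(1) b(1)] by (auto simp: hahn_less_iff)
    have "k \<le> i" using k i yb by (metis leI order_refl)
    then have "\<forall>j\<le>k. coord \<beta> j = coord b j" using yb \<beta> \<open>i < ?c\<close> by (metis order_trans le_less_trans)
    then show ?thesis using k unfolding hahn_less_iff by (metis order_refl less_imp_le)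
  qed
  have aboveB: "\<beta> < b" if ab: "b \<in> B" "\<not> agr b" and \<beta>: "\<And>k. k < ?c \<Longrightarrow> coord \<beta> k = coord y k" for b \<beta>
  proof -
    obtain i where i: "i \<in> D" "coord b i \<noteq> coord y i" using first_diff ab by blast
    obtain a where a: "wit i a" using wit_ex[OF i(1)] by auto
    then have aA: "a \<in> A" by (auto simp: wit_def)
    have ya: "coord y k = coord a k" if "k \<le> i" for k using y_wit[OF a i(1) that] by simp
    have "i < ?c" using i Sless by (auto simp: D_def)
    obtain k where k: "coord a k < coord b k" "\<forall>j<k. coord a j = coord b j"
      using AB[OF aA ab(1)] by (auto simp: hahn_less_iff)
    have "k \<le> i" using k i ya by (metis leI order_refl)
    then have "\<forall>j\<le>k. coord \<beta> j = coord a j" using ya \<beta> \<open>i < ?c\<close> by (metis order_trans le_less_trans)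
    then show ?thesis using k unfolding hahn_less_iff by (metis order_refl less_imp_le)
  qed
  have supp_y: "supp y \<subseteq> Lv" using y_off by (auto simp: supp_def D_def)
  have c_lv: "?c \<notin> Lv" using Sne by blast
  have c_off: "coord a ?c = 0" if "a \<in> A \<union> B" for a using nonlvl[OF that c_lv] .
  have y_c: "coord y ?c = 0" using c_lv y_off by (auto simp: D_def)
  \<comment> \<open>Elements of A and B vanish at \<open>?c\<close>, so the sign of r there places
    \<beta> on one side of all those that agree with y.\<close>
  have case1: thesis if beta: "\<beta> = y + hahn_single ?c r" and
    A': "\<And>a. a \<in> A \<Longrightarrow> agr a \<Longrightarrow> 0 < r" and B': "\<And>b. b \<in> B \<Longrightarrow> agr b \<Longrightarrow> r < 0" for \<beta> r
  proof (rule result)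
    have \<beta>: "coord \<beta> k = coord y k" if "k < ?c" for k using that beta by simp
    have \<beta>c: "coord \<beta> ?c = r" using y_c beta by simp
    show "\<beta> \<in> R_sme" unfolding R_sme_def R_cut_def
      using S supp_y beta by (auto simp: supp_def Lv_def split: if_splits)
    show "a < \<beta>" if "a \<in> A" for a
    proof (cases "agr a")
      case True
      then have "coord a ?c < coord \<beta> ?c \<and> (\<forall>j<?c. coord a j = coord \<beta> j)"
        using A'[OF that True] c_off[of a] \<beta> \<beta>c that by (auto simp: agr_def)
      then show ?thesis unfolding hahn_less_iff by blast
    qed (use belowA that \<beta> in blast)
    show "\<beta> < b" if "b \<in> B" for b
    proof (cases "agr b")
      case True
      then have "coord \<beta> ?c < coord b ?c \<and> (\<forall>j<?c. coord \<beta> j = coord b j)"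
        using B'[OF that True] c_off[of b] \<beta> \<beta>c that by (auto simp: agr_def)
      then show ?thesis unfolding hahn_less_iff by blast
    qed (use aboveB that \<beta> in blast)
  qed
  consider "\<forall>a\<in>A. \<not> agr a" | "\<forall>b\<in>B. \<not> agr b" | a b where "a \<in> A" "agr a" "b \<in> B" "agr b" by blast
  then show thesis
  proof cases
    case 1
    then show ?thesis using case1[OF refl, of "-1"] by auto
  next
    case 2
    then show ?thesis using case1[OF refl, of 1] by auto
  next

    \<comment> \<open>The two-sided case: a real supremum at the next level\<close>
    case (3 as bs)
    obtain j where j: "coord as j < coord bs j" "\<forall>k<j. coord as k = coord bs k"
      using AB[OF 3(1,3)] by (auto simp: hahn_less_iff)
    have jL: "j \<in> Lv" using j nonlvl[of as j] nonlvl[of bs j] 3 by force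
    have notD: "k \<notin> D" if "agr a" "agr b" "coord a k \<noteq> coord b k" for a b k
      using that Sless[of k] by (auto simp: agr_def D_def)
    have jD: "j \<notin> D" using notD[OF 3(2,4)] j by auto
    \<comment> \<open>The pair \<open>as\<close>, \<open>bs\<close> puts all levels before j into D,
      so j is the first level after D.\<close>
    have below_j: "coord a k = coord y k" if "a \<in> A \<union> B" "agr a" "k < j" for a k
    proof (cases "k \<in> Lv")
      case True
      have "\<forall>l\<le>k. coord as l = coord bs l" using j(2) \<open>k < j\<close> by auto
      then have "k \<in> D" using True 3 by (auto simp: D_def)
      then show ?thesis using Sless[OF True] \<open>agr a\<close> by (auto simp: agr_def)
    next
      case False
      then show ?thesis using nonlvl[OF that(1)] y_off[of k] by (auto simp: D_def)
    qed
    \<comment> \<open>The first difference cannot precede j, where both elements follow y, nor come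
      after j, which would put j into D.\<close>
    have at_j: "coord a j < coord b j" if ab: "a \<in> A" "agr a" "b \<in> B" "agr b" for a b
    proof -
      obtain k where k: "coord a k < coord b k" "\<forall>l<k. coord a l = coord b l"
        using AB[OF ab(1,3)] by (auto simp: hahn_less_iff)
      have "\<not> k < j" using below_j[of a k] below_j[of b k] that k by force
      moreover have "\<not> j < k"
      proof
        assume "j < k"
        then have "\<forall>l\<le>j. coord a l = coord b l" using k(2) by (metis le_less_trans)
        then have "j \<in> D" using jL that by (auto simp: D_def)
        then show False using jD by simp
      qed
      ultimately show ?thesis using k by (metis linorder_neqE)
    qed
    define X where "X = (\<lambda>a. coord a j) ` {a \<in> A. agr a}"
    have X: "X \<noteq> {}" "bdd_above X" using 3 at_j unfolding X_def
      by (auto intro!: bdd_aboveI[of _ "coord bs j"] less_imp_le)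
    define s where "s = Sup X"
    have sA: "coord a j \<le> s" if "a \<in> A" "agr a" for a
      unfolding s_def by (rule cSup_upper[OF _ X(2)]) (use that in \<open>auto simp: X_def\<close>)
    have sB: "s \<le> coord b j" if "b \<in> B" "agr b" for b
      unfolding s_def by (rule cSup_least[OF X(1)]) (use that at_j in \<open>auto simp: X_def intro: less_imp_le\<close>)
    \<comment> \<open>A new index immediately after the level j, to break ties with s: by
      \<open>at_j\<close> the two sides cannot both attain s at j.\<close>
    obtain T where T: "T \<in> initial_segments" and
      Tless: "\<And>i. i \<in> Lv \<Longrightarrow> i < cut_index T \<longleftrightarrow> i \<in> {i \<in> Lv. i \<le> j}" and
      Tne: "\<And>i. i \<in> Lv \<Longrightarrow> i \<noteq> cut_index T"
    proof (rule down_closed_cut_index[of "{i \<in> Lv. i \<le> j}"])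
      show "{i \<in> Lv. i \<le> j} \<subseteq> lvl_index ` levels" by (auto simp: Lv_def)
      show "k \<in> {i \<in> Lv. i \<le> j}"
        if "i \<in> {i \<in> Lv. i \<le> j}" "k \<in> lvl_index ` levels" "k \<le> i" for i k
        using that order_trans[of k i j] by (simp add: Lv_def)
    qed (simp add: Lv_def)
    let ?t = "cut_index T"
    have jt: "j < ?t" using Tless jL by simp
    have tL: "?t \<notin> Lv" using Tne by blast
    \<comment> \<open>Positive if some agreeing a attains s, so that \<beta> exceeds it; otherwise
      negative, to stay below any b that attains s.\<close>
    define r :: real where "r = (if \<exists>a\<in>A. agr a \<and> coord a j = s then 1 else -1)"
    define \<beta> where "\<beta> = y + hahn_single j s + hahn_single ?t r"
    have between: "k \<notin> Lv" if "j < k" "k < ?t" for k using Tless[of k] that by auto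
    have \<beta>_below: "coord \<beta> k = coord y k" if "k < j" for k using that jt by (auto simp: \<beta>_def)
    have \<beta>_j: "coord \<beta> j = s" using jt y_off[OF jD] by (simp add: \<beta>_def)
    have \<beta>_t: "coord \<beta> ?t = r" using jt tL y_off[of ?t] by (auto simp: \<beta>_def D_def)
    have \<beta>_btw: "coord \<beta> k = 0" if "j < k" "k < ?t" for k
      using that between[OF that] y_off[of k] by (auto simp: \<beta>_def D_def)
    have cj: "?c < j" using Sless[OF jL] Sne[OF jL] jD by (metis linorder_neqE)
    have \<beta>_c: "coord \<beta> k = coord y k" if "k < ?c" for k using \<beta>_below that cj by simp
    have upto: "coord a k = coord \<beta> k" if "a \<in> A \<union> B" "agr a" "coord a j = s" "k < ?t" for a k
      using below_j[OF that(1,2)] \<beta>_below[of k] \<beta>_j \<beta>_btw[of k] nonlvl[OF that(1)] between[of k] that(3,4)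
      by (metis linorder_neqE)
    have t_off: "coord a ?t = 0" if "a \<in> A \<union> B" for a using nonlvl[OF that tL] .
    show ?thesis
    proof (rule result)
      show "\<beta> \<in> R_sme" unfolding R_sme_def R_cut_def
        using T supp_y jL by (auto simp: supp_def Lv_def \<beta>_def split: if_splits)
      show "a < \<beta>" if a: "a \<in> A" for a
      proof (cases "agr a")
        case agr: True
        show ?thesis
        proof (cases "coord a j = s")
          case True
          then have "r = 1" using a agr by (auto simp: r_def)
          then have "coord a ?t < coord \<beta> ?t" using t_off[of a] a \<beta>_t by simp
          then show ?thesis using upto[OF _ agr True] a unfolding hahn_less_iff by blast
        next
          case False
          then have "coord a j < coord \<beta> j" using sA[OF a agr] \<beta>_j by simp
          moreover have "\<forall>k<j. coord a k = coord \<beta> k" using below_j[OF _ agr] \<beta>_below a by simp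
          ultimately show ?thesis unfolding hahn_less_iff by blast
        qed
      qed (use belowA a \<beta>_c in blast)
      show "\<beta> < b" if b: "b \<in> B" for b
      proof (cases "agr b")
        case agr: True
        show ?thesis
        proof (cases "coord b j = s")
          case True
          then have "r = -1" using at_j b agr by (force simp: r_def)
          then have "coord \<beta> ?t < coord b ?t" using t_off[of b] b \<beta>_t by simp
          moreover have "\<forall>k<?t. coord \<beta> k = coord b k" using upto[OF _ agr True] b by simp
          ultimately show ?thesis unfolding hahn_less_iff by blast
        next
          case False
          then have "coord \<beta> j < coord b j" using sB[OF b agr] \<beta>_j by simp
          moreover have "\<forall>k<j. coord \<beta> k = coord b k" using below_j[OF _ agr] \<beta>_below b by simp
          ultimately show ?thesis unfolding hahn_less_iff by blast
        qed
      qed (use aboveB b \<beta>_c in blast)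
    qed
  qed
qed

section \<open>The divisible hull and equivalence of cuts\<close>

definition div_hull :: "('g \<Rightarrow> 'g sme_index hahn) \<Rightarrow> 'g::linordered_ab_group_add sme_index hahn set" where
  "div_hull \<iota> = {t. \<exists>n>0. real n *\<^sub>R t \<in> range \<iota>}"

text \<open>Both elements are non-torsion, so comparison with Q never meets equality and the lower
  halves alone determine the cuts.\<close>

definition same_cut :: "('g \<Rightarrow> 'g sme_index hahn) \<Rightarrow> 'g::linordered_ab_group_add sme_index hahn
    \<Rightarrow> 'g sme_index hahn \<Rightarrow> bool" where
  "same_cut \<iota> \<alpha> \<beta> \<longleftrightarrow> \<alpha> \<notin> div_hull \<iota> \<and> \<beta> \<notin> div_hull \<iota> \<and> (\<forall>t\<in>div_hull \<iota>. t < \<alpha> \<longleftrightarrow> t < \<beta>)"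

lemma scaleR_less_cancel_left_pos:
  fixes x y :: "'i::linorder hahn"
  assumes "0 < c"
  shows "c *\<^sub>R x < c *\<^sub>R y \<longleftrightarrow> x < y"
proof -
  have "c *\<^sub>R x \<le> c *\<^sub>R y \<longleftrightarrow> x \<le> y" for x y :: "'i hahn"
    using assms by (rule scaleR_le_cancel_left_pos)
  then show ?thesis by (simp add: less_le_not_le)
qed

lemma R_cut_add: "a \<in> R_cut S \<Longrightarrow> b \<in> R_cut S \<Longrightarrow> a + b \<in> R_cut S"
  by (force simp: R_cut_def supp_def)

lemma R_cut_diff: "a \<in> R_cut S \<Longrightarrow> b \<in> R_cut S \<Longrightarrow> a - b \<in> R_cut S"
  by (force simp: R_cut_def supp_def)

lemma R_cut_zero: "0 \<in> R_cut S"
  by (simp add: R_cut_def supp_def)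

lemma R_lvl_subset_R_cut: "R_lvl \<subseteq> R_cut S"
  by (auto simp: R_lvl_def R_cut_def)

lemma empty_initial_segment: "{} \<in> initial_segments"
  by (simp add: initial_segments_def)

lemma R_lvl_subset_R_sme: "R_lvl \<subseteq> R_sme"
  unfolding R_sme_def using R_lvl_subset_R_cut empty_initial_segment by blast

locale hahn_emb =
  fixes \<iota> :: "'g::linordered_ab_group_add \<Rightarrow> 'g sme_index hahn"
  assumes emb: "hahn_embedding \<iota>"
begin

abbreviation "Q \<equiv> div_hull \<iota>"

lemma emb_add: "\<iota> (a + b) = \<iota> a + \<iota> b"
  using emb by (simp add: hahn_embedding_def)

lemma emb_zero [simp]: "\<iota> 0 = 0"
  using emb_add[of 0 0] by simp

lemma emb_minus: "\<iota> (- a) = - \<iota> a"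
  using emb_add[of a "- a"] by (simp add: eq_neg_iff_add_eq_0 add.commute)

lemma emb_diff: "\<iota> (a - b) = \<iota> a - \<iota> b"
  using emb_add[of a "- b"] by (simp add: emb_minus)

lemma emb_strict_mono: "strict_mono \<iota>"
  using emb by (simp add: hahn_embedding_def)

lemma emb_eq_iff [simp]: "\<iota> a = \<iota> b \<longleftrightarrow> a = b"
  using emb_strict_mono by (simp add: strict_mono_eq)

lemma emb_le_iff [simp]: "\<iota> a \<le> \<iota> b \<longleftrightarrow> a \<le> b"
  using emb_strict_mono by (simp add: strict_mono_less_eq)

lemma scale_emb_nat: "real n *\<^sub>R \<iota> g \<in> range \<iota>"
proof (induction n)
  case 0
  show ?case using emb_zero by (metis of_nat_0 rangeI scaleR_zero_left)
next
  case (Suc n)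
  then obtain h where "real n *\<^sub>R \<iota> g = \<iota> h" by auto
  then have "real (Suc n) *\<^sub>R \<iota> g = \<iota> (g + h)" by (simp add: emb_add scaleR_add_left)
  then show ?case by blast
qed

lemma div_hullI: "n > 0 \<Longrightarrow> real n *\<^sub>R t = \<iota> g \<Longrightarrow> t \<in> Q"
  by (auto simp: div_hull_def)

lemma div_hullE:
  assumes "t \<in> Q"
  obtains n g where "n > 0" "real n *\<^sub>R t = \<iota> g"
  using assms by (auto simp: div_hull_def)

lemma emb_in_div_hull [simp]: "\<iota> g \<in> Q"
  by (rule div_hullI[of 1]) auto

lemma zero_in_div_hull [simp]: "0 \<in> Q"
  using emb_in_div_hull[of 0] by simp

lemma div_hull_minus: "t \<in> Q \<Longrightarrow> - t \<in> Q"
  by (erule div_hullE, rule div_hullI) (auto simp: emb_minus[symmetric])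

lemma div_hull_add:
  assumes "s \<in> Q" "t \<in> Q"
  shows "s + t \<in> Q"
proof -
  obtain n g where n: "n > 0" "real n *\<^sub>R s = \<iota> g" by (rule div_hullE[OF assms(1)])
  obtain m h where m: "m > 0" "real m *\<^sub>R t = \<iota> h" by (rule div_hullE[OF assms(2)])
  obtain g' h' where gh: "real m *\<^sub>R \<iota> g = \<iota> g'" "real n *\<^sub>R \<iota> h = \<iota> h'"
    using scale_emb_nat by (metis imageE)
  have "real (n * m) *\<^sub>R (s + t) = real m *\<^sub>R real n *\<^sub>R s + real n *\<^sub>R real m *\<^sub>R t"
    by (simp add: scaleR_add_right mult.commute)
  also have "\<dots> = \<iota> (g' + h')" by (simp add: n(2) m(2) gh emb_add)
  finally have "real (n * m) *\<^sub>R (s + t) = \<iota> (g' + h')" .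
  then show ?thesis using n m by (intro div_hullI[of "n * m"]) auto
qed

lemma div_hull_diff: "s \<in> Q \<Longrightarrow> t \<in> Q \<Longrightarrow> s - t \<in> Q"
  using div_hull_add[of s "- t"] div_hull_minus by simp

lemma div_hull_divide:
  assumes "real n *\<^sub>R t \<in> Q" "n > 0"
  shows "t \<in> Q"
proof -
  obtain m g where "m > 0" "real m *\<^sub>R real n *\<^sub>R t = \<iota> g" by (rule div_hullE[OF assms(1)])
  then show ?thesis using assms(2) by (intro div_hullI[of "m * n"]) auto
qed

lemma div_hull_quotient: "n > 0 \<Longrightarrow> inverse (real n) *\<^sub>R \<iota> g \<in> Q"
  by (rule div_hullI[of n]) auto

lemma div_hull_subset_R_lvl: "Q \<subseteq> R_lvl"
proof
  fix t assume "t \<in> Q"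
  then obtain n g where n: "n > 0" "real n *\<^sub>R t = \<iota> g" by (rule div_hullE)
  then have "coord (\<iota> g) i = real n * coord t i" for i by (metis coord_simps(5))
  then have "supp t = supp (\<iota> g)" using n(1) by (auto simp: supp_def)
  moreover have "\<iota> g \<in> R_lvl" using emb by (auto simp: hahn_embedding_def)
  ultimately show "t \<in> R_lvl" by (simp add: R_lvl_def)
qed

lemma group_closure_insert_range:
  "group_closure (insert \<alpha> (range \<iota>)) = {x. \<exists>g m. x = \<iota> g + of_int m *\<^sub>R \<alpha>}"
proof (intro equalityI subsetI)
  fix x assume "x \<in> group_closure (insert \<alpha> (range \<iota>))"
  then have "\<exists>g m. x = \<iota> g + of_int m *\<^sub>R \<alpha>"
  proof induction
    case (base s)
    then consider "s = \<alpha>" | g where "s = \<iota> g" using emb_zero by (metis imageE insertE)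
    then show ?case
    proof cases
      case 1
      then have "s = \<iota> 0 + of_int 1 *\<^sub>R \<alpha>" by simp
      then show ?thesis by blast
    next
      case 2
      then have "s = \<iota> g + of_int 0 *\<^sub>R \<alpha>" by simp
      then show ?thesis by blast
    qed
  next
    case (diff s t)
    then obtain g m h k where "s = \<iota> g + of_int m *\<^sub>R \<alpha>" "t = \<iota> h + of_int k *\<^sub>R \<alpha>" by blast
    then have "s - t = \<iota> (g - h) + of_int (m - k) *\<^sub>R \<alpha>"
      by (simp add: emb_diff scaleR_diff_left)
    then show ?case by blast
  qed
  then show "x \<in> {x. \<exists>g m. x = \<iota> g + of_int m *\<^sub>R \<alpha>}" by simp
next
  fix x assume "x \<in> {x. \<exists>g m. x = \<iota> g + of_int m *\<^sub>R \<alpha>}"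
  then obtain g m where x: "x = \<iota> g + of_int m *\<^sub>R \<alpha>" by blast
  let ?C = "group_closure (insert \<alpha> (range \<iota>))"
  have \<alpha>: "\<alpha> \<in> ?C" and g: "\<iota> g \<in> ?C" by (auto intro: group_closure.base)
  have nat: "real n *\<^sub>R \<alpha> \<in> ?C" for n
    using \<alpha> by (induction n) (auto simp: scaleR_add_left intro: group_closure_add)
  have "of_int m *\<^sub>R \<alpha> \<in> ?C"
  proof (cases "m \<ge> 0")
    case True
    then have "of_int m = real (nat m)" by simp
    then show ?thesis using nat by metis
  next
    case False
    then have "of_int m *\<^sub>R \<alpha> = - (real (nat (- m)) *\<^sub>R \<alpha>)" by simp
    then show ?thesis using nat by simp
  qed
  then show "x \<in> ?C" using g x by (auto intro: group_closure_add)
qed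

lemma sme_equiv_nat_scale:
  fixes \<phi> :: "'g sme_index hahn \<Rightarrow> 'g sme_index hahn"
  assumes add: "\<And>x y. x \<in> group_closure (insert \<alpha> (range \<iota>)) \<Longrightarrow>
      y \<in> group_closure (insert \<alpha> (range \<iota>)) \<Longrightarrow> \<phi> (x + y) = \<phi> x + \<phi> y"
    and \<phi>: "\<phi> \<alpha> = \<beta>"
  shows "\<phi> (real n *\<^sub>R \<alpha>) = real n *\<^sub>R \<beta>" "real n *\<^sub>R \<alpha> \<in> group_closure (insert \<alpha> (range \<iota>))"
proof -
  let ?C = "group_closure (insert \<alpha> (range \<iota>))"
  have mem: "real n *\<^sub>R \<alpha> \<in> ?C" for n
  proof -
    have "real n *\<^sub>R \<alpha> = \<iota> 0 + of_int (int n) *\<^sub>R \<alpha>" by simp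
    then show ?thesis unfolding group_closure_insert_range by blast
  qed
  have zero: "\<phi> 0 = 0" using add[of 0 0] by simp
  show "\<phi> (real n *\<^sub>R \<alpha>) = real n *\<^sub>R \<beta>"
    using mem mem[of 1] by (induction n) (simp_all add: zero add \<phi> scaleR_add_left)
  show "real n *\<^sub>R \<alpha> \<in> ?C" by (rule mem)
qed

text \<open>A positive multiple of \<alpha> lies in the base group, which the isomorphism fixes, and
  division by n is unique in a real vector space.\<close>

lemma sme_equiv_div_hull:
  assumes "sme_equiv \<iota> \<alpha> \<beta>" "\<alpha> \<in> Q"
  shows "\<beta> = \<alpha>"
proof -
  obtain \<phi> where \<phi>: "\<And>x y. x \<in> group_closure (insert \<alpha> (range \<iota>)) \<Longrightarrow>
      y \<in> group_closure (insert \<alpha> (range \<iota>)) \<Longrightarrow> \<phi> (x + y) = \<phi> x + \<phi> y" "\<phi> \<alpha> = \<beta>"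
    "\<And>\<gamma>. \<phi> (\<iota> \<gamma>) = \<iota> \<gamma>"
    using assms(1) unfolding sme_equiv_def by blast
  obtain n g where n: "n > 0" "real n *\<^sub>R \<alpha> = \<iota> g" using assms(2) by (rule div_hullE)
  then have "real n *\<^sub>R \<beta> = real n *\<^sub>R \<alpha>"
    using sme_equiv_nat_scale(1)[OF \<phi>(1,2), where n = n] \<phi>(3) by simp
  then show ?thesis using n(1) by simp
qed

text \<open>Clearing the denominator of t moves the comparison into the group generated by \<alpha>,
  where the isomorphism is strictly monotone.\<close>

lemma sme_equiv_less:
  assumes "sme_equiv \<iota> \<alpha> \<beta>" "t \<in> Q"
  shows "t < \<alpha> \<longleftrightarrow> t < \<beta>" "\<alpha> < t \<longleftrightarrow> \<beta> < t"
proof -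
  let ?C = "group_closure (insert \<alpha> (range \<iota>))"
  obtain \<phi> where \<phi>: "\<And>x y. x \<in> ?C \<Longrightarrow> y \<in> ?C \<Longrightarrow> \<phi> (x + y) = \<phi> x + \<phi> y" "\<phi> \<alpha> = \<beta>"
    "\<And>\<gamma>. \<phi> (\<iota> \<gamma>) = \<iota> \<gamma>" and mono: "strict_mono_on ?C \<phi>"
    using assms(1) unfolding sme_equiv_def by blast
  obtain n g where n: "n > 0" "real n *\<^sub>R t = \<iota> g" using assms(2) by (rule div_hullE)
  note sc = sme_equiv_nat_scale[OF \<phi>(1,2), where n = n]
  have g: "\<iota> g \<in> ?C" by (auto intro: group_closure.base)
  have cmp: "x < y \<longleftrightarrow> real n *\<^sub>R x < real n *\<^sub>R y" for x y :: "'g sme_index hahn"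
    using scaleR_less_cancel_left_pos n(1) by (metis of_nat_0_less_iff)
  show "t < \<alpha> \<longleftrightarrow> t < \<beta>"
    using strict_mono_on_less[OF mono g sc(2)] n(2) sc(1) \<phi>(3) cmp[of t] cmp[of _ t] by simp
  show "\<alpha> < t \<longleftrightarrow> \<beta> < t"
    using strict_mono_on_less[OF mono sc(2) g] n(2) sc(1) \<phi>(3) cmp[of t] cmp[of _ t] by simp
qed

text \<open>For m \<noteq> 0 the sign depends only on the position of \<alpha> relative to the
  torsion element -g/m, hence on the cut.\<close>

lemma same_cut_affine_less:
  assumes "same_cut \<iota> \<alpha> \<beta>"
  shows "0 < \<iota> g + of_int m *\<^sub>R \<alpha> \<longleftrightarrow> 0 < \<iota> g + of_int m *\<^sub>R \<beta>"
proof -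
  have cut: "t < \<alpha> \<longleftrightarrow> t < \<beta>" "\<alpha> < t \<longleftrightarrow> \<beta> < t" if "t \<in> Q" for t
  proof -
    show "t < \<alpha> \<longleftrightarrow> t < \<beta>" using assms that by (auto simp: same_cut_def)
    moreover have "\<alpha> \<noteq> t" "\<beta> \<noteq> t" using assms that by (auto simp: same_cut_def)
    ultimately show "\<alpha> < t \<longleftrightarrow> \<beta> < t" by (auto simp: neq_iff)
  qed
  consider "m = 0" | "m > 0" | "m < 0" by linarith
  then show ?thesis
  proof cases
    case 2
    define t where "t = inverse (real (nat m)) *\<^sub>R \<iota> (- g)"
    have "t \<in> Q" unfolding t_def using 2 by (intro div_hull_quotient) simp
    have "0 < \<iota> g + of_int m *\<^sub>R x \<longleftrightarrow> t < x" for x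
    proof -
      have "of_int m *\<^sub>R t = - \<iota> g" using 2 by (simp add: t_def emb_minus)
      moreover have "t < x \<longleftrightarrow> of_int m *\<^sub>R t < of_int m *\<^sub>R x"
        using 2 by (simp add: scaleR_less_cancel_left_pos)
      ultimately show ?thesis by (metis add.commute diff_0 diff_less_eq)
    qed
    then show ?thesis using cut[OF \<open>t \<in> Q\<close>] by simp
  next
    case 3
    define t where "t = inverse (real (nat (- m))) *\<^sub>R \<iota> g"
    have "t \<in> Q" unfolding t_def using 3 by (intro div_hull_quotient) simp
    have "0 < \<iota> g + of_int m *\<^sub>R x \<longleftrightarrow> x < t" for x
    proof -
      have "of_int (- m) *\<^sub>R t = \<iota> g" using 3 by (simp add: t_def)
      moreover have "x < t \<longleftrightarrow> of_int (- m) *\<^sub>R x < of_int (- m) *\<^sub>R t"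
        using 3 by (intro scaleR_less_cancel_left_pos[symmetric]) simp
      ultimately have "x < t \<longleftrightarrow> - (of_int m *\<^sub>R x) < \<iota> g" by simp
      then show ?thesis by (metis add.commute diff_0 diff_less_eq)
    qed
    then show ?thesis using cut[OF \<open>t \<in> Q\<close>] by simp
  qed simp
qed

text \<open>For non-torsion \<alpha> the generated group is the direct sum of the base group and the
  multiples of \<alpha>, so sending \<alpha> to \<beta> defines an additive map; its monotonicity
  reduces to signs of differences.\<close>

lemma same_cut_sme_equiv:
  assumes "same_cut \<iota> \<alpha> \<beta>"
  shows "sme_equiv \<iota> \<alpha> \<beta>"
proof -
  have uniq: "g = h \<and> m = k" if "\<iota> g + of_int m *\<^sub>R x = \<iota> h + of_int k *\<^sub>R x" "x \<notin> Q" for g h m k x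
  proof -
    have eq: "of_int (m - k) *\<^sub>R x = \<iota> (h - g)"
      using that(1) by (simp add: emb_diff scaleR_diff_left algebra_simps)
    have "m = k"
    proof (rule ccontr)
      assume "m \<noteq> k"
      then consider "m > k" | "m < k" by linarith
      then show False
      proof cases
        case 1
        then have "real (nat (m - k)) *\<^sub>R x = \<iota> (h - g)" using eq by simp
        then show False using div_hullI[of "nat (m - k)" x] 1 that(2) by simp
      next
        case 2
        have "of_int (k - m) *\<^sub>R x = - (of_int (m - k) *\<^sub>R x)"
          by (simp add: algebra_simps)
        also have "\<dots> = \<iota> (g - h)" unfolding eq by (simp add: emb_diff)
        finally have "real (nat (k - m)) *\<^sub>R x = \<iota> (g - h)" using 2 by simp
        then show False using div_hullI[of "nat (k - m)" x] 2 that(2) by simp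
      qed
    qed
    then show ?thesis using that(1) by simp
  qed
  have nQ: "\<alpha> \<notin> Q" "\<beta> \<notin> Q" using assms by (auto simp: same_cut_def)
  define \<phi> where "\<phi> x = (THE y. \<exists>g m. x = \<iota> g + of_int m *\<^sub>R \<alpha> \<and> y = \<iota> g + of_int m *\<^sub>R \<beta>)" for x
  have \<phi>: "\<phi> (\<iota> g + of_int m *\<^sub>R \<alpha>) = \<iota> g + of_int m *\<^sub>R \<beta>" for g m
    unfolding \<phi>_def by (rule the_equality) (use uniq nQ(1) in blast)+
  let ?C = "\<lambda>\<alpha>. group_closure (insert \<alpha> (range \<iota>))"
  note C = group_closure_insert_range
  have less: "\<iota> g + of_int m *\<^sub>R \<alpha> < \<iota> h + of_int k *\<^sub>R \<alpha> \<longleftrightarrow>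
      \<iota> g + of_int m *\<^sub>R \<beta> < \<iota> h + of_int k *\<^sub>R \<beta>" for g m h k
  proof -
    have "\<iota> g + of_int m *\<^sub>R x < \<iota> h + of_int k *\<^sub>R x \<longleftrightarrow> 0 < \<iota> (h - g) + of_int (k - m) *\<^sub>R x" for x
    proof -
      have "\<iota> (h - g) + of_int (k - m) *\<^sub>R x = (\<iota> h + of_int k *\<^sub>R x) - (\<iota> g + of_int m *\<^sub>R x)"
        by (simp add: emb_diff scaleR_diff_left)
      then show ?thesis by (simp only: diff_gt_0_iff_gt)
    qed
    then show ?thesis using same_cut_affine_less[OF assms] by blast
  qed
  have mono: "strict_mono_on (?C \<alpha>) \<phi>"
    unfolding C by (rule strict_mono_onI) (auto simp: \<phi> less)
  moreover have "bij_betw \<phi> (?C \<alpha>) (?C \<beta>)"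
    unfolding bij_betw_def
  proof
    show "inj_on \<phi> (?C \<alpha>)" using mono by (rule strict_mono_on_imp_inj_on)
    show "\<phi> ` ?C \<alpha> = ?C \<beta>"
    proof (intro equalityI subsetI)
      fix y assume "y \<in> ?C \<beta>"
      then obtain g m where "y = \<iota> g + of_int m *\<^sub>R \<beta>" unfolding C by blast
      then have "y = \<phi> (\<iota> g + of_int m *\<^sub>R \<alpha>)" by (simp add: \<phi>)
      then show "y \<in> \<phi> ` ?C \<alpha>" unfolding C by blast
    qed (unfold C, use \<phi> in blast)
  qed
  moreover have "\<phi> (x + y) = \<phi> x + \<phi> y" if xy: "x \<in> ?C \<alpha>" "y \<in> ?C \<alpha>" for x y
  proof -
    obtain g m h k where e: "x = \<iota> g + of_int m *\<^sub>R \<alpha>" "y = \<iota> h + of_int k *\<^sub>R \<alpha>" using xy unfolding C by blast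
    then have "x + y = \<iota> (g + h) + of_int (m + k) *\<^sub>R \<alpha>" by (simp add: emb_add scaleR_add_left)
    then have "\<phi> (x + y) = \<iota> (g + h) + of_int (m + k) *\<^sub>R \<beta>" by (simp only: \<phi>)
    then show ?thesis unfolding e \<phi> by (simp add: emb_add scaleR_add_left)
  qed
  moreover have "\<phi> \<alpha> = \<beta>" using \<phi>[of 0 1] by simp
  moreover have "\<phi> (\<iota> g) = \<iota> g" for g using \<phi>[of g 0] by simp
  ultimately show ?thesis unfolding sme_equiv_def by blast
qed

end

locale sme_setting = hahn_emb \<iota> for \<iota> :: "'g::linordered_ab_group_add \<Rightarrow> 'g sme_index hahn" +
  fixes \<Gamma>sme :: "'g sme_index hahn set"
  assumes reps: "sme_representatives \<iota> \<Gamma>sme"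
begin

text \<open>Both \<alpha> itself, by reflexivity, and \<beta> are representatives equivalent to
  \<alpha>.\<close>

lemma representatives_eq:
  assumes "\<alpha> \<in> \<Gamma>sme" "\<beta> \<in> \<Gamma>sme" "same_cut \<iota> \<alpha> \<beta>"
  shows "\<alpha> = \<beta>"
proof -
  have "same_cut \<iota> \<alpha> \<alpha>" using assms(3) by (auto simp: same_cut_def)
  then have "sme_equiv \<iota> \<alpha> \<alpha>" "sme_equiv \<iota> \<alpha> \<beta>" using assms(3) same_cut_sme_equiv by blast+
  moreover have "\<alpha> \<in> R_sme" using reps assms(1) by (auto simp: sme_representatives_def)
  ultimately show ?thesis using assms(1,2) reps unfolding sme_representatives_def by blast
qed

lemma div_hull_subset_representatives: "Q \<subseteq> \<Gamma>sme"
proof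
  fix t assume "t \<in> Q"
  then have "t \<in> R_sme" using div_hull_subset_R_lvl R_lvl_subset_R_sme by blast
  then obtain \<beta> where "\<beta> \<in> \<Gamma>sme" "sme_equiv \<iota> t \<beta>" using reps unfolding sme_representatives_def by blast
  then show "t \<in> \<Gamma>sme" using sme_equiv_div_hull \<open>t \<in> Q\<close> by metis
qed

text \<open>The least class above U, as far as cuts of Q can tell. U may lie outside Q;
  \<open>cofinal\<close> is what lets a cut, which sees only Q, dominate it. For U = {} the result
  is the lowest class.\<close>

lemma representative_above:
  assumes no_max: "\<And>u. u \<in> U \<Longrightarrow> \<exists>u'\<in>U. u < u'"
    and cofinal: "\<And>u. u \<in> U \<Longrightarrow> \<exists>t\<in>Q. \<exists>u'\<in>U. u \<le> t \<and> t \<le> u'"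
  obtains \<gamma> where "\<gamma> \<in> \<Gamma>sme" "\<gamma> \<notin> Q" "\<And>u. u \<in> U \<Longrightarrow> u < \<gamma>"
    "\<And>\<gamma>'. \<gamma>' \<le> \<gamma> \<Longrightarrow> (\<And>u. u \<in> U \<Longrightarrow> u \<le> \<gamma>') \<Longrightarrow> same_cut \<iota> \<gamma>' \<gamma>"
proof -
  define A where "A = {t \<in> Q. \<exists>u\<in>U. t \<le> u}"
  define B where "B = {t \<in> Q. \<forall>u\<in>U. u < t}"
  have AB: "a < b" if "a \<in> A" "b \<in> B" for a b using that by (fastforce simp: A_def B_def)
  have Q: "t \<in> A \<or> t \<in> B" if "t \<in> Q" for t using that by (auto simp: A_def B_def not_le)
  have "A \<subseteq> R_lvl" "B \<subseteq> R_lvl" using div_hull_subset_R_lvl by (auto simp: A_def B_def)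
  from R_sme_fills_cuts[OF this AB] obtain \<beta>
    where \<beta>: "\<beta> \<in> R_sme" "\<And>a. a \<in> A \<Longrightarrow> a < \<beta>" "\<And>b. b \<in> B \<Longrightarrow> \<beta> < b" by blast
  obtain \<gamma> where \<gamma>: "\<gamma> \<in> \<Gamma>sme" "sme_equiv \<iota> \<beta> \<gamma>" using reps \<beta>(1) unfolding sme_representatives_def by blast
  have A: "a < \<gamma>" if "a \<in> A" for a
    using \<beta>(2)[OF that] sme_equiv_less(1)[OF \<gamma>(2)] that by (auto simp: A_def)
  have B: "\<gamma> < b" if "b \<in> B" for b
    using \<beta>(3)[OF that] sme_equiv_less(2)[OF \<gamma>(2)] that by (auto simp: B_def)
  \<comment> \<open>A and B exhaust Q, and \<gamma> lies strictly between them.\<close>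
  have \<gamma>Q: "\<gamma> \<notin> Q" using Q[of \<gamma>] A B by blast
  show thesis
  proof
    show "\<gamma> \<in> \<Gamma>sme" "\<gamma> \<notin> Q" by fact+
    show "u < \<gamma>" if u: "u \<in> U" for u
    proof -
      obtain t u' where "t \<in> Q" "u' \<in> U" "u \<le> t" "t \<le> u'" using cofinal[OF u] by blast
      then have "u \<le> t" "t < \<gamma>" using A[of t] by (auto simp: A_def)
      then show ?thesis by (rule le_less_trans)
    qed
    show "same_cut \<iota> \<gamma>' \<gamma>" if le: "\<gamma>' \<le> \<gamma>" and U: "\<And>u. u \<in> U \<Longrightarrow> u \<le> \<gamma>'" for \<gamma>'
    proof -
      \<comment> \<open>Strictness comes from \<open>no_max\<close>: a \<le> u < u' \<le>
        \<gamma>'.\<close>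
      have A': "a < \<gamma>'" if "a \<in> A" for a
        using that no_max U unfolding A_def by (blast intro: le_less_trans less_le_trans)
      have B': "\<gamma>' < b" if "b \<in> B" for b using B[OF that] le by simp
      have "\<gamma>' \<notin> Q" using Q A' B' by blast
      moreover have "t < \<gamma>' \<longleftrightarrow> t < \<gamma>" if "t \<in> Q" for t
        using Q[OF that] A A' B B' by (meson order_less_asym)
      ultimately show ?thesis using \<gamma>Q by (simp add: same_cut_def)
    qed
  qed
qed

end

section \<open>Valuations on polynomial rings\<close>

instance with_inf :: (linordered_ab_group_add) ordered_comm_monoid_add
proof
  fix a b c :: "'a with_inf"
  show "a \<le> b \<Longrightarrow> c + a \<le> c + b" by (cases a; cases b; cases c) auto
qed

lemma with_inf_add_eq_Infty [simp]: "x + y = Infty \<longleftrightarrow> x = Infty \<or> y = Infty"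
  by (cases x; cases y) auto

lemma with_inf_add_Infty [simp]: "x + Infty = Infty" "Infty + x = Infty"
  by (cases x; simp)+

lemma with_inf_le_Infty [simp]: "x \<le> Infty" "Infty \<le> x \<longleftrightarrow> x = Infty"
  by (cases x; simp)+

lemma with_inf_add_strict_mono:
  fixes x y z :: "'l::linordered_ab_group_add with_inf"
  shows "x < y \<Longrightarrow> z \<noteq> Infty \<Longrightarrow> z + x < z + y"
  by (cases x; cases y; cases z) auto

lemma with_inf_add_cancel [simp]:
  fixes x y :: "'l::linordered_ab_group_add with_inf"
  shows "Fin c + x \<le> Fin c + y \<longleftrightarrow> x \<le> y" "Fin c + x < Fin c + y \<longleftrightarrow> x < y" "Fin c + x = Fin c + y \<longleftrightarrow> x = y"
  by (cases x; cases y; simp)+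

lemma with_inf_add_eq_mono:
  fixes x y x' y' :: "'l::linordered_ab_group_add with_inf"
  assumes "x + y = x' + y'" "x + y \<noteq> Infty" "x \<le> x'" "y \<le> y'"
  shows "x = x'" "y = y'"
proof -
  have *: "x = x'" if "x + y = x' + y'" "x + y \<noteq> Infty" "x \<le> x'" "y \<le> y'"
    for x y x' y' :: "'l with_inf"
  proof (rule ccontr)
    assume "x \<noteq> x'"
    then have "y + x < y + x'" using that by (intro with_inf_add_strict_mono) auto
    also have "\<dots> \<le> y' + x'" using that(4) by (rule add_right_mono)
    finally show False using that(1) by (simp add: add.commute)
  qed
  show "x = x'" using *[OF assms] .
  show "y = y'" using *[of y x y' x'] assms by (simp add: add.commute)
qed

context
  fixes \<nu> :: "'r::comm_ring_1 \<Rightarrow> 'l::linordered_ab_group_add with_inf"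
  assumes v: "valuation \<nu>"
begin

lemma val_mult: "\<nu> (f * g) = \<nu> f + \<nu> g"
  and val_zero: "\<nu> 0 = Infty"
  and val_one: "\<nu> 1 = 0"
  using v by (simp_all add: valuation_def)

lemma val_add: "min (\<nu> f) (\<nu> g) \<le> \<nu> (f + g)"
  using v by (simp add: valuation_def)

lemma val_add_ge: "x \<le> \<nu> f \<Longrightarrow> x \<le> \<nu> g \<Longrightarrow> x \<le> \<nu> (f + g)"
  using val_add[of f g] by (meson min.boundedI order_trans)

lemma val_add_gt: "x < \<nu> f \<Longrightarrow> x < \<nu> g \<Longrightarrow> x < \<nu> (f + g)"
  using val_add[of f g] by (meson min_less_iff_conj less_le_trans)

lemma val_diff_ge: "x \<le> \<nu> f \<Longrightarrow> x \<le> \<nu> g \<Longrightarrow> x \<le> \<nu> (f - g)"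
  using val_add_ge[of x f "- g"] valuation_uminus[OF v, of g] by simp

lemma val_diff_gt: "x < \<nu> f \<Longrightarrow> x < \<nu> g \<Longrightarrow> x < \<nu> (f - g)"
  using val_add_gt[of x f "- g"] valuation_uminus[OF v, of g] by simp

lemma val_add_less:
  assumes "\<nu> f < \<nu> g"
  shows "\<nu> (f + g) = \<nu> f"
proof (rule antisym)
  show "\<nu> f \<le> \<nu> (f + g)" using assms by (intro val_add_ge) auto
  show "\<nu> (f + g) \<le> \<nu> f"
  proof (rule ccontr)
    assume "\<not> \<nu> (f + g) \<le> \<nu> f"
    then have "\<nu> f < \<nu> (f + g - g)" using assms by (intro val_diff_gt) auto
    then show False by simp
  qed
qed

lemma val_add_neq: "\<nu> f \<noteq> \<nu> g \<Longrightarrow> \<nu> (f + g) = min (\<nu> f) (\<nu> g)"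
  using val_add_less[of f g] val_add_less[of g f]
  by (cases "\<nu> f" "\<nu> g" rule: linorder_cases) (auto simp: add.commute min_def)

lemma val_sum_inj:
  assumes "finite N" "N \<noteq> {}" "inj_on (\<lambda>n. \<nu> (f n)) N"
  shows "\<exists>n\<in>N. \<nu> (sum f N) = \<nu> (f n)"
  using assms
proof (induction N rule: finite_ne_induct)
  case (insert n N)
  then obtain m where m: "m \<in> N" "\<nu> (sum f N) = \<nu> (f m)" by auto
  then have "\<nu> (f n) \<noteq> \<nu> (sum f N)" using insert by (auto simp: inj_on_def)
  then have "\<nu> (f n + sum f N) = min (\<nu> (f n)) (\<nu> (f m))" using m(2) val_add_neq by metis
  then show ?case using insert m(1) by (auto simp: min_def)
qed auto

end

lemma val_power:
  fixes \<nu> :: "'r::comm_ring_1 \<Rightarrow> 'i::linorder hahn with_inf"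
  assumes "valuation \<nu>" "\<nu> a = Fin \<alpha>"
  shows "\<nu> (a ^ n) = Fin (real n *\<^sub>R \<alpha>)"
  by (induction n) (auto simp: val_one[OF assms(1)] val_mult[OF assms(1)] assms(2) zero_with_inf_def
      scaleR_add_left)

text \<open>\<open>\<nu>\<close> factors through a field, on which comparable valuations coincide.\<close>

lemma val_nontrivial_support_maximal:
  fixes \<nu> \<nu>' :: "'k::field poly \<Rightarrow> 'l::linordered_ab_group_add with_inf"
  assumes v: "valuation \<nu>" and v': "valuation \<nu>'" and le: "\<nu> \<le> \<nu>'" and q: "q \<noteq> 0" "\<nu> q = Infty"
  shows "\<nu> = \<nu>'"
proof
  fix f
  have le: "\<nu> g \<le> \<nu>' g" for g using le by (simp add: le_fun_def)
  obtain p where p: "p \<noteq> 0" "\<nu> p = Infty"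
    and pmin: "\<And>g. g \<noteq> 0 \<Longrightarrow> \<nu> g = Infty \<Longrightarrow> degree p \<le> degree g"
    using ex_has_least_nat[of "\<lambda>p. p \<noteq> 0 \<and> \<nu> p = Infty" q degree] q by blast
  show "\<nu> f = \<nu>' f"
  proof (cases "\<nu> f = Infty")
    case True
    then show ?thesis using le[of f] by simp
  next
    case False
    let ?P = "\<lambda>h. h \<noteq> 0 \<and> (\<exists>u w. h = u * f + w * p)"
    have "?P p" using p by (metis add.left_neutral mult_1 mult_zero_left)
    then obtain h where h: "?P h" "\<And>g. ?P g \<Longrightarrow> degree h \<le> degree g"
      using ex_has_least_nat[of ?P p degree] by blast
    then obtain u w where uw: "h = u * f + w * p" by blast
    \<comment> \<open>h is a gcd of f and p: a non-zero combination of least degree divides all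
      combinations.\<close>
    have red: "h dvd u' * f + w' * p" for u' w'
    proof (rule ccontr)
      assume nd: "\<not> h dvd u' * f + w' * p"
      let ?g = "u' * f + w' * p"
      define s where "s = ?g div h"
      have "?g mod h = ?g - s * h" by (simp add: minus_div_mult_eq_mod s_def)
      also have "\<dots> = (u' - s * u) * f + (w' - s * w) * p"
        unfolding uw by (simp add: algebra_simps)
      finally have "\<exists>u w. ?g mod h = u * f + w * p" by blast
      then have "?P (?g mod h)" using nd by (simp add: mod_eq_0_iff_dvd)
      moreover have "degree (?g mod h) < degree h"
        using degree_mod_less[of h ?g] h(1) nd by (auto simp: mod_eq_0_iff_dvd)
      ultimately show False using h(2) by (meson not_le)
    qed
    obtain k where k: "p = h * k" using red[of 0 1] by (auto elim: dvdE)
    obtain l where l: "f = h * l" using red[of 1 0] by (auto elim: dvdE)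
    have "\<nu> h \<noteq> Infty" using False l val_mult[OF v] by auto
    then have "\<nu> k = Infty" using p(2) k val_mult[OF v] by auto
    moreover have "k \<noteq> 0" using p(1) k by auto
    ultimately have "degree p \<le> degree k" by (intro pmin)
    then have "degree h = 0" using k p(1) by (auto simp: degree_mult_eq)
    then obtain c where c: "h = [:c:]" by (rule degree_eq_zeroE)
    define x y where "x = [:inverse c:] * u" and "y = [:inverse c:] * w"
    have "[:inverse c:] * h = 1" using h(1) c by (simp add: one_pCons)
    then have one: "x * f + y * p = 1" unfolding uw x_def y_def by (simp add: algebra_simps)
    \<comment> \<open>Modulo p the polynomial x inverts f, so the values of x and f cancel under
      both \<nu> and \<nu>'. Neither can drop from \<nu> to \<nu>', hence neither changes.\<close>
    have eq0: "\<mu> x + \<mu> f = 0" if \<mu>: "valuation \<mu>" "\<mu> p = Infty" for \<mu> :: "'k poly \<Rightarrow> 'l with_inf"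
    proof -
      have "\<mu> (1 + - (y * p)) = \<mu> 1"
        using that by (intro val_add_less) (auto simp: val_mult valuation_uminus val_one zero_with_inf_def)
      moreover have "x * f = 1 + - (y * p)" using one by (simp add: algebra_simps)
      ultimately have "\<mu> (x * f) = 0" by (simp add: val_one[OF \<mu>(1)])
      then show ?thesis by (simp add: val_mult[OF \<mu>(1)])
    qed
    have "\<nu>' p = Infty" using le[of p] p(2) by simp
    then show ?thesis
      using with_inf_add_eq_mono(2)[of "\<nu> x" "\<nu> f" "\<nu>' x" "\<nu>' f"] eq0[OF v p(2)] eq0[OF v'] le
      by (simp add: zero_with_inf_def)
  qed
qed

lemma degree_mod_lt: "0 < degree g \<Longrightarrow> degree (f mod g) < degree g"
  for f g :: "'k::field poly"
  using degree_mod_less[of g f] by (cases "g = 0"; cases "f mod g = 0") auto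

text \<open>Otherwise the multiple of \<chi> in the division is a difference of two terms with
  distinct values, neither of which changes from \<nu> to \<nu>'; yet its value must grow because
  that of \<chi> does.\<close>

lemma val_eq_mod:
  fixes \<nu> \<nu>' :: "'k::field poly \<Rightarrow> 'l::linordered_ab_group_add with_inf"
  assumes v: "valuation \<nu>" and v': "valuation \<nu>'" and le: "\<And>g. \<nu> g \<le> \<nu>' g"
    and \<chi>: "\<nu> \<chi> < \<nu>' \<chi>" "\<And>a. degree a < degree \<chi> \<Longrightarrow> \<nu> a = \<nu>' a" "degree \<chi> > 0"
    and fin: "\<And>a. a \<noteq> 0 \<Longrightarrow> \<nu> a \<noteq> Infty"
    and f: "\<nu> f = \<nu>' f"
  shows "\<nu> (f mod \<chi>) = \<nu> f"
proof (rule ccontr)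
  let ?q = "f div \<chi>" and ?r = "f mod \<chi>"
  assume ne: "\<nu> ?r \<noteq> \<nu> f"
  have r: "\<nu> ?r = \<nu>' ?r" by (intro \<chi>(2) degree_mod_lt \<chi>(3))
  have q: "?q * \<chi> = f + - ?r" by (simp add: minus_mod_eq_div_mult)
  have "\<mu> (?q * \<chi>) = min (\<mu> f) (\<mu> ?r)" if "valuation \<mu>" "\<mu> f \<noteq> \<mu> ?r" for \<mu> :: "'k poly \<Rightarrow> 'l with_inf"
    unfolding q using val_add_neq[OF that(1), of f "- ?r"] that by (simp add: valuation_uminus)
  then have "\<nu> (?q * \<chi>) = \<nu>' (?q * \<chi>)" using v v' ne r f by metis
  moreover have "?q \<noteq> 0"
  proof
    assume "?q = 0"
    then have "?r = f" using div_mult_mod_eq[of f \<chi>] by simp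
    then show False using ne by simp
  qed
  then have "\<nu> ?q + \<nu> \<chi> < \<nu>' ?q + \<nu>' \<chi>"
    using with_inf_add_strict_mono[OF \<chi>(1) fin] le[of ?q] add_right_mono[of "\<nu> ?q" "\<nu>' ?q" "\<nu>' \<chi>"]
    by (meson less_le_trans)
  ultimately show False by (simp add: val_mult[OF v] val_mult[OF v'])
qed

lemma val_min_degree_difference:
  fixes \<nu> \<nu>' :: "'k::field poly \<Rightarrow> 'l::linordered_ab_group_add with_inf"
  assumes "\<And>g. \<nu> g \<le> \<nu>' g" "\<nu> \<noteq> \<nu>'" "\<And>c. \<nu> [:c:] = \<nu>' [:c:]"
  obtains \<chi> where "\<nu> \<chi> < \<nu>' \<chi>" "\<And>a. degree a < degree \<chi> \<Longrightarrow> \<nu> a = \<nu>' a" "degree \<chi> > 0"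
proof -
  obtain f where f: "\<nu> f \<noteq> \<nu>' f" using assms(2) by auto
  obtain \<chi> where \<chi>: "\<nu> \<chi> \<noteq> \<nu>' \<chi>" "\<And>g. \<nu> g \<noteq> \<nu>' g \<Longrightarrow> degree \<chi> \<le> degree g"
    using ex_has_least_nat[of "\<lambda>g. \<nu> g \<noteq> \<nu>' g" f degree] f by blast
  have "degree \<chi> > 0" using \<chi>(1) assms(3) by (metis degree_eq_zeroE gr0I)
  moreover have "\<nu> \<chi> < \<nu>' \<chi>" using \<chi>(1) assms(1)[of \<chi>] by simp
  moreover have "\<nu> a = \<nu>' a" if "degree a < degree \<chi>" for a using \<chi>(2) that by (meson not_le)
  ultimately show ?thesis using that by blast
qed

text \<open>Membership in \<open>T_Rsme\<close> without the bound on the value group, which matters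
  only when a new element of the tree is built.\<close>

definition extends :: "('g \<Rightarrow> 'g sme_index hahn) \<Rightarrow> ('k::field \<Rightarrow> 'g::linordered_ab_group_add with_inf) \<Rightarrow>
    ('k poly \<Rightarrow> 'g sme_index hahn with_inf) \<Rightarrow> bool" where
  "extends \<iota> v \<nu> \<longleftrightarrow> valuation \<nu> \<and> (\<forall>a. \<nu> [:a:] = map_with_inf \<iota> (v a))"

context hahn_emb
begin

lemma extends_const:
  assumes "extends \<iota> v \<nu>" "\<nu> [:c:] = Fin \<alpha>"
  shows "\<alpha> \<in> Q"
  using assms by (cases "v c") (auto simp: extends_def)

lemma extends_const_finite:
  assumes "extends \<iota> v \<nu>" "c \<noteq> 0"
  shows "\<nu> [:c:] \<noteq> Infty"
proof
  assume "\<nu> [:c:] = Infty"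
  moreover have "[:c:] * [:inverse c:] = 1" using assms(2) by (simp add: one_pCons)
  ultimately show False
    using assms(1) val_mult[of \<nu> "[:c:]" "[:inverse c:]"] val_one[of \<nu>]
    by (auto simp: extends_def zero_with_inf_def)
qed

text \<open>If \<open>\<alpha>\<close> is not a torsion element, the powers of \<open>a\<close> modulo \<open>\<chi>\<close> are linearly independent.\<close>

lemma val_mod_powers_torsion:
  assumes ext: "extends \<iota> v \<nu>" and pow: "\<And>n. \<nu> (a ^ n mod \<chi>) = \<nu> (a ^ n)"
    and d: "degree \<chi> > 0" and a: "\<nu> a = Fin \<alpha>"
  shows "\<alpha> \<in> Q"
proof (rule ccontr)
  assume \<alpha>: "\<alpha> \<notin> Q"
  interpret pv: vector_space "smult :: 'a \<Rightarrow> 'a poly \<Rightarrow> 'a poly"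
    by standard (simp_all add: smult_add_right smult_add_left)
  have val: "valuation \<nu>" using ext by (simp add: extends_def)
  define r where "r n = a ^ n mod \<chi>" for n
  have r: "\<nu> (r n) = Fin (real n *\<^sub>R \<alpha>)" for n
    using pow val_power[OF val a] by (simp add: r_def)
  \<comment> \<open>Distinctness is needed modulo Q, because scalar multiplication shifts values by
    elements of Q.\<close>
  have distinct: "m = n" if "real m *\<^sub>R \<alpha> - real n *\<^sub>R \<alpha> \<in> Q" for m n
  proof (rule ccontr)
    assume "m \<noteq> n"
    then consider "n < m" | "m < n" by linarith
    then show False
    proof cases
      case 1
      then have "real (m - n) *\<^sub>R \<alpha> \<in> Q" using that 1 by (simp add: scaleR_diff_left of_nat_diff)
      then show False using \<alpha> 1 div_hull_divide[of "m - n"] by simp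
    next
      case 2
      then have "real (n - m) *\<^sub>R \<alpha> \<in> Q"
        using div_hull_minus[OF that] 2 by (simp add: scaleR_diff_left of_nat_diff)
      then show False using \<alpha> 2 div_hull_divide[of "n - m"] by simp
    qed
  qed
  have inj: "inj r"
  proof (rule injI)
    fix m n assume "r m = r n"
    then have "real m *\<^sub>R \<alpha> = real n *\<^sub>R \<alpha>" using r by (metis with_inf.inject)
    then have "real m *\<^sub>R \<alpha> - real n *\<^sub>R \<alpha> = 0" by (simp only: diff_self)
    then show "m = n" using distinct zero_in_div_hull by metis
  qed
  have smult: "\<exists>t\<in>Q. \<nu> (smult c f) = Fin t + \<nu> f" if c: "c \<noteq> 0" for c f
  proof -
    obtain t where t: "\<nu> [:c:] = Fin t" using extends_const_finite[OF ext c] by (cases "\<nu> [:c:]") auto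
    moreover have "smult c f = [:c:] * f" by simp
    ultimately show ?thesis using extends_const[OF ext t] val_mult[OF val] by metis
  qed
  \<comment> \<open>In a vanishing combination the terms with non-zero coefficient have distinct
    finite values, so their sum has a finite value and is not 0. There are
    \<open>degree \<chi>\<close> + 1 residues, one more than the space of residues allows.\<close>
  have indep: "pv.independent (r ` {..degree \<chi>})"
    unfolding pv.dependent_explicit
  proof
    assume "\<exists>t u. finite t \<and> t \<subseteq> r ` {..degree \<chi>} \<and> (\<Sum>v\<in>t. smult (u v) v) = 0 \<and> (\<exists>v\<in>t. u v \<noteq> 0)"
    then obtain t u where t: "finite t" "t \<subseteq> r ` {..degree \<chi>}" "(\<Sum>v\<in>t. smult (u v) v) = 0" "\<exists>v\<in>t. u v \<noteq> 0"
      by blast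
    define N where "N = {v \<in> t. u v \<noteq> 0}"
    have N: "finite N" "N \<noteq> {}" using t by (auto simp: N_def)
    have sum: "(\<Sum>v\<in>N. smult (u v) v) = 0"
      using t(1,3) by (subst sum.mono_neutral_left[of t N]) (auto simp: N_def)
    have "inj_on (\<lambda>v. \<nu> (smult (u v) v)) N"
    proof (rule inj_onI)
      fix x y assume xy: "x \<in> N" "y \<in> N" "\<nu> (smult (u x) x) = \<nu> (smult (u y) y)"
      have "x \<in> r ` {..degree \<chi>}" "y \<in> r ` {..degree \<chi>}" using xy(1,2) t(2) by (auto simp: N_def)
      then obtain m n where mn: "x = r m" "y = r n" by blast
      obtain s where s: "s \<in> Q" "\<nu> (smult (u x) x) = Fin s + \<nu> x" using smult xy(1) by (auto simp: N_def)
      obtain s' where s': "s' \<in> Q" "\<nu> (smult (u y) y) = Fin s' + \<nu> y" using smult xy(2) by (auto simp: N_def)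
      have "s + real m *\<^sub>R \<alpha> = s' + real n *\<^sub>R \<alpha>" using xy(3) s(2) s'(2) mn r by simp
      then have "real m *\<^sub>R \<alpha> - real n *\<^sub>R \<alpha> = s' - s" by (simp add: algebra_simps)
      then show "x = y" using distinct div_hull_diff[OF s'(1) s(1)] mn by metis
    qed
    from val_sum_inj[OF val N this] sum obtain x where "x \<in> N" "\<nu> (smult (u x) x) = Infty"
      by (auto simp: val_zero[OF val])
    moreover obtain n where "x = r n" using \<open>x \<in> N\<close> t(2) by (auto simp: N_def)
    ultimately show False using smult[of "u x" x] r[of n] by (auto simp: N_def)
  qed
  let ?B = "(\<lambda>i. monom 1 i) ` {..<degree \<chi>} :: 'a poly set"
  have "r n \<in> pv.span ?B" for n
  proof -
    have "degree (r n) < degree \<chi>" unfolding r_def by (rule degree_mod_lt[OF d])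
    then have "r n = (\<Sum>i<degree \<chi>. smult (coeff (r n) i) (monom 1 i))"
      by (intro poly_eqI) (simp add: coeff_sum if_distrib sum.delta coeff_eq_0 cong: if_cong)
    also have "\<dots> \<in> pv.span ?B" by (intro pv.span_sum pv.span_scale pv.span_base) auto
    finally show ?thesis .
  qed
  then have "card (r ` {..degree \<chi>}) \<le> card ?B"
    using pv.independent_span_bound[OF _ indep, of ?B] by auto
  also have "\<dots> \<le> degree \<chi>" using card_image_le[of "{..<degree \<chi>}"] by simp
  finally show False using card_image[OF inj_on_subset[OF inj subset_UNIV], of "{..degree \<chi>}"] by simp
qed

text \<open>Agreement at f passes to all powers of f, so each power keeps its value modulo a \<chi>
  of least degree at which \<nu> and \<nu>' differ.\<close>

proposition val_eq_torsion:
  assumes ext: "extends \<iota> v \<nu>" "extends \<iota> v \<nu>'" and le: "\<And>g. \<nu> g \<le> \<nu>' g" and ne: "\<nu> \<noteq> \<nu>'"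
    and f: "\<nu> f = \<nu>' f" "\<nu> f = Fin \<alpha>"
  shows "\<alpha> \<in> Q"
proof -
  have v: "valuation \<nu>" "valuation \<nu>'" using ext by (auto simp: extends_def)
  have fin: "\<nu> a \<noteq> Infty" if "a \<noteq> 0" for a
    using val_nontrivial_support_maximal[OF v _ that] le ne by (auto simp: le_fun_def)
  obtain \<chi> where \<chi>: "\<nu> \<chi> < \<nu>' \<chi>" "\<And>a. degree a < degree \<chi> \<Longrightarrow> \<nu> a = \<nu>' a" "degree \<chi> > 0"
    using val_min_degree_difference[OF le ne] ext by (auto simp: extends_def)
  have "\<nu> (f ^ n mod \<chi>) = \<nu> (f ^ n)" for n
  proof (rule val_eq_mod[OF v le \<chi> fin])
    show "\<nu> (f ^ n) = \<nu>' (f ^ n)"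
      using f val_power[OF v(1), of f \<alpha> n] val_power[OF v(2), of f \<alpha> n] by simp
  qed
  then show ?thesis using val_mod_powers_torsion[OF ext(1) _ \<chi>(3) f(2)] by simp
qed

end

section \<open>Key polynomials via division with remainder\<close>

lemma lookup_times_single:
  fixes q :: "'l::ab_group_add \<Rightarrow>\<^sub>0 'r::comm_ring_1"
  shows "Poly_Mapping.lookup (q * Poly_Mapping.single \<gamma> g) \<alpha> = Poly_Mapping.lookup q (\<alpha> - \<gamma>) * g"
proof -
  have inner: "Sum_any (\<lambda>m. Poly_Mapping.lookup (Poly_Mapping.single \<gamma> g) m when \<alpha> = l + m)
      = (g when l = \<alpha> - \<gamma>)" for l
  proof -
    have "(\<lambda>m. Poly_Mapping.lookup (Poly_Mapping.single \<gamma> g) m when \<alpha> = l + m)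
        = (\<lambda>m. (g when l = \<alpha> - \<gamma>) when m = \<gamma>)"
      by (auto simp: lookup_single when_def algebra_simps fun_eq_iff)
    then show ?thesis by (simp only: Sum_any_when_equal)
  qed
  have "Poly_Mapping.lookup (q * Poly_Mapping.single \<gamma> g) \<alpha>
      = Sum_any (\<lambda>l. Poly_Mapping.lookup q l * g when l = \<alpha> - \<gamma>)"
    by (simp add: lookup_mult inner mult_when)
  then show ?thesis by simp
qed

lemma value_group_diff: "a \<in> value_group \<nu> \<Longrightarrow> b \<in> value_group \<nu> \<Longrightarrow> a - b \<in> value_group \<nu>"
  by (simp add: value_group_def group_closure.diff)

lemma in_value_group: "\<nu> f = Fin \<alpha> \<Longrightarrow> \<alpha> \<in> value_group \<nu>"
  by (auto simp: value_group_def intro: group_closure.base)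

context
  fixes \<nu> :: "'r::comm_ring_1 \<Rightarrow> 'l::linordered_ab_group_add with_inf"
  assumes v: "valuation \<nu>"
begin

abbreviation "Ge \<equiv> graded_sum_ge \<nu>"
abbreviation "Gr \<equiv> graded_algebra \<nu>"
abbreviation "cls \<equiv> graded_class \<nu>"

lemma graded_sum_ge_simps:
  "x \<oplus>\<^bsub>Ge\<^esub> y = x + y" "x \<otimes>\<^bsub>Ge\<^esub> y = x * y" "\<zero>\<^bsub>Ge\<^esub> = 0" "\<one>\<^bsub>Ge\<^esub> = 1"
  by (simp_all add: graded_sum_ge_def)

lemma carrier_graded_sum_ge:
  "p \<in> carrier Ge \<longleftrightarrow> Poly_Mapping.keys p \<subseteq> value_group \<nu> \<and> (\<forall>\<alpha>. Fin \<alpha> \<le> \<nu> (Poly_Mapping.lookup p \<alpha>))"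
  by (simp add: graded_sum_ge_def val_ge_def)

lemma mem_graded_sum_gt:
  "p \<in> graded_sum_gt \<nu> \<longleftrightarrow> Poly_Mapping.keys p \<subseteq> value_group \<nu> \<and> (\<forall>\<alpha>. Fin \<alpha> < \<nu> (Poly_Mapping.lookup p \<alpha>))"
  by (simp add: graded_sum_gt_def val_gt_def)

lemma single_in_carrier:
  "\<alpha> \<in> value_group \<nu> \<or> f = 0 \<Longrightarrow> Fin \<alpha> \<le> \<nu> f \<Longrightarrow> Poly_Mapping.single \<alpha> f \<in> carrier Ge"
  by (auto simp: carrier_graded_sum_ge lookup_single when_def val_zero[OF v])

lemma carrier_mult: "p \<in> carrier Ge \<Longrightarrow> q \<in> carrier Ge \<Longrightarrow> p * q \<in> carrier Ge"
proof -
  interpret cring Ge by (rule cring_graded_sum_ge[OF v])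
  show "p \<in> carrier Ge \<Longrightarrow> q \<in> carrier Ge \<Longrightarrow> p * q \<in> carrier Ge"
    using m_closed[of p q] by (simp add: graded_sum_ge_simps)
qed

lemma uminus_in_carrier: "p \<in> carrier Ge \<Longrightarrow> - p \<in> carrier Ge"
  by (simp add: carrier_graded_sum_ge valuation_uminus[OF v])

lemma cls_hom: "cls \<in> ring_hom Ge Gr"
  using ideal.rcos_ring_hom[OF ideal_graded_sum_gt[OF v]]
  unfolding graded_algebra_def graded_class_def .

lemma carrier_graded_algebra: "carrier Gr = cls ` carrier Ge"
  by (auto simp: graded_algebra_def FactRing_def A_RCOSETS_def' graded_class_def)

lemma cls_mult: "p \<in> carrier Ge \<Longrightarrow> q \<in> carrier Ge \<Longrightarrow> cls p \<otimes>\<^bsub>Gr\<^esub> cls q = cls (p * q)"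
  using ring_hom_mult[OF cls_hom, of p q] by (simp add: graded_sum_ge_simps)

lemma cls_eq_iff:
  assumes "p \<in> carrier Ge" "q \<in> carrier Ge"
  shows "cls p = cls q \<longleftrightarrow> p - q \<in> graded_sum_gt \<nu>"
proof -
  interpret R: cring Ge by (rule cring_graded_sum_ge[OF v])
  have "\<ominus>\<^bsub>Ge\<^esub> q = - q"
    using assms(2) uminus_in_carrier[OF assms(2)]
    by (intro R.minus_equality) (auto simp: graded_sum_ge_simps)
  then have "p \<ominus>\<^bsub>Ge\<^esub> q = p - q" by (simp add: a_minus_def graded_sum_ge_simps)
  then show ?thesis
    using R.quotient_eq_iff_same_a_r_cos[OF ideal_graded_sum_gt[OF v] assms]
    by (simp add: graded_class_def)
qed

lemma zero_graded_algebra: "\<zero>\<^bsub>Gr\<^esub> = cls 0"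
proof -
  interpret ring_hom_ring Ge Gr cls
    using ideal.rcos_ring_hom_ring[OF ideal_graded_sum_gt[OF v]]
    unfolding graded_algebra_def graded_class_def .
  show ?thesis using hom_zero by (simp add: graded_sum_ge_simps)
qed

lemma initial_term_finite: "\<nu> f = Fin \<alpha> \<Longrightarrow> initial_term \<nu> f = cls (Poly_Mapping.single \<alpha> f)"
  by (simp add: initial_term_def)

lemma cls_in_principal_iff:
  assumes "p \<in> carrier Ge" "s \<in> carrier Ge"
  shows "cls p \<in> PIdl\<^bsub>Gr\<^esub> (cls s) \<longleftrightarrow> (\<exists>q\<in>carrier Ge. p - q * s \<in> graded_sum_gt \<nu>)"
proof -
  have "cls p \<in> PIdl\<^bsub>Gr\<^esub> (cls s) \<longleftrightarrow> (\<exists>q\<in>carrier Ge. cls p = cls (q * s))"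
    using cls_mult assms by (fastforce simp: cgenideal_def carrier_graded_algebra)
  then show ?thesis using cls_eq_iff carrier_mult assms by simp
qed

text \<open>f and \<open>g * \<psi>\<close> differ by something of larger value, so the initial term
  of f is the product of those of g and \<psi>.\<close>

lemma initial_term_in_principal:
  assumes "\<nu> f = Fin \<alpha>" "\<nu> \<psi> = Fin \<delta>" "Fin \<alpha> < \<nu> (f - g * \<psi>)"
  shows "initial_term \<nu> f \<in> PIdl\<^bsub>Gr\<^esub> (initial_term \<nu> \<psi>)"
proof -
  have "\<nu> (f + - (f - g * \<psi>)) = \<nu> f"
    using assms(1,3) by (intro val_add_less[OF v]) (simp only: valuation_uminus[OF v])
  then have "\<nu> g + Fin \<delta> = Fin \<alpha>" using assms by (simp add: val_mult[OF v])
  then obtain \<beta> where \<beta>: "\<nu> g = Fin \<beta>" "\<alpha> = \<beta> + \<delta>" by (cases "\<nu> g") auto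
  have [simp]: "Poly_Mapping.single \<alpha> f \<in> carrier Ge" "Poly_Mapping.single \<delta> \<psi> \<in> carrier Ge"
    "Poly_Mapping.single \<beta> g \<in> carrier Ge"
    using assms \<beta> in_value_group[of \<nu>] by (auto intro!: single_in_carrier)
  have "Poly_Mapping.single \<alpha> f - Poly_Mapping.single \<beta> g * Poly_Mapping.single \<delta> \<psi>
      = Poly_Mapping.single \<alpha> (f - g * \<psi>)"
    by (simp add: mult_single \<beta> single_diff)
  moreover have "Poly_Mapping.single \<alpha> (f - g * \<psi>) \<in> graded_sum_gt \<nu>"
    using assms in_value_group[of \<nu>, OF assms(1)]
    by (auto simp: mem_graded_sum_gt lookup_single when_def val_zero[OF v])
  ultimately show ?thesis
    using assms(1,2) by (auto simp: initial_term_finite cls_in_principal_iff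
        intro!: bexI[of _ "Poly_Mapping.single \<beta> g"])
qed

end

text \<open>The value \<open>Infty\<close> would make the ideal zero, and a monic constant is 1,
  whose initial term generates the whole algebra; \<open>KP\<close> excludes both.\<close>

lemma key_poly_properties:
  fixes \<nu> :: "'k::field poly \<Rightarrow> 'l::linordered_ab_group_add with_inf"
  assumes v: "valuation \<nu>" and \<psi>: "\<psi> \<in> KP \<nu>"
  shows "lead_coeff \<psi> = 1" "degree \<psi> > 0" "\<nu> \<psi> \<noteq> Infty"
    "f \<noteq> 0 \<Longrightarrow> degree f < degree \<psi> \<Longrightarrow> initial_term \<nu> f \<notin> PIdl\<^bsub>graded_algebra \<nu>\<^esub> (initial_term \<nu> \<psi>)"
proof -
  let ?G = "graded_algebra \<nu>" and ?J = "PIdl\<^bsub>graded_algebra \<nu>\<^esub> (initial_term \<nu> \<psi>)"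
  interpret G: cring ?G by (rule cring_graded_algebra[OF v])
  have J: "lead_coeff \<psi> = 1" "?J \<noteq> {\<zero>\<^bsub>?G\<^esub>}" "primeideal ?J ?G"
    "\<And>f. f \<noteq> 0 \<Longrightarrow> degree f < degree \<psi> \<Longrightarrow> initial_term \<nu> f \<notin> ?J"
    using \<psi> by (auto simp: KP_def Let_def)
  show "lead_coeff \<psi> = 1" by fact
  show "f \<noteq> 0 \<Longrightarrow> degree f < degree \<psi> \<Longrightarrow> initial_term \<nu> f \<notin> ?J" by fact
  show fin: "\<nu> \<psi> \<noteq> Infty"
  proof
    assume "\<nu> \<psi> = Infty"
    then have "?J = {\<zero>\<^bsub>?G\<^esub>}" by (auto simp: initial_term_def cgenideal_def intro!: exI[of _ "\<zero>\<^bsub>?G\<^esub>"])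
    then show False using J(2) by simp
  qed
  show "degree \<psi> > 0"
  proof (rule ccontr)
    assume "\<not> ?thesis"
    then have "\<psi> = 1" using J(1) by (auto elim!: degree_eq_zeroE simp: one_pCons)
    then have one: "initial_term \<nu> \<psi> = \<one>\<^bsub>?G\<^esub>"
      using ring_hom_one[OF cls_hom[OF v]] graded_sum_ge_simps(4)[OF v]
      by (simp add: initial_term_def val_one[OF v] zero_with_inf_def)
    have "?J = carrier ?G" 
    proof (intro equalityI subsetI)
      fix x assume "x \<in> carrier ?G"
      then show "x \<in> ?J" unfolding one cgenideal_def using G.r_one by (intro CollectI exI[of _ x]) simp
    qed (auto simp: one cgenideal_def)
    then show False using primeideal.I_notcarr[OF J(3)] by simp
  qed
qed

text \<open>A remainder of smaller value than f differs from a multiple of \<psi> by f only, so its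
  initial term lies in the ideal in spite of its low degree.\<close>

lemma key_poly_val_le_mod:
  fixes \<nu> :: "'k::field poly \<Rightarrow> 'l::linordered_ab_group_add with_inf"
  assumes v: "valuation \<nu>" and \<psi>: "\<psi> \<in> KP \<nu>"
  shows "\<nu> f \<le> \<nu> (f mod \<psi>)"
proof (rule ccontr)
  note kp = key_poly_properties[OF v \<psi>]
  let ?r = "f mod \<psi>"
  assume "\<not> ?thesis"
  then have less: "\<nu> ?r < \<nu> f" by simp
  then obtain \<alpha> where \<alpha>: "\<nu> ?r = Fin \<alpha>" by (cases "\<nu> ?r") auto
  obtain \<delta> where \<delta>: "\<nu> \<psi> = Fin \<delta>" using kp(3) by (cases "\<nu> \<psi>") auto
  have "?r - (- (f div \<psi>)) * \<psi> = f" by simp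
  then have "initial_term \<nu> ?r \<in> PIdl\<^bsub>graded_algebra \<nu>\<^esub> (initial_term \<nu> \<psi>)"
    using less \<alpha> by (intro initial_term_in_principal[OF v \<alpha> \<delta>, of "- (f div \<psi>)"]) simp
  moreover have "?r \<noteq> 0" using \<alpha> val_zero[OF v] by auto
  ultimately show False using kp(4) degree_mod_lt[OF kp(2)] by blast
qed

text \<open>The hypotheses allow the ideal to be tested on remainders modulo \<phi>, where values
  are multiplicative; primeness then follows as in Gauss's lemma.\<close>

proposition key_polyI:
  fixes \<nu> :: "'k::field poly \<Rightarrow> 'l::linordered_ab_group_add with_inf"
  assumes v: "valuation \<nu>" and \<phi>: "lead_coeff \<phi> = 1" "degree \<phi> > 0" "\<nu> \<phi> = Fin \<gamma>"
    and mod: "\<And>f. \<nu> f \<le> \<nu> (f mod \<phi>)"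
    and mult: "\<And>a b. degree a < degree \<phi> \<Longrightarrow> degree b < degree \<phi> \<Longrightarrow> \<nu> (a * b mod \<phi>) = \<nu> a + \<nu> b"
    and fin: "\<And>a. a \<noteq> 0 \<Longrightarrow> degree a < degree \<phi> \<Longrightarrow> \<nu> a \<noteq> Infty"
  shows "\<phi> \<in> KP \<nu>"
proof -
  let ?R = "graded_sum_ge \<nu>" and ?G = "graded_algebra \<nu>" and ?lu = Poly_Mapping.lookup
  define s where "s = Poly_Mapping.single \<gamma> \<phi>"
  have \<gamma>: "\<gamma> \<in> value_group \<nu>" using \<phi>(3) in_value_group[of \<nu>] by blast
  have s: "s \<in> carrier ?R" unfolding s_def using \<gamma> \<phi>(3) by (intro single_in_carrier[OF v]) auto
  have ins: "initial_term \<nu> \<phi> = graded_class \<nu> s" unfolding s_def by (rule initial_term_finite[OF v \<phi>(3)])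
  let ?J = "PIdl\<^bsub>?G\<^esub> (graded_class \<nu> s)"
  \<comment> \<open>The membership test: in every degree the remainder vanishes in the graded
    algebra.\<close>
  define P where "P p \<longleftrightarrow> (\<forall>\<alpha>. Fin \<alpha> < \<nu> (?lu p \<alpha> mod \<phi>))" for p
  have J: "graded_class \<nu> p \<in> ?J \<longleftrightarrow> P p" if p: "p \<in> carrier ?R" for p
  proof
    assume "graded_class \<nu> p \<in> ?J"
    then obtain q where q: "p - q * s \<in> graded_sum_gt \<nu>" using cls_in_principal_iff[OF v p s] by blast
    show "P p" unfolding P_def
    proof
      fix \<alpha>
      have "?lu (p - q * s) \<alpha> = ?lu p \<alpha> - ?lu q (\<alpha> - \<gamma>) * \<phi>"
        by (simp add: s_def lookup_times_single lookup_minus)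
      then have "Fin \<alpha> < \<nu> (?lu p \<alpha> - ?lu q (\<alpha> - \<gamma>) * \<phi>)" using q mem_graded_sum_gt[OF v] by metis
      also have "\<dots> \<le> \<nu> ((?lu p \<alpha> - ?lu q (\<alpha> - \<gamma>) * \<phi>) mod \<phi>)" by (rule mod)
      also have "(?lu p \<alpha> - ?lu q (\<alpha> - \<gamma>) * \<phi>) mod \<phi> = ?lu p \<alpha> mod \<phi>"
        by (metis mod_mult_self2_is_0 mod_diff_right_eq diff_zero)
      finally show "Fin \<alpha> < \<nu> (?lu p \<alpha> mod \<phi>)" .
    qed
  next
    assume P: "P p"
    \<comment> \<open>Componentwise quotients, with degrees lowered by the degree \<gamma> of s so
      that \<open>q * s\<close> matches p degree by degree.\<close>
    define q where "q = Abs_poly_mapping (\<lambda>\<beta>. ?lu p (\<beta> + \<gamma>) div \<phi>)"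
    have "{\<beta>. ?lu p (\<beta> + \<gamma>) div \<phi> \<noteq> 0} \<subseteq> (\<lambda>\<alpha>. \<alpha> - \<gamma>) ` Poly_Mapping.keys p"
    proof
      fix \<beta> assume "\<beta> \<in> {\<beta>. ?lu p (\<beta> + \<gamma>) div \<phi> \<noteq> 0}"
      then have "\<beta> + \<gamma> \<in> Poly_Mapping.keys p" by (auto simp: in_keys_iff)
      then show "\<beta> \<in> (\<lambda>\<alpha>. \<alpha> - \<gamma>) ` Poly_Mapping.keys p" by (force intro: image_eqI[of _ _ "\<beta> + \<gamma>"])
    qed
    then have "finite {\<beta>. ?lu p (\<beta> + \<gamma>) div \<phi> \<noteq> 0}" by (rule finite_subset) simp
    then have luq: "?lu q \<beta> = ?lu p (\<beta> + \<gamma>) div \<phi>" for \<beta>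
      unfolding q_def by (subst Abs_poly_mapping_inverse) auto
    have "Poly_Mapping.keys q \<subseteq> value_group \<nu>"
    proof
      fix \<beta> assume "\<beta> \<in> Poly_Mapping.keys q"
      then have "\<beta> + \<gamma> \<in> Poly_Mapping.keys p" by (auto simp: in_keys_iff luq)
      then have "\<beta> + \<gamma> - \<gamma> \<in> value_group \<nu>"
        using p \<gamma> by (intro value_group_diff) (auto simp: carrier_graded_sum_ge[OF v])
      then show "\<beta> \<in> value_group \<nu>" by simp
    qed
    moreover have "Fin \<beta> \<le> \<nu> (?lu q \<beta>)" for \<beta>
    proof -
      let ?f = "?lu p (\<beta> + \<gamma>)"
      have "Fin (\<beta> + \<gamma>) \<le> \<nu> (?f - ?f mod \<phi>)"
        using p P by (intro val_diff_ge[OF v]) (auto simp: carrier_graded_sum_ge[OF v] P_def intro: less_imp_le)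
      then have "Fin (\<beta> + \<gamma>) \<le> \<nu> (?f div \<phi>) + Fin \<gamma>"
        using \<phi>(3) by (simp add: minus_mod_eq_div_mult val_mult[OF v])
      then show ?thesis unfolding luq by (cases "\<nu> (?f div \<phi>)") auto
    qed
    ultimately have q: "q \<in> carrier ?R" by (simp add: carrier_graded_sum_ge[OF v])
    have "?lu (p - q * s) \<alpha> = ?lu p \<alpha> mod \<phi>" for \<alpha>
      by (simp add: s_def lookup_times_single lookup_minus luq minus_div_mult_eq_mod)
    moreover have "Poly_Mapping.keys (p - q * s) \<subseteq> value_group \<nu>"
      using p carrier_mult[OF v q s] keys_diff[of p "q * s"] by (auto simp: carrier_graded_sum_ge[OF v])
    ultimately have "p - q * s \<in> graded_sum_gt \<nu>" using P by (simp add: mem_graded_sum_gt[OF v] P_def)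
    then show "graded_class \<nu> p \<in> ?J" using cls_in_principal_iff[OF v p s] q by blast
  qed
  \<comment> \<open>\<open>mod\<close> gives \<open>\<le>\<close> in every degree, so equality holds
    at the lowest degree where the test fails.\<close>
  have least: "\<exists>\<alpha>. \<nu> (?lu p \<alpha> mod \<phi>) = Fin \<alpha> \<and> (\<forall>\<beta><\<alpha>. Fin \<beta> < \<nu> (?lu p \<beta> mod \<phi>))"
    if p: "p \<in> carrier ?R" and nP: "\<not> P p" for p
  proof -
    define X where "X = {\<alpha>. \<not> Fin \<alpha> < \<nu> (?lu p \<alpha> mod \<phi>)}"
    have "X \<subseteq> Poly_Mapping.keys p" by (auto simp: X_def in_keys_iff val_zero[OF v])
    then have fX: "finite X" by (rule finite_subset) simp
    have "X \<noteq> {}" using nP by (auto simp: X_def P_def)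
    with fX have "Min X \<in> X" by simp
    then have "\<nu> (?lu p (Min X) mod \<phi>) \<le> Fin (Min X)" by (simp add: X_def not_less)
    moreover have "Fin (Min X) \<le> \<nu> (?lu p (Min X) mod \<phi>)"
      using p mod[of "?lu p (Min X)"] by (auto simp: carrier_graded_sum_ge[OF v] intro: order_trans)
    moreover have "Fin \<beta> < \<nu> (?lu p \<beta> mod \<phi>)" if "\<beta> < Min X" for \<beta>
    proof -
      have "\<beta> \<notin> X" using that Min_le[OF fX] by (meson not_le)
      then show ?thesis by (simp add: X_def)
    qed
    ultimately show ?thesis by (intro exI[of _ "Min X"]) auto
  qed
  have prime: "P p \<or> P q" if p: "p \<in> carrier ?R" and q: "q \<in> carrier ?R" and Ppq: "P (p * q)" for p q
  proof (rule ccontr)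
    assume "\<not> ?thesis"
    then obtain \<alpha>0 \<beta>0 where
      \<alpha>0: "\<nu> (?lu p \<alpha>0 mod \<phi>) = Fin \<alpha>0" "\<And>\<alpha>. \<alpha> < \<alpha>0 \<Longrightarrow> Fin \<alpha> < \<nu> (?lu p \<alpha> mod \<phi>)" and
      \<beta>0: "\<nu> (?lu q \<beta>0 mod \<phi>) = Fin \<beta>0" "\<And>\<beta>. \<beta> < \<beta>0 \<Longrightarrow> Fin \<beta> < \<nu> (?lu q \<beta> mod \<phi>)"
      using least[OF p] least[OF q] by metis
    let ?a = "?lu p \<alpha>0" and ?b = "?lu q \<beta>0" and ?\<delta> = "\<alpha>0 + \<beta>0"
    \<comment> \<open>Only the degree \<open>?\<delta>\<close> is constrained; the others are left
      free so that \<open>lookup_times_closed\<close> applies.\<close>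
    define C where "C \<alpha> = (if \<alpha> = ?\<delta> then {f. Fin ?\<delta> < \<nu> (f mod \<phi>)} else UNIV)" for \<alpha>
    have C0: "0 \<in> C \<alpha>" for \<alpha> by (simp add: C_def val_zero[OF v])
    have Cadd: "f + g \<in> C \<alpha>" if "f \<in> C \<alpha>" "g \<in> C \<alpha>" for f g \<alpha>
      using that val_add_gt[OF v, of "Fin ?\<delta>" "f mod \<phi>" "g mod \<phi>"]
      by (auto simp: C_def poly_mod_add_left split: if_splits)
    have ge: "Fin \<alpha> \<le> \<nu> (?lu h \<alpha> mod \<phi>)" if "h \<in> carrier ?R" for h \<alpha>
      using that mod[of "?lu h \<alpha>"] by (auto simp: carrier_graded_sum_ge[OF v] intro: order_trans)
    have mod_mult: "\<nu> (f * g mod \<phi>) = \<nu> (f mod \<phi>) + \<nu> (g mod \<phi>)" for f g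
      using mult[of "f mod \<phi>" "g mod \<phi>"] degree_mod_lt[OF \<phi>(2)] by (simp add: mod_mult_eq)
    have Cmult: "f * g \<in> C (\<alpha> + \<beta>)" if "\<alpha> + \<beta> = ?\<delta> \<Longrightarrow> Fin (\<alpha> + \<beta>) < \<nu> (f mod \<phi>) + \<nu> (g mod \<phi>)" for f g \<alpha> \<beta>
      using that mod_mult by (simp add: C_def)
    have gt: "Fin (\<alpha> + \<beta>) < x + y" if "Fin \<alpha> < x \<and> Fin \<beta> \<le> y \<or> Fin \<alpha> \<le> x \<and> Fin \<beta> < y" for \<alpha> \<beta> and x y :: "'l with_inf"
      using that by (cases x; cases y) (auto intro: add_less_le_mono add_le_less_mono)
    \<comment> \<open>With the critical components removed, a product of components whose degrees
      sum to \<open>?\<delta>\<close> either vanishes or has a factor below its critical degree,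
      hence excess value.\<close>
    define p' where "p' = p - Poly_Mapping.single \<alpha>0 ?a"
    define q' where "q' = q - Poly_Mapping.single \<beta>0 ?b"
    have p': "?lu p' \<alpha> = (if \<alpha> = \<alpha>0 then 0 else ?lu p \<alpha>)" for \<alpha>
      by (simp add: p'_def lookup_minus lookup_single when_def)
    have q': "?lu q' \<beta> = (if \<beta> = \<beta>0 then 0 else ?lu q \<beta>)" for \<beta>
      by (simp add: q'_def lookup_minus lookup_single when_def)
    have "p = p' + Poly_Mapping.single \<alpha>0 ?a" "q = q' + Poly_Mapping.single \<beta>0 ?b"
      by (simp_all add: p'_def q'_def)
    then have "p * q = p' * q + Poly_Mapping.single \<alpha>0 ?a * (q' + Poly_Mapping.single \<beta>0 ?b)"
      by (metis distrib_right)
    then have split: "p * q = p' * q + Poly_Mapping.single \<alpha>0 ?a * q' + Poly_Mapping.single ?\<delta> (?a * ?b)"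
      by (simp add: distrib_left mult_single add.assoc)
    have "?lu (p' * q) ?\<delta> \<in> C ?\<delta>"
    proof (rule lookup_times_closed[OF C0 Cadd])
      show "?lu p' \<alpha> * ?lu q \<beta> \<in> C (\<alpha> + \<beta>)" for \<alpha> \<beta>
      proof (rule Cmult)
        assume sum: "\<alpha> + \<beta> = ?\<delta>"
        consider "\<alpha> < \<alpha>0" | "\<alpha> = \<alpha>0" | "\<alpha>0 < \<alpha>" by fastforce
        then show "Fin (\<alpha> + \<beta>) < \<nu> (?lu p' \<alpha> mod \<phi>) + \<nu> (?lu q \<beta> mod \<phi>)"
        proof cases
          case 1
          then show ?thesis using \<alpha>0(2) ge[OF q] by (intro gt) (auto simp: p')
        next
          case 2
          then show ?thesis by (simp add: p' val_zero[OF v])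
        next
          case 3
          then have "\<beta> < \<beta>0" using sum by (metis add_less_le_mono not_le order_less_irrefl)
          then show ?thesis using \<beta>0(2) ge[OF p] 3 by (intro gt) (auto simp: p')
        qed
      qed
    qed
    moreover have "?lu (Poly_Mapping.single \<alpha>0 ?a * q') ?\<delta> \<in> C ?\<delta>"
    proof (rule lookup_times_closed[OF C0 Cadd])
      show "?lu (Poly_Mapping.single \<alpha>0 ?a) \<alpha> * ?lu q' \<beta> \<in> C (\<alpha> + \<beta>)" for \<alpha> \<beta>
        by (rule Cmult) (auto simp: lookup_single when_def q' val_zero[OF v])
    qed
    ultimately have "?lu (p' * q) ?\<delta> + ?lu (Poly_Mapping.single \<alpha>0 ?a * q') ?\<delta> \<in> C ?\<delta>" (is "?x \<in> _")
      by (rule Cadd)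
    then have x: "Fin ?\<delta> < \<nu> (?x mod \<phi>)" by (simp add: C_def)
    have "?lu (p * q) ?\<delta> = ?a * ?b + ?x" by (subst split) (simp add: lookup_add)
    then have "?lu (p * q) ?\<delta> mod \<phi> = ?a * ?b mod \<phi> + ?x mod \<phi>" by (simp add: poly_mod_add_left)
    moreover have "\<nu> (?a * ?b mod \<phi>) = Fin ?\<delta>" by (simp add: mod_mult \<alpha>0(1) \<beta>0(1))
    ultimately have "\<nu> (?lu (p * q) ?\<delta> mod \<phi>) = Fin ?\<delta>" using val_add_less[OF v] x by metis
    then show False using Ppq unfolding P_def by (metis less_irrefl)
  qed
  interpret G: cring ?G by (rule cring_graded_algebra[OF v])
  have s_carr: "graded_class \<nu> s \<in> carrier ?G" using s carrier_graded_algebra[OF v] by blast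
  have "primeideal ?J ?G"
  proof (rule primeidealI)
    show "ideal ?J ?G" by (rule G.cgenideal_ideal[OF s_carr])
    show "cring ?G" by (rule G.is_cring)
    have one: "(1 :: 'l \<Rightarrow>\<^sub>0 'k poly) \<in> carrier ?R"
      using cring.cring_simprules(6)[OF cring_graded_sum_ge[OF v]] by (simp add: graded_sum_ge_simps[OF v])
    have "?lu (1 :: 'l \<Rightarrow>\<^sub>0 'k poly) 0 mod \<phi> = 1" using \<phi>(2) by (simp add: lookup_one mod_poly_less)
    then have "\<not> P 1" unfolding P_def by (metis val_one[OF v] zero_with_inf_def less_irrefl)
    then have "graded_class \<nu> 1 \<notin> ?J" using J[OF one] by simp
    then show "carrier ?G \<noteq> ?J" using one carrier_graded_algebra[OF v] by blast
    show "a \<in> ?J \<or> b \<in> ?J" if ab: "a \<in> carrier ?G" "b \<in> carrier ?G" "a \<otimes>\<^bsub>?G\<^esub> b \<in> ?J" for a b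
    proof -
      obtain p q where pq: "p \<in> carrier ?R" "q \<in> carrier ?R" "a = graded_class \<nu> p" "b = graded_class \<nu> q"
        using ab(1,2) by (auto simp: carrier_graded_algebra[OF v])
      then have "P (p * q)" using ab(3) J carrier_mult[OF v pq(1,2)] by (simp add: cls_mult[OF v])
      then show ?thesis using prime[OF pq(1,2)] J pq by blast
    qed
  qed
  moreover have "?J \<noteq> {\<zero>\<^bsub>?G\<^esub>}"
  proof
    assume "?J = {\<zero>\<^bsub>?G\<^esub>}"
    then have "graded_class \<nu> s = graded_class \<nu> 0"
      using G.cgenideal_self[OF s_carr] zero_graded_algebra[OF v] by simp
    moreover have "0 \<in> carrier ?R" by (simp add: carrier_graded_sum_ge[OF v] val_zero[OF v])
    ultimately have "s \<in> graded_sum_gt \<nu>" using cls_eq_iff[OF v s] by simp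
    then have "Fin \<gamma> < \<nu> (?lu s \<gamma>)" using mem_graded_sum_gt[OF v] by blast
    then show False using \<phi>(3) by (simp add: s_def)
  qed
  moreover have "homogeneous \<nu> ?J"
    unfolding homogeneous_def
  proof (intro ballI impI allI)
    fix p \<alpha> assume p: "p \<in> carrier ?R" "graded_class \<nu> p \<in> ?J"
    then have "P p" using J by simp
    then have "P (Poly_Mapping.single \<alpha> (?lu p \<alpha>))"
      by (auto simp: P_def lookup_single when_def val_zero[OF v])
    moreover have "Poly_Mapping.single \<alpha> (?lu p \<alpha>) \<in> carrier ?R"
      using p(1) by (intro single_in_carrier[OF v]) (auto simp: carrier_graded_sum_ge[OF v] in_keys_iff)
    ultimately show "graded_class \<nu> (Poly_Mapping.single \<alpha> (?lu p \<alpha>)) \<in> ?J" using J by simp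
  qed
  moreover have "initial_term \<nu> f \<notin> ?J" if f: "f \<noteq> 0" "degree f < degree \<phi>" for f
  proof -
    obtain \<alpha> where \<alpha>: "\<nu> f = Fin \<alpha>" using fin[OF f] by (cases "\<nu> f") auto
    have "Poly_Mapping.single \<alpha> f \<in> carrier ?R"
      using \<alpha> in_value_group[of \<nu>] by (intro single_in_carrier[OF v]) auto
    moreover have "\<not> P (Poly_Mapping.single \<alpha> f)"
      unfolding P_def using \<alpha> f(2) by (auto simp: mod_poly_less intro!: exI[of _ \<alpha>])
    ultimately show ?thesis using J \<alpha> initial_term_finite[OF v \<alpha>] by simp
  qed
  ultimately show ?thesis using \<phi>(1) by (simp add: KP_def Let_def ins)
qed


context hahn_emb
begin

text \<open>Modulo torsion every value is a multiple of \<open>\<gamma>\<close>, so no cancellation can occur in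
  expansions in powers of \<open>\<phi>\<close>.\<close>

context
  fixes v :: "'k::field \<Rightarrow> 'g with_inf" and \<nu> :: "'k poly \<Rightarrow> 'g sme_index hahn with_inf" and \<phi> \<gamma>
  assumes ext: "extends \<iota> v \<nu>" and monic: "lead_coeff \<phi> = 1" and deg: "degree \<phi> > 0"
    and torsion: "\<And>a. a \<noteq> 0 \<Longrightarrow> degree a < degree \<phi> \<Longrightarrow> \<nu> a \<in> Fin ` Q"
    and \<phi>: "\<nu> \<phi> = Fin \<gamma>" and \<gamma>: "\<gamma> \<notin> Q"
begin

lemma ext_valuation: "valuation \<nu>"
  using ext by (simp add: extends_def)

lemma scale_nontorsion: "n > 0 \<Longrightarrow> t \<in> Q \<Longrightarrow> t + real n *\<^sub>R \<gamma> \<notin> Q"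
  using div_hull_diff[of "t + real n *\<^sub>R \<gamma>" t] div_hull_divide \<gamma> by auto

text \<open>One induction for both claims: the first, at the quotient, shows that
  \<open>f div \<phi> * \<phi>\<close> carries a positive multiple of \<gamma>, which keeps its
  value apart from the torsion value of the remainder.\<close>

lemma val_form:
  shows "f \<noteq> 0 \<Longrightarrow> \<exists>t\<in>Q. \<exists>n. \<nu> f = Fin (t + real n *\<^sub>R \<gamma>)"
    and "\<nu> f = min (\<nu> (f mod \<phi>)) (\<nu> (f div \<phi> * \<phi>))"
proof (induction "degree f" arbitrary: f rule: less_induct)
  case less
  note v = ext_valuation
  let ?q = "f div \<phi>" and ?r = "f mod \<phi>"
  have r: "?r \<noteq> 0 \<Longrightarrow> \<exists>t\<in>Q. \<nu> ?r = Fin t" using torsion[OF _ degree_mod_lt[OF deg]] by blast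
  have r': "\<exists>t\<in>Q. \<exists>n. \<nu> f = Fin (t + real n *\<^sub>R \<gamma>)" if eqs: "\<nu> f = \<nu> ?r" "?r \<noteq> 0"
  proof -
    obtain t where "t \<in> Q" "\<nu> f = Fin (t + real 0 *\<^sub>R \<gamma>)" using r[OF eqs(2)] eqs(1) by auto
    then show ?thesis by blast
  qed
  have q: "\<exists>t\<in>Q. \<exists>n. \<nu> (?q * \<phi>) = Fin (t + real (Suc n) *\<^sub>R \<gamma>)" if q0: "?q \<noteq> 0"
  proof -
    have "degree f \<ge> degree \<phi>" using q0 by (metis div_poly_less not_le)
    then have "degree ?q < degree f" using deg degree_div_less[of f \<phi>] by (cases "f = 0") auto
    then obtain t n where "t \<in> Q" "\<nu> ?q = Fin (t + real n *\<^sub>R \<gamma>)" using less(1) q0 by blast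
    then show ?thesis using \<phi> by (auto simp: val_mult[OF v] scaleR_add_left algebra_simps intro!: bexI[of _ t] exI[of _ n])
  qed
  have f: "f = ?r + ?q * \<phi>" by simp
  have ne: "\<nu> ?r \<noteq> \<nu> (?q * \<phi>)" if "?q \<noteq> 0" "?r \<noteq> 0"
    using q[OF that(1)] r[OF that(2)] scale_nontorsion[OF zero_less_Suc] by fastforce
  show *: "\<nu> f = min (\<nu> ?r) (\<nu> (?q * \<phi>))"
  proof (cases "?q = 0 \<or> ?r = 0")
    case True
    then consider "?q = 0" "?r = f" | "?r = 0" "?q * \<phi> = f" using f by fastforce
    then show ?thesis by cases (simp_all add: val_zero[OF v] min_def)
  next
    case False
    then have "\<nu> (?r + ?q * \<phi>) = min (\<nu> ?r) (\<nu> (?q * \<phi>))" using ne by (intro val_add_neq[OF v]) auto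
    then show ?thesis by simp
  qed
  assume "f \<noteq> 0"
  show "\<exists>t\<in>Q. \<exists>n. \<nu> f = Fin (t + real n *\<^sub>R \<gamma>)"
  proof (cases "?q = 0")
    case True
    then show ?thesis using f \<open>f \<noteq> 0\<close> by (intro r') auto
  next
    case False
    then obtain t n where tn: "t \<in> Q" "\<nu> (?q * \<phi>) = Fin (t + real (Suc n) *\<^sub>R \<gamma>)" using q by blast
    show ?thesis
    proof (cases "\<nu> f = \<nu> (?q * \<phi>)")
      case True
      then show ?thesis using tn by metis
    next
      case False
      then have eq: "\<nu> f = \<nu> ?r" using * by (auto simp: min_def split: if_splits)
      have "?r \<noteq> 0"
      proof
        assume "?r = 0"
        then show False using False * by (simp add: val_zero[OF v] min_def)
      qed
      then show ?thesis using eq by (intro r')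
    qed
  qed
qed

lemma val_le_mod: "\<nu> f \<le> \<nu> (f mod \<phi>)"
  using val_form(2)[of f] by simp

text \<open>The product has torsion value and the quotient part has not, so the minimum in
  \<open>val_form\<close> is attained at the remainder.\<close>

lemma val_mult_mod:
  assumes "degree a < degree \<phi>" "degree b < degree \<phi>"
  shows "\<nu> (a * b mod \<phi>) = \<nu> a + \<nu> b"
proof (cases "a = 0 \<or> b = 0")
  case True
  then show ?thesis by (auto simp: val_zero[OF ext_valuation])
next
  case False
  note v = ext_valuation
  obtain s t where st: "s \<in> Q" "\<nu> a = Fin s" "t \<in> Q" "\<nu> b = Fin t" using torsion assms False by blast
  let ?q = "a * b div \<phi>"
  have "\<nu> (?q * \<phi>) \<noteq> \<nu> (a * b)"
  proof
    assume eq: "\<nu> (?q * \<phi>) = \<nu> (a * b)"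
    then have "?q \<noteq> 0" using st by (auto simp: val_mult[OF v] val_zero[OF v])
    then obtain u n where "u \<in> Q" "\<nu> ?q = Fin (u + real n *\<^sub>R \<gamma>)" using val_form(1) by blast
    then have "u + real (Suc n) *\<^sub>R \<gamma> = s + t"
      using eq st \<phi> by (simp add: val_mult[OF v] scaleR_add_left algebra_simps)
    then show False using scale_nontorsion[OF zero_less_Suc \<open>u \<in> Q\<close>] div_hull_add st by metis
  qed
  then have "\<nu> (a * b) = \<nu> (a * b mod \<phi>)" using val_form(2)[of "a * b"] by (auto simp: min_def split: if_splits)
  then show ?thesis by (simp add: val_mult[OF v])
qed

lemma nontorsion_in_KP: "\<phi> \<in> KP \<nu>"
proof (rule key_polyI[OF ext_valuation monic deg \<phi> val_le_mod val_mult_mod])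
  show "\<nu> a \<noteq> Infty" if "a \<noteq> 0" "degree a < degree \<phi>" for a using torsion[OF that] by auto
qed

text \<open>A key polynomial of smaller degree has torsion value, and dividing by it never hides a
  cancellation; every value, \<gamma> included, would be torsion or infinite.\<close>

lemma key_poly_degree_ge:
  assumes \<psi>: "\<psi> \<in> KP \<nu>"
  shows "degree \<phi> \<le> degree \<psi>"
proof (rule ccontr)
  note v = ext_valuation
  note kp = key_poly_properties[OF v \<psi>]
  assume less: "\<not> ?thesis"
  have \<psi>Q: "\<nu> \<psi> \<in> Fin ` Q" using torsion[of \<psi>] less kp(2) by (cases "\<psi> = 0") auto
  have "f \<noteq> 0 \<Longrightarrow> \<nu> f \<in> insert Infty (Fin ` Q)" for f
  proof (induction "degree f" arbitrary: f rule: less_induct)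
    case (less f)
    let ?q = "f div \<psi>" and ?r = "f mod \<psi>"
    have r: "\<nu> ?r \<in> insert Infty (Fin ` Q)"
      using torsion[of ?r] degree_mod_lt[OF kp(2), of f] \<open>\<not> degree \<phi> \<le> degree \<psi>\<close>
      by (cases "?r = 0") (auto simp: val_zero[OF v])
    have q: "\<nu> (?q * \<psi>) \<in> insert Infty (Fin ` Q)"
    proof (cases "?q = 0")
      case False
      then have "degree f \<ge> degree \<psi>" by (metis div_poly_less not_le)
      then have "degree ?q < degree f" using kp(2) degree_div_less[of f \<psi>] less(2) by auto
      then have "\<nu> ?q \<in> insert Infty (Fin ` Q)" using less(1) False by blast
      then show ?thesis using \<psi>Q div_hull_add by (auto simp: val_mult[OF v])
    qed (simp add: val_zero[OF v])
    have f: "f = ?r + ?q * \<psi>" by simp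
    \<comment> \<open>When both parts have the same value, \<open>key_poly_val_le_mod\<close> keeps
      the value of the sum from exceeding it.\<close>
    have "\<nu> f = \<nu> ?r \<or> \<nu> f = \<nu> (?q * \<psi>)"
    proof (cases "\<nu> ?r = \<nu> (?q * \<psi>)")
      case True
      then have "\<nu> ?r \<le> \<nu> (?r + ?q * \<psi>)" by (intro val_add_ge[OF v]) auto
      then show ?thesis using key_poly_val_le_mod[OF v \<psi>, of f] by (simp add: antisym)
    next
      case False
      then show ?thesis using val_add_neq[OF v False] by (simp add: min_def)
    qed
    then show ?case using q r by auto
  qed
  moreover have "\<phi> \<noteq> 0" using deg by auto
  ultimately have "\<nu> \<phi> \<in> insert Infty (Fin ` Q)" by blast
  then show False using \<phi> \<gamma> by auto
qed

text \<open>Any other key polynomial of least degree is \<open>\<phi> + a\<close> with a of smaller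
  degree. If a had smaller value than \<phi>, it would share the initial term of
  \<open>\<phi> + a\<close>, against its degree; equality is impossible as \<gamma> is not
  torsion.\<close>

proposition sv_nontorsion: "KP \<nu> \<noteq> {}" "sv \<nu> = Fin \<gamma>"
proof -
  note v = ext_valuation
  show "KP \<nu> \<noteq> {}" using nontorsion_in_KP by blast
  let ?\<psi> = "ARG_MIN degree \<psi>. \<psi> \<in> KP \<nu>"
  have \<psi>: "?\<psi> \<in> KP \<nu>" "degree ?\<psi> \<le> degree \<phi>"
    using arg_min_nat_lemma[of "\<lambda>\<psi>. \<psi> \<in> KP \<nu>" \<phi> degree] nontorsion_in_KP by blast+
  note kp = key_poly_properties[OF v \<psi>(1)]
  have degs: "degree ?\<psi> = degree \<phi>" using \<psi> key_poly_degree_ge by (meson antisym)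
  define a where "a = ?\<psi> - \<phi>"
  have da: "degree a < degree \<phi>"
  proof -
    have "coeff a (degree \<phi>) = 0" using kp(1) monic degs by (simp add: a_def)
    moreover have "degree a \<le> degree \<phi>" unfolding a_def using degs by (intro degree_diff_le) auto
    ultimately have "degree a \<noteq> degree \<phi> \<or> a = 0" by (metis leading_coeff_0_iff)
    then show ?thesis using deg \<open>degree a \<le> degree \<phi>\<close> by auto
  qed
  have eq: "?\<psi> = \<phi> + a" by (simp add: a_def)
  have "\<nu> \<phi> \<noteq> \<nu> a" using torsion[OF _ da] \<phi> \<gamma> val_zero[OF v] by (cases "a = 0") auto
  moreover have "\<not> \<nu> a < \<nu> \<phi>"
  proof
    assume less: "\<nu> a < \<nu> \<phi>"
    then have "a \<noteq> 0" using val_zero[OF v] by auto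
    then obtain t where t: "\<nu> a = Fin t" using torsion da by blast
    have "\<nu> ?\<psi> = Fin t" using val_add_less[OF v less] t by (simp add: eq add.commute)
    moreover have "Fin t < \<nu> (a - 1 * ?\<psi>)"
      using less t valuation_uminus[OF v, of \<phi>] by (simp add: a_def)
    ultimately have "initial_term \<nu> a \<in> PIdl\<^bsub>graded_algebra \<nu>\<^esub> (initial_term \<nu> ?\<psi>)"
      by (intro initial_term_in_principal[OF v t])
    then show False using kp(4)[OF \<open>a \<noteq> 0\<close>] da degs by simp
  qed
  ultimately have "\<nu> \<phi> < \<nu> a" by simp
  then show "sv \<nu> = Fin \<gamma>" unfolding sv_def using val_add_less[OF v] \<phi> eq by simp
qed

end

end

section \<open>Augmented valuations\<close>

text \<open>For non-constant \<phi> this is the minimum of w c_i + i \<gamma> over the \<phi>-adic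
  digits c_i of f, so w counts only in degrees below that of \<phi>. The guard for constant \<phi>
  ensures termination.\<close>

function augmentation :: "('k::field poly \<Rightarrow> 'l::linordered_ab_group_add with_inf) \<Rightarrow> 'k poly \<Rightarrow> 'l \<Rightarrow>
    'k poly \<Rightarrow> 'l with_inf" where
  "augmentation w \<phi> \<gamma> f = (if degree \<phi> = 0 \<or> degree f < degree \<phi> then w f
     else min (w (f mod \<phi>)) (Fin \<gamma> + augmentation w \<phi> \<gamma> (f div \<phi>)))"
  by auto
termination
  by (relation "measure (\<lambda>(w, \<phi>, \<gamma>, f). degree f)") (auto simp: degree_div_less)

declare augmentation.simps [simp del]

lemma degree_mult_div_less:
  fixes a b \<phi> :: "'k::field poly"
  assumes "degree a < degree \<phi>" "degree b < degree \<phi>"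
  shows "degree (a * b div \<phi>) < degree \<phi>"
proof (cases "a * b div \<phi> = 0")
  case False
  let ?q = "a * b div \<phi>"
  have "degree ?q + degree \<phi> = degree (?q * \<phi>)" using False assms by (subst degree_mult_eq) auto
  also have "?q * \<phi> = a * b - a * b mod \<phi>" by (simp add: minus_mod_eq_div_mult)
  also have "degree \<dots> \<le> max (degree (a * b)) (degree (a * b mod \<phi>))" by (rule degree_diff_le_max)
  also have "\<dots> < degree \<phi> + degree \<phi>"
    using assms degree_mult_le[of a b] degree_mod_lt[of \<phi> "a * b"] by auto
  finally show ?thesis by simp
qed (use assms in auto)

text \<open>w acts as a valuation on remainders, multiplied modulo \<phi>. The condition on \<gamma>
  is \<open>w_div\<close>: the carry of a product into the next power of \<phi> must not lower its
  value.\<close>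

locale augmentation_data =
  fixes w :: "'k::field poly \<Rightarrow> 'l::linordered_ab_group_add with_inf" and \<phi> :: "'k poly" and \<gamma> :: 'l
  assumes deg: "degree \<phi> > 0"
    and w_zero: "w 0 = Infty" and w_one: "w 1 = 0" and w_minus: "degree a < degree \<phi> \<Longrightarrow> w (- a) = w a"
    and w_add: "degree a < degree \<phi> \<Longrightarrow> degree b < degree \<phi> \<Longrightarrow> min (w a) (w b) \<le> w (a + b)"
    and w_mult: "degree a < degree \<phi> \<Longrightarrow> degree b < degree \<phi> \<Longrightarrow> w (a * b mod \<phi>) = w a + w b"
    and w_div: "degree a < degree \<phi> \<Longrightarrow> degree b < degree \<phi> \<Longrightarrow>
      w a + w b \<le> Fin \<gamma> + w (a * b div \<phi>)"
begin

abbreviation "aug \<equiv> augmentation w \<phi> \<gamma>"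

lemma aug_small: "degree a < degree \<phi> \<Longrightarrow> aug a = w a"
  by (simp add: augmentation.simps)

lemma aug_zero [simp]: "aug 0 = Infty"
  using aug_small[of 0] deg w_zero by simp

lemma aug_rec: "aug f = min (w (f mod \<phi>)) (Fin \<gamma> + aug (f div \<phi>))"
proof (cases "degree f < degree \<phi>")
  case True
  then show ?thesis by (simp add: aug_small mod_poly_less div_poly_less)
next
  case False
  then show ?thesis using deg by (subst augmentation.simps) simp
qed

lemma degree_div_\<phi>_less: "f div \<phi> \<noteq> 0 \<Longrightarrow> degree (f div \<phi>) < degree f"
  using degree_div_less[of f \<phi>] deg div_poly_less[of f \<phi>] by (cases "degree f = 0") auto

lemma aug_add: "min (aug f) (aug g) \<le> aug (f + g)"
proof (induction "degree f + degree g" arbitrary: f g rule: less_induct)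
  case less
  show ?case
  proof (cases "f div \<phi> = 0 \<and> g div \<phi> = 0")
    case True
    then have "f = f mod \<phi>" "g = g mod \<phi>" using div_mult_mod_eq[of f \<phi>] div_mult_mod_eq[of g \<phi>] by auto
    then have d: "degree f < degree \<phi>" "degree g < degree \<phi>" using degree_mod_lt[OF deg] by metis+
    then have "degree (f + g) < degree \<phi>" by (rule degree_add_less)
    then show ?thesis using w_add d by (simp add: aug_small)
  next
    case False
    have "degree (f div \<phi>) \<le> degree f" for f
      using degree_div_\<phi>_less[of f] by (cases "f div \<phi> = 0") auto
    from this[of f] this[of g]
    have "degree (f div \<phi>) + degree (g div \<phi>) < degree f + degree g"
      using False degree_div_\<phi>_less[of f] degree_div_\<phi>_less[of g] by linarith
    then have IH: "min (aug (f div \<phi>)) (aug (g div \<phi>)) \<le> aug ((f + g) div \<phi>)"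
      using less by (simp add: poly_div_add_left)
    have "min (w (f mod \<phi>)) (w (g mod \<phi>)) \<le> w ((f + g) mod \<phi>)"
      by (simp add: poly_mod_add_left w_add degree_mod_lt deg)
    moreover have "min (Fin \<gamma> + aug (f div \<phi>)) (Fin \<gamma> + aug (g div \<phi>)) \<le> Fin \<gamma> + aug ((f + g) div \<phi>)"
      using IH by (auto simp: min_le_iff_disj)
    ultimately show ?thesis unfolding aug_rec[of f] aug_rec[of g] aug_rec[of "f + g"]
      by (auto simp: min_le_iff_disj)
  qed
qed

lemma aug_add_ge: "x \<le> aug f \<Longrightarrow> x \<le> aug g \<Longrightarrow> x \<le> aug (f + g)"
  using aug_add[of f g] by (meson min.boundedI order_trans)

lemma aug_shift: "aug (f * \<phi>) = Fin \<gamma> + aug f"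
proof -
  have "\<phi> \<noteq> 0" using deg by auto
  then show ?thesis using aug_rec[of "f * \<phi>"] w_zero by (simp add: min_def)
qed

text \<open>Multiplying one \<phi>-adic digit by a gives a new digit, controlled by
  \<open>w_mult\<close>, and a carry, controlled by \<open>w_div\<close>.\<close>

lemma aug_mult_small_ge:
  assumes a: "degree a < degree \<phi>"
  shows "w a + aug f \<le> aug (a * f)"
proof (induction "degree f" arbitrary: f rule: less_induct)
  case less
  let ?q = "f div \<phi>" and ?r = "f mod \<phi>"
  have r: "degree ?r < degree \<phi>" by (rule degree_mod_lt[OF deg])
  have "w a + (Fin \<gamma> + aug ?q) \<le> aug (a * ?q * \<phi>)"
  proof (cases "?q = 0")
    case False
    then have "w a + aug ?q \<le> aug (a * ?q)" using less degree_div_\<phi>_less by blast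
    then have "Fin \<gamma> + (w a + aug ?q) \<le> aug (a * ?q * \<phi>)" by (simp only: aug_shift with_inf_add_cancel)
    then show ?thesis by (simp add: ac_simps)
  qed simp
  moreover have "w a + w ?r \<le> aug (a * ?r)"
  proof -
    have dq: "degree (a * ?r div \<phi>) < degree \<phi>" by (rule degree_mult_div_less[OF a r])
    show ?thesis unfolding aug_rec[of "a * ?r"] using w_mult[OF a r] w_div[OF a r] dq
      by (simp add: aug_small)
  qed
  ultimately have "w a + aug f \<le> aug (a * ?q * \<phi> + a * ?r)"
    unfolding aug_rec[of f]
    by (intro aug_add_ge; elim order_trans[rotated]) (auto intro: add_left_mono)
  moreover have "a * ?q * \<phi> + a * ?r = a * f"
  proof -
    have "a * q * \<phi> + a * r = a * (q * \<phi> + r)" for q r by (simp add: algebra_simps)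
    then show ?thesis by (simp only: div_mult_mod_eq)
  qed
  ultimately show ?case by simp
qed

lemma aug_mult_ge: "aug g + aug f \<le> aug (g * f)"
proof (induction "degree g" arbitrary: g rule: less_induct)
  case less
  let ?q = "g div \<phi>" and ?r = "g mod \<phi>"
  have r: "degree ?r < degree \<phi>" by (rule degree_mod_lt[OF deg])
  have "Fin \<gamma> + aug ?q + aug f \<le> aug (?q * f * \<phi>)"
  proof (cases "?q = 0")
    case False
    then have "aug ?q + aug f \<le> aug (?q * f)" using less degree_div_\<phi>_less by blast
    then show ?thesis by (simp only: aug_shift with_inf_add_cancel add.assoc)
  qed simp
  moreover have "w ?r + aug f \<le> aug (?r * f)" by (rule aug_mult_small_ge[OF r])
  ultimately have "aug g + aug f \<le> aug (?q * f * \<phi> + ?r * f)"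
    unfolding aug_rec[of g]
    by (intro aug_add_ge; elim order_trans[rotated]) (auto intro: add_right_mono)
  moreover have "?q * f * \<phi> + ?r * f = g * f"
  proof -
    have "q * f * \<phi> + r * f = (q * \<phi> + r) * f" for q r by (simp add: algebra_simps)
    then show ?thesis by (simp only: div_mult_mod_eq)
  qed
  ultimately show ?case by simp
qed

text \<open>For \<open>\<le>\<close>: if the value of g or of f comes from its quotient part alone,
  the remainder can be discarded and the degree drops. Otherwise both values are attained at the
  remainders, and \<open>w_mult\<close> gives the lowest digit of the product.\<close>

lemma aug_mult: "aug (g * f) = aug g + aug f"
proof (induction "degree g + degree f" arbitrary: f g rule: less_induct)
  case less
  have reduce: "aug (g * f) \<le> aug g + aug f"
    if IH: "\<And>h. degree h < degree g \<Longrightarrow> aug (h * f) = aug h + aug f"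
      and less: "Fin \<gamma> + aug (g div \<phi>) < w (g mod \<phi>)" for g f
  proof (cases "aug f = Infty")
    case False
    let ?q = "g div \<phi>" and ?r = "g mod \<phi>"
    have r: "degree (- ?r) < degree \<phi>" using degree_mod_lt[OF deg] by simp
    have "?q \<noteq> 0" using less by auto
    then have IH: "aug (?q * f * \<phi>) = Fin \<gamma> + aug ?q + aug f"
      using IH degree_div_\<phi>_less by (simp add: aug_shift add.assoc)
    have g: "aug g = Fin \<gamma> + aug ?q" using less by (simp add: aug_rec[of g])
    have "aug (?q * f * \<phi>) < w ?r + aug f"
      using with_inf_add_strict_mono[OF less False] IH by (simp add: add.commute)
    also have "\<dots> \<le> aug (- ?r * f)"
      using aug_mult_small_ge[OF r, of f] w_minus[of ?r] r by simp
    finally have "aug (?q * f * \<phi>) < aug (- ?r * f)" .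
    moreover have "?q * f * \<phi> = g * f + - ?r * f"
    proof -
      have "q * f * \<phi> = (q * \<phi> + r) * f + - r * f" for q r by (simp add: algebra_simps)
      from this[of ?q ?r] show ?thesis by (simp only: div_mult_mod_eq)
    qed
    \<comment> \<open>The term \<open>- ?r * f\<close> has larger value than the sum, so the minimum
      in \<open>aug_add\<close> must come from \<open>g * f\<close>.\<close>
    ultimately have "aug (g * f) \<le> aug (?q * f * \<phi>)"
      using aug_add[of "g * f" "- ?r * f"] by (auto simp: min_le_iff_disj)
    then show ?thesis by (simp add: g IH)
  qed simp
  have "aug (g * f) \<le> aug g + aug f"
  proof -
    consider "Fin \<gamma> + aug (g div \<phi>) < w (g mod \<phi>)" | "Fin \<gamma> + aug (f div \<phi>) < w (f mod \<phi>)"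
      | "w (g mod \<phi>) \<le> Fin \<gamma> + aug (g div \<phi>)" "w (f mod \<phi>) \<le> Fin \<gamma> + aug (f div \<phi>)" by fastforce
    then show ?thesis
    proof cases
      case 1
      then show ?thesis using less by (intro reduce) auto
    next
      case 2
      then have "aug (f * g) \<le> aug f + aug g"
        using less[of g] by (intro reduce) (auto simp: mult.commute add.commute)
      then show ?thesis by (simp add: mult.commute add.commute)
    next
      case 3
      have "aug (g * f) \<le> w (g * f mod \<phi>)" by (simp add: aug_rec[of "g * f"])
      also have "\<dots> = w ((g mod \<phi>) * (f mod \<phi>) mod \<phi>)" by (simp add: mod_mult_eq)
      also have "\<dots> = w (g mod \<phi>) + w (f mod \<phi>)" by (intro w_mult degree_mod_lt deg)
      also have "\<dots> = aug g + aug f" using 3 by (simp add: aug_rec[of g] aug_rec[of f] min_def)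
      finally show ?thesis .
    qed
  qed
  then show ?case using aug_mult_ge by (intro antisym)
qed

lemma valuation_aug: "valuation aug"
  unfolding valuation_def using aug_mult aug_add aug_small[of 1] deg w_one by simp

lemma aug_\<phi>: "aug \<phi> = Fin \<gamma>"
  using aug_shift[of 1] aug_small[of 1] deg w_one by (simp add: zero_with_inf_def)

lemma aug_le:
  assumes v: "valuation \<mu>" and small: "\<And>a. degree a < degree \<phi> \<Longrightarrow> w a \<le> \<mu> a" and \<phi>: "Fin \<gamma> \<le> \<mu> \<phi>"
  shows "aug f \<le> \<mu> f"
proof (induction "degree f" arbitrary: f rule: less_induct)
  case less
  let ?q = "f div \<phi>" and ?r = "f mod \<phi>"
  have "aug ?q \<le> \<mu> ?q"
    using less degree_div_\<phi>_less val_zero[OF v] by (cases "?q = 0") auto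
  then have "Fin \<gamma> + aug ?q \<le> \<mu> (?q * \<phi>)"
    using \<phi> by (simp add: val_mult[OF v] add.commute add_mono)
  moreover have "w ?r \<le> \<mu> ?r" by (intro small degree_mod_lt deg)
  ultimately have "aug f \<le> \<mu> (?q * \<phi> + ?r)"
    unfolding aug_rec[of f] by (intro val_add_ge[OF v]; elim order_trans[rotated]) auto
  then show ?case by simp
qed

end

lemma T_smeD:
  assumes "\<mu> \<in> T_sme v \<iota> \<Gamma>sme"
  shows "extends \<iota> v \<mu>" "KP \<mu> \<noteq> {} \<Longrightarrow> sv \<mu> \<in> Fin ` \<Gamma>sme"
  using assms by (auto simp: T_sme_def T_Rsme_def extends_def)

lemma value_group_subset_R_cut:
  assumes "\<And>f \<alpha>. \<mu> f = Fin \<alpha> \<Longrightarrow> \<alpha> \<in> R_cut S"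
  shows "value_group \<mu> \<subseteq> R_cut S"
proof
  fix x assume "x \<in> value_group \<mu>"
  then show "x \<in> R_cut S"
    unfolding value_group_def
    by induction (use assms R_cut_zero R_cut_diff in auto)
qed

lemma T_smeI:
  assumes "extends \<iota> v \<mu>" "S \<in> initial_segments" "\<And>f \<alpha>. \<mu> f = Fin \<alpha> \<Longrightarrow> \<alpha> \<in> R_cut S"
    "KP \<mu> \<noteq> {} \<Longrightarrow> sv \<mu> \<in> Fin ` \<Gamma>sme"
  shows "\<mu> \<in> T_sme v \<iota> \<Gamma>sme"
  using assms value_group_subset_R_cut[of \<mu> S] by (auto simp: T_sme_def T_Rsme_def extends_def)

context sme_setting
begin

text \<open>\<mu>' \<phi> is not torsion, hence it is the singular value of \<mu>' and a
  representative; lying in the cut of \<gamma> it equals \<gamma>, and \<open>aug_le\<close> gives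
  the missing inequality.\<close>

lemma augmentation_minimal:
  fixes v :: "'k::field \<Rightarrow> 'g with_inf" and w :: "'k poly \<Rightarrow> 'g sme_index hahn with_inf"
  assumes "augmentation_data w \<phi> \<gamma>" and monic: "lead_coeff \<phi> = 1"
    and const: "\<And>c. w [:c:] = map_with_inf \<iota> (v c)"
    and torsion: "\<And>a. a \<noteq> 0 \<Longrightarrow> degree a < degree \<phi> \<Longrightarrow> w a \<in> Fin ` Q"
    and \<gamma>: "\<gamma> \<in> \<Gamma>sme" "\<gamma> \<notin> Q"
  shows "augmentation w \<phi> \<gamma> \<in> T_sme v \<iota> \<Gamma>sme"
    and "\<And>\<mu>' \<gamma>'. \<mu>' \<in> T_sme v \<iota> \<Gamma>sme \<Longrightarrow> \<mu>' \<le> augmentation w \<phi> \<gamma> \<Longrightarrow> (\<And>a. degree a < degree \<phi> \<Longrightarrow> \<mu>' a = w a) \<Longrightarrow>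
      \<mu>' \<phi> = Fin \<gamma>' \<Longrightarrow> same_cut \<iota> \<gamma>' \<gamma> \<Longrightarrow> \<mu>' = augmentation w \<phi> \<gamma>"
proof -
  interpret augmentation_data w \<phi> \<gamma> by fact
  have ext: "extends \<iota> v aug"
    using valuation_aug const by (simp add: extends_def aug_small deg)
  have tors: "aug a \<in> Fin ` Q" if "a \<noteq> 0" "degree a < degree \<phi>" for a
    using torsion[OF that] that by (simp add: aug_small)
  \<comment> \<open>One initial segment serves all values: what they contain besides multiples of
    \<gamma> lies in Q, hence in \<open>R_lvl\<close>.\<close>
  obtain S where S: "S \<in> initial_segments" "\<gamma> \<in> R_cut S"
    using \<gamma>(1) reps by (auto simp: sme_representatives_def R_sme_def)
  show "aug \<in> T_sme v \<iota> \<Gamma>sme"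
  proof (rule T_smeI[OF ext S(1)])
    fix f \<alpha> assume f: "aug f = Fin \<alpha>"
    then have "f \<noteq> 0" by auto
    from val_form(1)[OF ext monic deg tors aug_\<phi> \<gamma>(2) this] f
    obtain t n where t: "t \<in> Q" "\<alpha> = t + real n *\<^sub>R \<gamma>" by auto
    have "real n *\<^sub>R \<gamma> \<in> R_cut S" using S(2) by (auto simp: R_cut_def supp_def)
    then show "\<alpha> \<in> R_cut S"
      using t div_hull_subset_R_lvl R_lvl_subset_R_cut by (auto intro: R_cut_add)
  next
    show "sv aug \<in> Fin ` \<Gamma>sme"
      using sv_nontorsion(2)[OF ext monic deg tors aug_\<phi> \<gamma>(2)] \<gamma>(1) by simp
  qed
  fix \<mu>' \<gamma>' assume \<mu>': "\<mu>' \<in> T_sme v \<iota> \<Gamma>sme" "\<mu>' \<le> aug" "\<And>a. degree a < degree \<phi> \<Longrightarrow> \<mu>' a = w a"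
    "\<mu>' \<phi> = Fin \<gamma>'" and cut: "same_cut \<iota> \<gamma>' \<gamma>"
  have "\<mu>' a \<in> Fin ` Q" if "a \<noteq> 0" "degree a < degree \<phi>" for a using torsion[OF that] \<mu>'(3) that by simp
  moreover have "\<gamma>' \<notin> Q" using cut by (simp add: same_cut_def)
  ultimately have "KP \<mu>' \<noteq> {}" "sv \<mu>' = Fin \<gamma>'"
    using sv_nontorsion[OF T_smeD(1)[OF \<mu>'(1)] monic deg _ \<mu>'(4)] by auto
  then have "\<gamma>' \<in> \<Gamma>sme" using T_smeD(2)[OF \<mu>'(1)] by auto
  then have "\<gamma>' = \<gamma>" using representatives_eq \<gamma>(1) cut by blast
  moreover have "valuation \<mu>'" using T_smeD(1)[OF \<mu>'(1)] by (simp add: extends_def)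
  ultimately have "aug f \<le> \<mu>' f" for f using \<mu>'(3,4) by (intro aug_le) auto
  then show "\<mu>' = aug" using \<mu>'(2) by (auto simp: le_fun_def intro: antisym)
qed

end

section \<open>Suprema of increasing families\<close>

locale increasing_family = sme_setting \<iota> \<Gamma>sme
  for \<iota> :: "'g::linordered_ab_group_add \<Rightarrow> 'g sme_index hahn" and \<Gamma>sme +
  fixes v :: "'k::field \<Rightarrow> 'g with_inf" and V :: "('k poly \<Rightarrow> 'g sme_index hahn with_inf) set"
  assumes V: "V \<subseteq> T_sme v \<iota> \<Gamma>sme"
    and chain: "\<And>\<nu> \<nu>'. \<nu> \<in> V \<Longrightarrow> \<nu>' \<in> V \<Longrightarrow> \<nu> \<le> \<nu>' \<or> \<nu>' \<le> \<nu>"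
    and no_max: "\<And>\<nu>. \<nu> \<in> V \<Longrightarrow> \<exists>\<nu>'\<in>V. \<nu> < \<nu>'"
    and nonempty: "V \<noteq> {}"
begin

lemma family_extends: "\<nu> \<in> V \<Longrightarrow> extends \<iota> v \<nu>"
  using V T_smeD by blast

lemma family_valuation: "\<nu> \<in> V \<Longrightarrow> valuation \<nu>"
  using family_extends by (simp add: extends_def)

text \<open>A valuation with non-trivial support has nothing strictly above it, but every member of
  V has.\<close>

lemma family_finite:
  assumes "\<nu> \<in> V" "f \<noteq> 0"
  shows "\<nu> f \<noteq> Infty"
proof
  assume "\<nu> f = Infty"
  moreover obtain \<nu>' where "\<nu>' \<in> V" "\<nu> < \<nu>'" using no_max assms by blast
  ultimately show False
    using val_nontrivial_support_maximal[of \<nu> \<nu>' f] less_imp_le[of \<nu> \<nu>'] family_valuation assms by auto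
qed

lemma family_torsion:
  assumes "\<nu> \<in> V" "\<nu>' \<in> V" "\<nu> < \<nu>'" "\<nu> f = \<nu>' f" "f \<noteq> 0"
  shows "\<nu> f \<in> Fin ` Q"
proof -
  obtain \<alpha> where \<alpha>: "\<nu> f = Fin \<alpha>" using family_finite[OF assms(1,5)] by (cases "\<nu> f") auto
  have "\<alpha> \<in> Q"
    using assms(3) less_imp_le[OF assms(3)] by (intro val_eq_torsion[OF family_extends[OF assms(1)] family_extends[OF assms(2)] _ _ assms(4) \<alpha>])
      (auto simp: le_fun_def)
  then show ?thesis using \<alpha> by simp
qed

text \<open>Validity on a tail of V. Since V is a chain, finitely many eventual statements hold
  together.\<close>

definition ev :: "(('k poly \<Rightarrow> 'g sme_index hahn with_inf) \<Rightarrow> bool) \<Rightarrow> bool" where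
  "ev P \<longleftrightarrow> (\<exists>\<nu>\<in>V. \<forall>\<nu>'\<in>V. \<nu> \<le> \<nu>' \<longrightarrow> P \<nu>')"

lemma ev_conj: "ev P \<Longrightarrow> ev R \<Longrightarrow> ev (\<lambda>\<nu>. P \<nu> \<and> R \<nu>)"
proof -
  assume "ev P" "ev R"
  then obtain \<mu> \<nu> where \<mu>: "\<mu> \<in> V" "\<And>\<nu>'. \<nu>' \<in> V \<Longrightarrow> \<mu> \<le> \<nu>' \<Longrightarrow> P \<nu>'"
    and \<nu>: "\<nu> \<in> V" "\<And>\<nu>'. \<nu>' \<in> V \<Longrightarrow> \<nu> \<le> \<nu>' \<Longrightarrow> R \<nu>'"
    unfolding ev_def by blast
  obtain \<rho> where "\<rho> \<in> V" "\<mu> \<le> \<rho>" "\<nu> \<le> \<rho>" using chain[OF \<mu>(1) \<nu>(1)] \<mu>(1) \<nu>(1) by blast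
  then show ?thesis using \<mu>(2) \<nu>(2) unfolding ev_def by (meson order_trans)
qed

lemma ev_ge: "\<nu> \<in> V \<Longrightarrow> ev (\<lambda>\<nu>'. \<nu> \<le> \<nu>')"
  by (auto simp: ev_def)

lemma ev_obtain:
  assumes "ev P"
  obtains \<nu> where "\<nu> \<in> V" "P \<nu>" "\<And>\<nu>'. \<nu>' \<in> V \<Longrightarrow> \<nu> \<le> \<nu>' \<Longrightarrow> P \<nu>'"
  using assms unfolding ev_def by blast

text \<open>The eventual value, not a supremum of values; it is meaningful for stable f.\<close>

definition lim :: "'k poly \<Rightarrow> 'g sme_index hahn with_inf" where
  "lim f = (SOME x. ev (\<lambda>\<nu>. \<nu> f = x))"

definition stable :: "'k poly \<Rightarrow> bool" where
  "stable f \<longleftrightarrow> (\<exists>x. ev (\<lambda>\<nu>. \<nu> f = x))"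

lemma stable_lim: "stable f \<Longrightarrow> ev (\<lambda>\<nu>. \<nu> f = lim f)"
  unfolding stable_def lim_def by (rule someI_ex)

lemma lim_ge:
  assumes "stable f" "\<nu> \<in> V"
  shows "\<nu> f \<le> lim f"
proof -
  obtain \<nu>' where "\<nu>' \<in> V" "\<nu>' f = lim f \<and> \<nu> \<le> \<nu>'"
    using ev_obtain[OF ev_conj[OF stable_lim[OF assms(1)] ev_ge[OF assms(2)]]] by metis
  then show ?thesis by (metis le_fun_def)
qed

lemma lim_le:
  assumes "stable f" "\<And>\<nu>. \<nu> \<in> V \<Longrightarrow> \<nu> \<le> \<mu>"
  shows "lim f \<le> \<mu> f"
  using ev_obtain[OF stable_lim[OF assms(1)]] assms(2) by (metis le_fun_def)

text \<open>Two distinct members of the tail agree at f, which is the situation of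
  \<open>val_eq_torsion\<close>.\<close>

lemma stable_torsion:
  assumes "stable f" "f \<noteq> 0"
  shows "lim f \<in> Fin ` Q"
proof -
  obtain \<nu> where \<nu>: "\<nu> \<in> V" "\<nu> f = lim f" "\<And>\<nu>'. \<nu>' \<in> V \<Longrightarrow> \<nu> \<le> \<nu>' \<Longrightarrow> \<nu>' f = lim f"
    using ev_obtain[OF stable_lim[OF assms(1)]] by metis
  obtain \<nu>' where "\<nu>' \<in> V" "\<nu> < \<nu>'" using no_max \<nu>(1) by blast
  then show ?thesis using family_torsion[OF \<nu>(1)] \<nu>(2,3) assms(2) by (metis less_imp_le)
qed

lemma stable_eq:
  assumes "ev (\<lambda>\<nu>. \<nu> f = x)"
  shows "stable f" "lim f = x"
proof -
  show s: "stable f" using assms by (auto simp: stable_def)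
  show "lim f = x" using ev_obtain[OF ev_conj[OF stable_lim[OF s] assms]] by metis
qed

lemma stable_const: "stable [:c:]" "lim [:c:] = map_with_inf \<iota> (v c)"
proof -
  have "ev (\<lambda>\<nu>. \<nu> [:c:] = map_with_inf \<iota> (v c))"
    using nonempty family_extends unfolding ev_def extends_def by blast
  then show "stable [:c:]" "lim [:c:] = map_with_inf \<iota> (v c)" by (rule stable_eq)+
qed

lemma lim_zero: "lim 0 = Infty"
proof -
  have "ev (\<lambda>\<nu>. \<nu> 0 = Infty)" using nonempty val_zero[OF family_valuation] unfolding ev_def by blast
  then show ?thesis by (rule stable_eq)
qed

lemma lim_one: "lim 1 = 0"
proof -
  have "ev (\<lambda>\<nu>. \<nu> 1 = 0)" using nonempty val_one[OF family_valuation] unfolding ev_def by blast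
  then show ?thesis by (rule stable_eq)
qed

lemma lim_minus: "lim (- f) = lim f"
proof -
  have "ev (\<lambda>\<nu>. \<nu> (- f) = x) \<longleftrightarrow> ev (\<lambda>\<nu>. \<nu> f = x)" for x
    unfolding ev_def using valuation_uminus[OF family_valuation] by metis
  then show ?thesis by (simp add: lim_def)
qed

lemma lim_add:
  assumes "stable f" "stable g" "stable (f + g)"
  shows "min (lim f) (lim g) \<le> lim (f + g)"
proof -
  obtain \<nu> where "\<nu> \<in> V" "\<nu> f = lim f \<and> \<nu> g = lim g \<and> \<nu> (f + g) = lim (f + g)"
    using ev_obtain[OF ev_conj[OF stable_lim[OF assms(1)] ev_conj[OF stable_lim[OF assms(2)] stable_lim[OF assms(3)]]]]
    by metis
  then show ?thesis using val_add[OF family_valuation, of \<nu> f g] by simp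
qed

lemma lim_mult:
  assumes "stable f" "stable g" "stable (f * g)"
  shows "lim (f * g) = lim f + lim g"
proof -
  obtain \<nu> where "\<nu> \<in> V" "\<nu> f = lim f \<and> \<nu> g = lim g \<and> \<nu> (f * g) = lim (f * g)"
    using ev_obtain[OF ev_conj[OF stable_lim[OF assms(1)] ev_conj[OF stable_lim[OF assms(2)] stable_lim[OF assms(3)]]]]
    by metis
  then show ?thesis using val_mult[OF family_valuation, of \<nu> f g] by metis
qed

text \<open>All limit values are torsion, so a key polynomial would only have a value in
  \<open>Q \<subseteq> \<Gamma>sme\<close>.\<close>

lemma supremum_all_stable:
  assumes st: "\<And>f. stable f"
  shows "\<exists>\<mu> \<in> T_sme v \<iota> \<Gamma>sme. (\<forall>\<nu>\<in>V. \<nu> \<le> \<mu>) \<and>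
           (\<forall>\<mu>' \<in> T_sme v \<iota> \<Gamma>sme. (\<forall>\<nu>\<in>V. \<nu> \<le> \<mu>') \<and> \<mu>' \<le> \<mu> \<longrightarrow> \<mu>' = \<mu>)"
proof (rule bexI[of _ lim])
  have val: "valuation lim"
    unfolding valuation_def using lim_mult lim_add st lim_one lim_zero by blast
  show "lim \<in> T_sme v \<iota> \<Gamma>sme"
  proof (rule T_smeI[OF _ empty_initial_segment])
    show "extends \<iota> v lim" using val stable_const(2) by (simp add: extends_def)
    show "\<alpha> \<in> R_cut {}" if "lim f = Fin \<alpha>" for f \<alpha>
      using stable_torsion[OF st, of f] that lim_zero div_hull_subset_R_lvl R_lvl_subset_R_cut
      by (cases "f = 0") auto
    assume ne: "KP lim \<noteq> {}"
    let ?\<psi> = "ARG_MIN degree \<psi>. \<psi> \<in> KP lim"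
    have "?\<psi> \<in> KP lim" using ne arg_min_nat_lemma[of "\<lambda>\<psi>. \<psi> \<in> KP lim" _ degree] by blast
    then have "?\<psi> \<noteq> 0" using key_poly_properties(2)[OF val] by fastforce
    then have "lim ?\<psi> \<in> Fin ` Q" by (rule stable_torsion[OF st])
    then show "sv lim \<in> Fin ` \<Gamma>sme" using div_hull_subset_representatives by (auto simp: sv_def)
  qed
  show "(\<forall>\<nu>\<in>V. \<nu> \<le> lim) \<and>
      (\<forall>\<mu>' \<in> T_sme v \<iota> \<Gamma>sme. (\<forall>\<nu>\<in>V. \<nu> \<le> \<mu>') \<and> \<mu>' \<le> lim \<longrightarrow> \<mu>' = lim)"
    using lim_ge[OF st] lim_le[OF st] by (auto simp: le_fun_def intro!: antisym)
qed

end

section \<open>Families whose values do not stabilise\<close>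

locale unstable_family = increasing_family \<iota> \<Gamma>sme v V
  for \<iota> :: "'g::linordered_ab_group_add \<Rightarrow> 'g sme_index hahn" and \<Gamma>sme
    and v :: "'k::field \<Rightarrow> 'g with_inf" and V :: "('k poly \<Rightarrow> 'g sme_index hahn with_inf) set" +
  fixes \<phi> :: "'k poly"
  assumes monic: "lead_coeff \<phi> = 1" and unstable: "\<not> stable \<phi>"
    and stable_small: "\<And>a. degree a < degree \<phi> \<Longrightarrow> stable a"
begin

lemma deg: "degree \<phi> > 0"
  using stable_const(1) unstable by (metis degree_eq_zeroE gr0I)

definition U :: "'g sme_index hahn set" where
  "U = {u. \<exists>\<nu>\<in>V. \<nu> \<phi> = Fin u}"

lemma \<phi>_finite:
  assumes "\<nu> \<in> V"
  obtains u where "\<nu> \<phi> = Fin u" "u \<in> U"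
proof -
  have "\<phi> \<noteq> 0" using deg by auto
  then show ?thesis using family_finite[OF assms] that assms by (cases "\<nu> \<phi>") (auto simp: U_def)
qed

lemma \<phi>_increases:
  assumes "\<nu> \<in> V"
  obtains \<nu>' where "\<nu>' \<in> V" "\<nu> \<le> \<nu>'" "\<nu> \<phi> < \<nu>' \<phi>"
proof -
  obtain \<nu>' where \<nu>': "\<nu>' \<in> V" "\<nu> \<le> \<nu>'" "\<nu>' \<phi> \<noteq> \<nu> \<phi>"
    using unstable assms unfolding stable_def ev_def by metis
  then have "\<nu> \<phi> \<le> \<nu>' \<phi>" by (simp add: le_fun_def)
  then show ?thesis using that \<nu>' by auto
qed

lemma U_no_max:
  assumes "u \<in> U"
  shows "\<exists>u'\<in>U. u < u'"
proof -
  obtain \<nu> where \<nu>: "\<nu> \<in> V" "\<nu> \<phi> = Fin u" using assms by (auto simp: U_def)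
  obtain \<nu>' where \<nu>': "\<nu>' \<in> V" "\<nu> \<phi> < \<nu>' \<phi>" using \<phi>_increases[OF \<nu>(1)] by metis
  obtain u' where "\<nu>' \<phi> = Fin u'" "u' \<in> U" using \<phi>_finite[OF \<nu>'(1)] .
  then show ?thesis using \<nu> \<nu>' by auto
qed

lemma val_quotient_increases:
  assumes "\<nu> \<in> V" "\<nu>' \<in> V" "\<nu> \<le> \<nu>'" "\<nu> \<chi> < \<nu>' \<chi>" "q \<noteq> 0"
  shows "\<nu> (q * \<chi>) < \<nu>' (q * \<chi>)"
proof -
  have "\<nu> q + \<nu> \<chi> < \<nu> q + \<nu>' \<chi>" using assms family_finite by (intro with_inf_add_strict_mono)
  also have "\<dots> \<le> \<nu>' q + \<nu>' \<chi>" using assms(3) by (intro add_right_mono) (simp add: le_fun_def)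
  finally show ?thesis using assms by (simp add: val_mult[OF family_valuation])
qed

text \<open>Otherwise \<open>\<nu> \<chi> < \<nu>' \<chi>\<close> for some \<open>\<chi>\<close> of degree below that of \<open>\<phi>\<close>, and once \<open>\<chi>\<close> has
  stabilised, division of \<open>\<phi>\<close> by \<open>\<chi>\<close> makes the values at \<open>\<phi>\<close> torsion.\<close>

lemma stationary_if_no_torsion:
  assumes \<nu>: "\<nu> \<in> V" "\<nu> \<phi> = Fin u" and no_tors: "\<And>t u'. t \<in> Q \<Longrightarrow> u' \<in> U \<Longrightarrow> u \<le> t \<Longrightarrow> \<not> t \<le> u'"
    and \<nu>': "\<nu>' \<in> V" "\<nu> \<le> \<nu>'" and a: "degree a < degree \<phi>"
  shows "\<nu> a = \<nu>' a"
proof (rule ccontr)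
  assume ne: "\<nu> a \<noteq> \<nu>' a"
  note v = family_valuation[OF \<nu>(1)] and v' = family_valuation[OF \<nu>'(1)]
  have le: "\<nu> g \<le> \<nu>' g" for g using \<nu>'(2) by (simp add: le_fun_def)
  have lt: "\<nu> < \<nu>'" using \<nu>'(2) ne by (auto simp: order_less_le)
  have const: "\<nu> [:c:] = \<nu>' [:c:]" for c using family_extends[OF \<nu>(1)] family_extends[OF \<nu>'(1)] by (simp add: extends_def)
  have "\<nu> \<noteq> \<nu>'" using lt by simp
  from val_min_degree_difference[OF le this const] obtain \<chi> where
    \<chi>: "\<nu> \<chi> < \<nu>' \<chi>" "\<And>a. degree a < degree \<chi> \<Longrightarrow> \<nu> a = \<nu>' a" "degree \<chi> > 0" by blast
  have d\<chi>: "degree \<chi> < degree \<phi>" using \<chi>(2)[of a] ne a by (meson le_less_trans not_le)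
  let ?q = "\<phi> div \<chi>" and ?r = "\<phi> mod \<chi>"
  have dq: "degree ?q < degree \<phi>" using degree_div_less[of \<phi> \<chi>] \<chi>(3) deg by auto
  have q0: "?q \<noteq> 0"
  proof
    assume "?q = 0"
    then have "?r = \<phi>" using div_mult_mod_eq[of \<phi> \<chi>] by simp
    then show False using degree_mod_lt[OF \<chi>(3), of \<phi>] d\<chi> by simp
  qed
  have qeq: "?q * \<chi> = \<phi> - ?r" by (simp add: minus_mod_eq_div_mult)
  have r: "\<nu> ?r = \<nu>' ?r" by (intro \<chi>(2) degree_mod_lt \<chi>(3))
  have uQ: "t \<notin> Q" if "u \<le> t" "t \<in> U" for t using no_tors[of t t] that by auto
  have uU: "u \<in> U" using \<nu> by (auto simp: U_def)
  have tors_r: "\<nu> ?r \<in> Fin ` Q" if "?r \<noteq> 0" using family_torsion[OF \<nu>(1) \<nu>'(1) lt r that] .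
  have sub: "\<mu> (\<phi> - ?r) = min (\<mu> \<phi>) (\<mu> ?r)" if "\<mu> \<in> V" "\<mu> \<phi> \<noteq> \<mu> ?r" for \<mu>
    using val_add_neq[OF family_valuation[OF that(1)], of \<phi> "- ?r"] that
    by (simp add: valuation_uminus[OF family_valuation[OF that(1)]])
  \<comment> \<open>For \<open>?r \<noteq> 0\<close> its value is torsion and u is not, so they
    differ. If it were below u, \<open>?q * \<chi>\<close> would have the value of \<open>?r\<close>
    under both \<nu> and \<nu>', although it must grow with \<chi>.\<close>
  have gt: "Fin u < \<nu> ?r"
  proof (rule ccontr)
    assume "\<not> ?thesis"
    moreover have "\<nu> ?r \<noteq> Fin u"
      using tors_r uQ[OF order_refl uU] val_zero[OF v] by (cases "?r = 0") auto
    ultimately have less: "\<nu> ?r < \<nu> \<phi>" using \<nu>(2) by auto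
    have less': "\<nu>' ?r < \<nu>' \<phi>" using less le[of \<phi>] r by simp
    have drop: "\<mu> (\<phi> - ?r) = \<mu> ?r" if "\<mu> \<in> V" "\<mu> ?r < \<mu> \<phi>" for \<mu>
      using sub[OF that(1)] that(2) by (metis min.absorb2 less_imp_le less_irrefl)
    have "\<nu> (?q * \<chi>) = \<nu>' (?q * \<chi>)"
      unfolding qeq drop[OF \<nu>(1) less] drop[OF \<nu>'(1) less'] by (rule r)
    then show False using val_quotient_increases[OF \<nu>(1) \<nu>' \<chi>(1) q0] by simp
  qed
  \<comment> \<open>Late enough for \<open>?q\<close> and \<chi> to have reached their torsion
    limits, so that \<open>?q * \<chi>\<close> has torsion value.\<close>
  obtain \<mu> where \<mu>: "\<mu> \<in> V" "\<mu> ?q = lim ?q" "\<mu> \<chi> = lim \<chi>" "\<nu>' \<le> \<mu>"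
    using ev_obtain[OF ev_conj[OF stable_lim[OF stable_small[OF dq]]
          ev_conj[OF stable_lim[OF stable_small[OF d\<chi>]] ev_ge[OF \<nu>'(1)]]]] by metis
  have "\<chi> \<noteq> 0" using \<chi>(3) by auto
  then obtain t1 t2 where t12: "t1 \<in> Q" "lim ?q = Fin t1" "t2 \<in> Q" "lim \<chi> = Fin t2"
    using stable_torsion[OF stable_small[OF dq] q0] stable_torsion[OF stable_small[OF d\<chi>]] by blast
  then have t: "\<mu> (?q * \<chi>) = Fin (t1 + t2)"
    by (simp add: val_mult[OF family_valuation[OF \<mu>(1)]] \<mu>(2,3))
  obtain u' where u': "\<mu> \<phi> = Fin u'" "u' \<in> U" using \<phi>_finite[OF \<mu>(1)] .
  have uu': "u \<le> u'"
  proof -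
    have "\<nu> \<phi> \<le> \<mu> \<phi>" using \<nu>'(2) \<mu>(4) by (metis le_fun_def order_trans)
    then show ?thesis using \<nu>(2) u'(1) by simp
  qed
  \<comment> \<open>For \<open>?r \<noteq> 0\<close> its torsion value at \<nu> exceeds u, hence by
    \<open>no_tors\<close> also u'. Then \<open>?q * \<chi>\<close> takes the value u' of \<phi>,
    which makes u' itself a forbidden torsion element.\<close>
  have "\<mu> \<phi> < \<mu> ?r"
  proof (cases "?r = 0")
    case False
    then obtain s where s: "s \<in> Q" "\<nu> ?r = Fin s" using tors_r by blast
    then have "u \<le> s" using gt by simp
    then have "u' < s" using no_tors[OF s(1) u'(2)] by simp
    then have "\<mu> \<phi> < \<nu>' ?r" using u'(1) s(2) r by (metis less_with_inf_simps(1))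
    also have "\<dots> \<le> \<mu> ?r" using \<mu>(4) by (simp add: le_fun_def)
    finally show ?thesis .
  qed (simp add: u'(1) val_zero[OF family_valuation[OF \<mu>(1)]])
  then have "\<mu> (?q * \<chi>) = \<mu> \<phi>" 
    unfolding qeq using sub[OF \<mu>(1)] by (metis min.absorb1 less_imp_le less_irrefl)
  then have "u' \<in> Q" using t u'(1) div_hull_add[OF t12(1,3)] by simp
  then show False using uQ[OF uu' u'(2)] by simp
qed

text \<open>The member with value u at \<phi> is already stationary in smaller degrees, so its
  values there are torsion; as u is not, it is the singular value of that member.\<close>

lemma representative_if_no_torsion:
  assumes u: "u \<in> U" and no_tors: "\<And>t u'. t \<in> Q \<Longrightarrow> u' \<in> U \<Longrightarrow> u \<le> t \<Longrightarrow> \<not> t \<le> u'"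
  shows "u \<in> \<Gamma>sme" "u \<notin> Q"
proof -
  obtain \<nu> where \<nu>: "\<nu> \<in> V" "\<nu> \<phi> = Fin u" using u by (auto simp: U_def)
  obtain \<nu>' where \<nu>': "\<nu>' \<in> V" "\<nu> < \<nu>'" using no_max[OF \<nu>(1)] by blast
  have tors: "\<nu> a \<in> Fin ` Q" if "a \<noteq> 0" "degree a < degree \<phi>" for a
  proof -
    have "\<nu> a = \<nu>' a"
      using stationary_if_no_torsion[OF \<nu> no_tors \<nu>'(1) less_imp_le[OF \<nu>'(2)] that(2)] .
    then show ?thesis using family_torsion[OF \<nu>(1) \<nu>'] that(1) by blast
  qed
  show uQ: "u \<notin> Q" using no_tors[of u u] u by auto
  have "KP \<nu> \<noteq> {}" "sv \<nu> = Fin u"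
    using sv_nontorsion[OF family_extends[OF \<nu>(1)] monic deg tors \<nu>(2) uQ] by simp_all
  then show "u \<in> \<Gamma>sme" using T_smeD(2)[of \<nu>] V \<nu>(1) by auto
qed

lemma torsion_cofinal:
  assumes u: "u \<in> U"
  shows "\<exists>t\<in>Q. \<exists>u'\<in>U. u \<le> t \<and> t \<le> u'"
proof (rule ccontr)
  assume "\<not> ?thesis"
  then have no: "\<not> t \<le> u'" if "t \<in> Q" "u' \<in> U" "u \<le> t" for t u' using that by blast
  obtain u1 where u1: "u1 \<in> U" "u < u1" using U_no_max[OF u] by blast
  have no1: "\<not> t \<le> u'" if "t \<in> Q" "u' \<in> U" "u1 \<le> t" for t u' using no that u1 by force
  note r = representative_if_no_torsion[OF u no] and r1 = representative_if_no_torsion[OF u1(1) no1]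
  have "t < u \<longleftrightarrow> t < u1" if "t \<in> Q" for t
    using no[OF that u1(1)] u1(2) by (meson less_imp_le less_trans not_le)
  then have "same_cut \<iota> u u1" using r r1 by (simp add: same_cut_def)
  then have "u = u1" using r r1 representatives_eq by blast
  then show False using u1(2) by simp
qed

text \<open>If the limits of remainder and product differed, the value of the quotient part would be
  their minimum and eventually constant, although that of \<phi> grows. The second claim is
  \<open>w_div\<close> with u' in place of \<gamma>.\<close>

lemma lim_mult_mod:
  assumes a: "degree a < degree \<phi>" and b: "degree b < degree \<phi>"
  shows "lim (a * b mod \<phi>) = lim a + lim b"
    and "u \<in> U \<Longrightarrow> \<exists>u'\<in>U. u \<le> u' \<and> lim a + lim b \<le> Fin u' + lim (a * b div \<phi>)"
proof -
  let ?q = "a * b div \<phi>" and ?r = "a * b mod \<phi>"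
  have dq: "degree ?q < degree \<phi>" by (rule degree_mult_div_less[OF a b])
  have dr: "degree ?r < degree \<phi>" by (rule degree_mod_lt[OF deg])
  have qeq: "?q * \<phi> = a * b + - ?r" by (simp add: minus_mod_eq_div_mult)
  note st = stable_lim[OF stable_small]
  have evs: "ev (\<lambda>\<nu>. \<nu> a = lim a \<and> \<nu> b = lim b \<and> \<nu> ?q = lim ?q \<and> \<nu> ?r = lim ?r)"
    by (intro ev_conj st a b dq dr)
  obtain \<nu> where \<nu>: "\<nu> \<in> V" "\<nu> a = lim a" "\<nu> b = lim b" "\<nu> ?q = lim ?q" "\<nu> ?r = lim ?r"
    and later: "\<And>\<nu>'. \<nu>' \<in> V \<Longrightarrow> \<nu> \<le> \<nu>' \<Longrightarrow> \<nu>' a = lim a \<and> \<nu>' b = lim b \<and> \<nu>' ?q = lim ?q \<and> \<nu>' ?r = lim ?r"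
    using ev_obtain[OF evs] by metis
  show eq: "lim ?r = lim a + lim b"
  proof (cases "?q = 0")
    case True
    then have "?r = a * b" using div_mult_mod_eq[of "a * b" \<phi>] by simp
    then show ?thesis using \<nu> val_mult[OF family_valuation[OF \<nu>(1)], of a b] by simp
  next
    case False
    obtain \<nu>' where \<nu>': "\<nu>' \<in> V" "\<nu> \<le> \<nu>'" "\<nu> \<phi> < \<nu>' \<phi>" using \<phi>_increases[OF \<nu>(1)] .
    have form: "\<mu> (?q * \<phi>) = min (lim a + lim b) (lim ?r)"
      if "\<mu> \<in> V" "\<nu> \<le> \<mu>" "lim ?r \<noteq> lim a + lim b" for \<mu>
    proof -
      note v = family_valuation[OF that(1)]
      have "\<mu> (a * b) = lim a + lim b" using later[OF that(1,2)] by (simp add: val_mult[OF v])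
      moreover have "\<mu> (- ?r) = lim ?r" using later[OF that(1,2)] by (simp add: valuation_uminus[OF v])
      ultimately show ?thesis unfolding qeq using val_add_neq[OF v, of "a * b" "- ?r"] that(3) by simp
    qed
    show ?thesis
    proof (rule ccontr)
      assume ne: "\<not> ?thesis"
      have "\<nu> (?q * \<phi>) = \<nu>' (?q * \<phi>)"
        unfolding form[OF \<nu>(1) order_refl ne] form[OF \<nu>'(1,2) ne] ..
      then show False using val_quotient_increases[OF \<nu>(1) \<nu>' False] by simp
    qed
  qed
  assume "u \<in> U"
  then obtain \<nu>0 where \<nu>0: "\<nu>0 \<in> V" "\<nu>0 \<phi> = Fin u" by (auto simp: U_def)
  obtain \<mu> where \<mu>: "\<mu> \<in> V" "\<nu> \<le> \<mu>" "\<nu>0 \<le> \<mu>" using chain[OF \<nu>(1) \<nu>0(1)] \<nu>(1) \<nu>0(1) by blast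
  note v = family_valuation[OF \<mu>(1)]
  obtain u' where u': "\<mu> \<phi> = Fin u'" "u' \<in> U" using \<phi>_finite[OF \<mu>(1)] .
  have "u \<le> u'" using \<mu>(3) \<nu>0(2) u'(1) by (metis le_fun_def less_eq_with_inf.simps(1))
  moreover have "lim a + lim b \<le> \<mu> (?q * \<phi>)"
    unfolding qeq using later[OF \<mu>(1,2)] eq
    by (intro val_add_ge[OF v]) (simp_all add: val_mult[OF v] valuation_uminus[OF v])
  then have "lim a + lim b \<le> Fin u' + lim ?q"
    using later[OF \<mu>(1,2)] u'(1) by (simp add: val_mult[OF v] add.commute)
  ultimately show "\<exists>u'\<in>U. u \<le> u' \<and> lim a + lim b \<le> Fin u' + lim ?q" using u'(2) by blast
qed

lemma U_nonempty: "U \<noteq> {}"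
  using nonempty \<phi>_finite by blast

lemma augmentation_data_lim:
  assumes "\<And>u. u \<in> U \<Longrightarrow> u < \<gamma>"
  shows "augmentation_data lim \<phi> \<gamma>"
proof
  fix a b :: "'k poly"
  assume a: "degree a < degree \<phi>"
  show "lim (- a) = lim a" by (rule lim_minus)
  assume b: "degree b < degree \<phi>"
  show "min (lim a) (lim b) \<le> lim (a + b)"
    using a b by (intro lim_add stable_small degree_add_less)
  show "lim (a * b mod \<phi>) = lim a + lim b" by (rule lim_mult_mod[OF a b])
  obtain u where "u \<in> U" using U_nonempty by blast
  then obtain u' where "u' \<in> U" "lim a + lim b \<le> Fin u' + lim (a * b div \<phi>)"
    using lim_mult_mod(2)[OF a b] by blast
  moreover have "Fin u' + x \<le> Fin \<gamma> + x" if "u' \<in> U" for x and u'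
    using assms[OF that] by (intro add_right_mono) simp
  ultimately show "lim a + lim b \<le> Fin \<gamma> + lim (a * b div \<phi>)" using order_trans by blast
qed (use deg lim_zero lim_one in auto)

text \<open>The bound holds termwise, so it could fail only if quotient part and remainder had equal
  values at all later members. But the remainder settles while the quotient part keeps
  growing.\<close>

lemma family_le_augmentation:
  assumes \<gamma>: "\<And>u. u \<in> U \<Longrightarrow> u < \<gamma>"
  shows "\<nu> \<in> V \<Longrightarrow> \<nu> f \<le> augmentation lim \<phi> \<gamma> f"
proof -
  interpret augmentation_data lim \<phi> \<gamma> by (rule augmentation_data_lim[OF \<gamma>])
  show "\<nu> \<in> V \<Longrightarrow> \<nu> f \<le> aug f"
  proof (induction "degree f" arbitrary: f \<nu> rule: less_induct)
    case less
    let ?q = "f div \<phi>" and ?r = "f mod \<phi>"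
    have st: "stable ?r" by (intro stable_small degree_mod_lt deg)
    have q: "\<mu> (?q * \<phi>) \<le> Fin \<gamma> + aug ?q" if \<mu>: "\<mu> \<in> V" for \<mu>
    proof (cases "?q = 0")
      case False
      then have "\<mu> ?q \<le> aug ?q" using less(1)[OF degree_div_\<phi>_less \<mu>] by blast
      moreover obtain u where "\<mu> \<phi> = Fin u" "u \<in> U" using \<phi>_finite[OF \<mu>] .
      then have "\<mu> \<phi> \<le> Fin \<gamma>" using \<gamma>[of u] by simp
      ultimately show ?thesis
        by (simp add: val_mult[OF family_valuation[OF \<mu>]] add.commute add_mono)
    qed simp
    have f: "f = ?q * \<phi> + ?r" by simp
    show ?case
    proof (rule ccontr)
      assume "\<not> ?case"
      then have gt: "aug f < \<mu> f" if "\<mu> \<in> V" "\<nu> \<le> \<mu>" for \<mu>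
        using that by (metis le_fun_def not_le order_trans)
      have eq: "\<mu> (?q * \<phi>) = \<mu> ?r" if \<mu>: "\<mu> \<in> V" "\<nu> \<le> \<mu>" for \<mu>
      proof (rule ccontr)
        assume "\<mu> (?q * \<phi>) \<noteq> \<mu> ?r"
        then have "\<mu> f = min (\<mu> (?q * \<phi>)) (\<mu> ?r)"
          using val_add_neq[OF family_valuation[OF \<mu>(1)], of "?q * \<phi>" ?r] by simp
        also have "\<dots> \<le> aug f"
          unfolding aug_rec[of f] using q[OF \<mu>(1)] lim_ge[OF st \<mu>(1)] by (auto simp: min_le_iff_disj)
        finally show False using gt[OF \<mu>] by simp
      qed
      show False
      proof (cases "?q = 0")
        case True
        then have "?r = f" using f by simp
        then have "aug f = lim f" using degree_mod_lt[OF deg, of f] by (simp add: aug_small)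
        then show False using gt[OF less(2)] lim_ge[OF st less(2)] \<open>?r = f\<close> by simp
      next
        case False
        obtain \<nu>1 where \<nu>1: "\<nu>1 \<in> V" "\<nu>1 ?r = lim ?r" "\<nu> \<le> \<nu>1"
          and later: "\<And>\<mu>. \<mu> \<in> V \<Longrightarrow> \<nu>1 \<le> \<mu> \<Longrightarrow> \<mu> ?r = lim ?r"
          using ev_obtain[OF ev_conj[OF stable_lim[OF st] ev_ge[OF less(2)]]] by metis
        obtain \<nu>2 where \<nu>2: "\<nu>2 \<in> V" "\<nu>1 \<le> \<nu>2" "\<nu>1 \<phi> < \<nu>2 \<phi>" using \<phi>_increases[OF \<nu>1(1)] .
        have "\<nu>1 (?q * \<phi>) = \<nu>2 (?q * \<phi>)"
          using eq[OF \<nu>1(1,3)] eq[OF \<nu>2(1)] \<nu>1(2,3) \<nu>2(2) later[OF \<nu>2(1,2)] by simp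
        then show False using val_quotient_increases[OF \<nu>1(1) \<nu>2 False] by simp
      qed
    qed
  qed
qed

lemma supremum_unstable:
  shows "\<exists>\<mu> \<in> T_sme v \<iota> \<Gamma>sme. (\<forall>\<nu>\<in>V. \<nu> \<le> \<mu>) \<and>
           (\<forall>\<mu>' \<in> T_sme v \<iota> \<Gamma>sme. (\<forall>\<nu>\<in>V. \<nu> \<le> \<mu>') \<and> \<mu>' \<le> \<mu> \<longrightarrow> \<mu>' = \<mu>)"
proof -
  obtain \<gamma> where \<gamma>: "\<gamma> \<in> \<Gamma>sme" "\<gamma> \<notin> Q" "\<And>u. u \<in> U \<Longrightarrow> u < \<gamma>"
    "\<And>\<gamma>'. \<gamma>' \<le> \<gamma> \<Longrightarrow> (\<And>u. u \<in> U \<Longrightarrow> u \<le> \<gamma>') \<Longrightarrow> same_cut \<iota> \<gamma>' \<gamma>"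
    using representative_above[OF U_no_max torsion_cofinal] by metis
  note data = augmentation_data_lim[OF \<gamma>(3)]
  interpret augmentation_data lim \<phi> \<gamma> by (rule data)
  note min = augmentation_minimal[OF data monic stable_const(2) stable_torsion[OF stable_small] \<gamma>(1,2)]
  show ?thesis
  proof (intro bexI[of _ aug] conjI ballI impI)
    show "aug \<in> T_sme v \<iota> \<Gamma>sme" by (rule min(1))
    show "\<nu> \<le> aug" if "\<nu> \<in> V" for \<nu> using family_le_augmentation[OF \<gamma>(3) that] by (simp add: le_fun_def)
    fix \<mu>' assume \<mu>': "\<mu>' \<in> T_sme v \<iota> \<Gamma>sme" "(\<forall>\<nu>\<in>V. \<nu> \<le> \<mu>') \<and> \<mu>' \<le> aug"
    have le: "\<mu>' f \<le> aug f" for f using \<mu>'(2) by (simp add: le_fun_def)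
    obtain \<gamma>' where \<gamma>': "\<mu>' \<phi> = Fin \<gamma>'" "\<gamma>' \<le> \<gamma>" using le[of \<phi>] aug_\<phi> by (cases "\<mu>' \<phi>") auto
    have "u \<le> \<gamma>'" if "u \<in> U" for u
    proof -
      obtain \<nu> where "\<nu> \<in> V" "\<nu> \<phi> = Fin u" using \<open>u \<in> U\<close> by (auto simp: U_def)
      then show ?thesis using \<mu>'(2) \<gamma>'(1) by (metis le_fun_def less_eq_with_inf.simps(1))
    qed
    then have cut: "same_cut \<iota> \<gamma>' \<gamma>" using \<gamma>(4) \<gamma>'(2) by blast
    \<comment> \<open>Squeezed: the limit bounds \<mu>' from below, and aug equals the limit in
      these degrees.\<close>
    have small: "\<mu>' a = lim a" if "degree a < degree \<phi>" for a
      using lim_le[OF stable_small[OF that], of \<mu>'] \<mu>'(2) le[of a] aug_small[OF that] by (intro antisym) auto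
    show "\<mu>' = aug"
      by (rule min(2)[OF _ _ _ \<mu>'(1) _ small \<gamma>'(1) cut]) (use \<mu>'(2) in auto)
  qed
qed

end

context increasing_family
begin

lemma supremum_exists:
  "\<exists>\<mu> \<in> T_sme v \<iota> \<Gamma>sme. (\<forall>\<nu>\<in>V. \<nu> \<le> \<mu>) \<and>
     (\<forall>\<mu>' \<in> T_sme v \<iota> \<Gamma>sme. (\<forall>\<nu>\<in>V. \<nu> \<le> \<mu>') \<and> \<mu>' \<le> \<mu> \<longrightarrow> \<mu>' = \<mu>)"
proof (cases "\<forall>f. stable f")
  case False
  then obtain \<psi> where \<psi>: "\<not> stable \<psi>" "\<And>g. \<not> stable g \<Longrightarrow> degree \<psi> \<le> degree g"
    using ex_has_least_nat[of "\<lambda>g. \<not> stable g" _ degree] by blast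
  \<comment> \<open>Normalisation to a monic polynomial; instability survives because constants are
    stable and stable polynomials are closed under products.\<close>
  define c where "c = inverse (lead_coeff \<psi>)"
  have "\<psi> \<noteq> 0" using \<psi>(1) stable_const(1)[of 0] by auto
  then have c: "c \<noteq> 0" "lead_coeff (smult c \<psi>) = 1" by (simp_all add: c_def)
  have "\<psi> = [:inverse c:] * smult c \<psi>" using c by simp
  moreover have "stable (f * g)" if "stable f" "stable g" for f g
  proof -
    have "ev (\<lambda>\<nu>. \<nu> (f * g) = lim f + lim g)"
      using ev_conj[OF stable_lim[OF that(1)] stable_lim[OF that(2)]] val_mult[OF family_valuation]
      unfolding ev_def by metis
    then show ?thesis by (rule stable_eq)
  qed
  ultimately have "\<not> stable (smult c \<psi>)" using \<psi>(1) stable_const(1) by metis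
  moreover have "stable a" if "degree a < degree (smult c \<psi>)" for a using that \<psi>(2) c(1) by (metis degree_smult_eq not_le)
  ultimately interpret unstable_family \<iota> \<Gamma>sme v V "smult c \<psi>" using c(2) by unfold_locales
  show ?thesis by (rule supremum_unstable)
qed (use supremum_all_stable in blast)

end

text \<open>The witness is the Gauss valuation sending \<open>x\<close> below all of \<open>Q\<close>.\<close>

lemma (in sme_setting) minimal_element_exists:
  fixes v :: "'k::field \<Rightarrow> 'g with_inf"
  assumes v: "valuation v"
  shows "\<exists>\<mu> \<in> T_sme v \<iota> \<Gamma>sme. \<forall>\<mu>' \<in> T_sme v \<iota> \<Gamma>sme. \<mu>' \<le> \<mu> \<longrightarrow> \<mu>' = \<mu>"
proof -
  \<comment> \<open>For the empty U the hypotheses are vacuous, and everything below \<gamma> lies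
    in its cut.\<close>
  obtain \<gamma> where \<gamma>: "\<gamma> \<in> \<Gamma>sme" "\<gamma> \<notin> Q" "\<And>\<gamma>'. \<gamma>' \<le> \<gamma> \<Longrightarrow> same_cut \<iota> \<gamma>' \<gamma>"
    using representative_above[of "{}"] by (metis empty_iff)
  define w :: "'k poly \<Rightarrow> 'g sme_index hahn with_inf" where "w a = map_with_inf \<iota> (v (coeff a 0))" for a
  let ?x = "[:0, 1:] :: 'k poly"
  have map_add: "map_with_inf \<iota> (x + y) = map_with_inf \<iota> x + map_with_inf \<iota> y" for x y
    by (cases x; cases y) (auto simp: emb_add)
  have map_le: "map_with_inf \<iota> x \<le> map_with_inf \<iota> y \<longleftrightarrow> x \<le> y" for x y
    by (cases x; cases y) auto
  have map_min: "min (map_with_inf \<iota> x) (map_with_inf \<iota> y) = map_with_inf \<iota> (min x y)" for x y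
    by (simp add: min_def map_le)
  have small: "a = [:coeff a 0:]" if "degree a < degree ?x" for a :: "'k poly"
    using that by (auto elim: degree_eq_zeroE)
  have data: "augmentation_data w ?x \<gamma>"
  proof
    show "w 0 = Infty" "w 1 = 0" by (simp_all add: w_def val_zero[OF v] val_one[OF v] zero_with_inf_def)
    fix a b :: "'k poly"
    assume a: "degree a < degree ?x"
    show "w (- a) = w a" by (simp add: w_def valuation_uminus[OF v])
    assume b: "degree b < degree ?x"
    show "min (w a) (w b) \<le> w (a + b)" by (simp add: w_def map_min map_le val_add[OF v])
    have ab: "degree (a * b) < degree ?x" using a b degree_mult_le[of a b] by simp
    show "w (a * b mod ?x) = w a + w b"
      unfolding mod_poly_less[OF ab] by (simp add: w_def coeff_mult val_mult[OF v] map_add)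
    \<comment> \<open>Constants produce no carry: the quotient is 0, of value
      \<open>Infty\<close>.\<close>
    show "w a + w b \<le> Fin \<gamma> + w (a * b div ?x)"
      unfolding div_poly_less[OF ab] by (simp add: w_def val_zero[OF v])
  qed simp
  interpret augmentation_data w ?x \<gamma> by (rule data)
  have const: "w [:c:] = map_with_inf \<iota> (v c)" for c by (simp add: w_def)
  have tors: "w a \<in> Fin ` Q" if a: "a \<noteq> 0" "degree a < degree ?x" for a
  proof -
    define c where "c = coeff a 0"
    have "c \<noteq> 0" using small[OF a(2)] a(1) by (auto simp: c_def)
    then have "v c + v (inverse c) = 0" using val_mult[OF v, of c "inverse c"] val_one[OF v] by simp
    then obtain g where "v c = Fin g" by (cases "v c") (auto simp: zero_with_inf_def)
    then show ?thesis by (simp add: w_def flip: c_def)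
  qed
  note min = augmentation_minimal[OF data _ const tors \<gamma>(1,2)]
  show ?thesis
  proof (intro bexI[of _ aug] ballI impI)
    show "aug \<in> T_sme v \<iota> \<Gamma>sme" by (rule min(1)) simp_all
    fix \<mu>' assume \<mu>': "\<mu>' \<in> T_sme v \<iota> \<Gamma>sme" "\<mu>' \<le> aug"
    have "\<mu>' ?x \<le> aug ?x" using \<mu>'(2) by (simp add: le_fun_def)
    then obtain \<gamma>' where \<gamma>': "\<mu>' ?x = Fin \<gamma>'" "\<gamma>' \<le> \<gamma>" using aug_\<phi> by (cases "\<mu>' ?x") auto
    have "\<mu>' a = w a" if "degree a < degree ?x" for a
      using T_smeD(1)[OF \<mu>'(1)] const small[OF that] by (metis extends_def)
    then show "\<mu>' = aug" using min(2)[OF _ _ _ \<mu>' _ \<gamma>'(1) \<gamma>(3)[OF \<gamma>'(2)]] by simp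
  qed
qed

theorem mainTheorem2:
  fixes v :: "'k::field \<Rightarrow> 'g::linordered_ab_group_add with_inf"
    and \<iota> :: "'g \<Rightarrow> 'g sme_index hahn"
    and \<Gamma>sme :: "'g sme_index hahn set"
    and V :: "('k poly \<Rightarrow> 'g sme_index hahn with_inf) set"
  assumes "valuation v" and "value_group v = UNIV"
    and "hahn_embedding \<iota>"
    and "sme_representatives \<iota> \<Gamma>sme"
    and "V \<subseteq> T_sme v \<iota> \<Gamma>sme"
    and "\<forall>\<nu>\<^sub>1\<in>V. \<forall>\<nu>\<^sub>2\<in>V. \<nu>\<^sub>1 \<le> \<nu>\<^sub>2 \<or> \<nu>\<^sub>2 \<le> \<nu>\<^sub>1"
    and "\<nexists>\<mu>. \<mu> \<in> V \<and> (\<forall>\<nu>\<in>V. \<nu> \<le> \<mu>)"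
  shows "\<exists>\<mu> \<in> T_sme v \<iota> \<Gamma>sme. (\<forall>\<nu>\<in>V. \<nu> \<le> \<mu>) \<and>
           (\<forall>\<mu>' \<in> T_sme v \<iota> \<Gamma>sme. (\<forall>\<nu>\<in>V. \<nu> \<le> \<mu>') \<and> \<mu>' \<le> \<mu> \<longrightarrow> \<mu>' = \<mu>)"
proof -
  interpret sme_setting \<iota> \<Gamma>sme by unfold_locales fact+
  show ?thesis
  proof (cases "V = {}")
    case True
    \<comment> \<open>Everything bounds the empty family, so a minimal element of the whole tree is
      required.\<close>
    then show ?thesis using minimal_element_exists[OF assms(1)] by simp
  next
    case False
    have "\<exists>\<nu>'\<in>V. \<nu> < \<nu>'" if "\<nu> \<in> V" for \<nu>
      using assms(6,7) that by (metis order_less_le order_refl)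
    then interpret increasing_family \<iota> \<Gamma>sme v V
      using assms(5,6) False by unfold_locales blast+
    show ?thesis by (rule supremum_exists)
  qed
qed

end
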